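(* Consider the DSCMD-N iteration described in the context, and suppose that the network, stochastic-subgradient, noise and mirror-map assumptions listed in the context hold and that $\{\alpha_t\}_{t\ge0}$, $\{r_t\}_{t\ge0}$ are positive non-increasing sequences. Assume in addition that $\|\tilde g_i^t\|\le G_f$ and $\|\xi_{ij}^t\|^2\le\nu$ for all $i,j\in\mathcal V$ and all $t$. Then for every $l\in\mathcal V$, every integer $T\ge1$ and every $\delta\in(0,1)$, with probability at least $1-\delta$, the average $\hat x_l^T=\frac1T\sum_{t=1}^Tx_l^t$ satisfies $$F(\hat x_l^T)-F(x^* )\le \frac{C_1}{T}+\frac{C_2}{T\alpha_T}+\frac{C_3}{T}\sum_{t=0}^T\alpha_t+\frac{C_4}{T}\sum_{t=0}^T r_t+\frac{C_5}{T}\sum_{t=0}^T\frac{r_t}{\alpha_t}+\frac{C_6}{T}\sum_{t=0}^T\frac{r_t^2}{\alpha_t}+2\sqrt2\,G_fD_{\mathcal X}N\frac{\sqrt{\log(1/\delta)}}{\sqrt T},$$ where $C_1,\dots,C_6$ are the constants defined in the context.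
   Context: Problem. $\mathcal V=\{1,\dots,N\}$ is a set of agents; $\mathcal X\subseteq\mathbb R^n$ is nonempty, convex and compact; $f_i,\chi_i:\mathbb R^n\to\mathbb R$ ($i\in\mathcal V$) are convex, possibly nonsmooth; $F_i=f_i+\chi_i$, $F=\sum_{i=1}^N F_i$. The problem is to minimize $F$ over $\mathcal X$; $\mathcal X^*$ is the set of minimizers and $x^*\in\mathcal X^*$. $\|\cdot\|$ is the Euclidean norm. $G_\chi=\max_{i\in\mathcal V}\sup\{\|g\|:g\in\partial\chi_i(x),\,x\in\mathcal X\}$. $D_{\mathcal X}=\sup_{x,y\in\mathcal X}\|x-y\|$. Mirror map. $\Phi:\mathbb R^n\to\mathbb R$ is continuously differentiable and $\sigma_\Phi$-strongly convex ($\sigma_\Phi>0$): $\Phi(x)\ge\Phi(y)+\langle\nabla\Phi(y),x-y\rangle+\frac{\sigma_\Phi}{2}\|x-y\|^2$. Its Bregman divergence is $D_\Phi(x,y)=\Phi(x)-\Phi(y)-\langle\nabla\Phi(y),x-y\rangle$, and $D_{\Phi,\mathcal X}^2=\sup_{x,y\in\mathcal X}D_\Phi(x,y)$ with $D_{\Phi,\mathcal X}\ge 0$. DSCMD-N. Starting from deterministic $x_i^0\in\mathcal X$, with stepsizes $\alpha_t>0$ and noise magnitudes $r_t>0$, for $t=0,1,2,\dots$ and $i\in\mathcal V$: $$y_i^t=\sum_{j=1}^N[P^t]_{ij}(x_j^t+r_t\xi_{ij}^t),\qquad x_i^{t+1}=\arg\min_{x\in\mathcal X}\Big\{\langle\tilde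 g_i^t,x\rangle+\frac1{\alpha_t}D_\Phi(x,y_i^t)+\chi_i(x)\Big\}.$$ Here $P^t$ is an $N\times N$ weight matrix, $\xi_{ij}^t$ is a random vector in $\mathbb R^n$, and $\tilde g_i^t=\tilde g_i(y_i^t)$ is a stochastic subgradient of $f_i$ queried at $y_i^t$. $\mathcal F_t$ is the $\sigma$-algebra of the history up to time $t$ ($\mathcal F_{-1}$ trivial); all processes are adapted, the noises and stochastic subgradients of time $t$ being $\mathcal F_t$-measurable. Network assumption. Each $P^t$ is doubly stochastic with nonnegative entries; $E^t=\{(i,j):[P^t]_{ij}>0\}$; there is an integer $B\ge1$ such that the graph $(\mathcal V,\bigcup_{t=sB+1}^{(s+1)B}E^t)$ is strongly connected for every $s\ge0$; there is $\theta\in(0,1)$ with $[P^t]_{ii}\ge\theta$ for all $i,t$ and $[P^t]_{ij}\ge\theta$ whenever $(j,i)\in E^t$. Stochastic-subgradient assumption. There is $G_f\ge0$ such that at any $x\in\mathcal X$, $\mathbb E[\tilde g_i(x)\mid\mathcal F_{t-1}]=g_i(x)\in\partial f_i(x)$ and $\mathbb E[\|\tilde g_i(x)\|^2\mid\mathcal F_{t-1}]\le G_f^2$; the same holds at the query points: conditionally on $\mathcal F_{t-1}$ and the time-$t$ noises, $\tilde g_i^t$ has mean $g_i(y_i^t)\in\partial f_i(y_i^t)$ and second moment (of the norm) at most $G_f^2$. Noise assumption. At each time $t$, the noise on link $(i,j)$ is independent of the noise on link $(i',j')$ for $i\ne i'$, $j\neq j'$; and $\mathbb E[\|\xi_{ij}^t\|^2\mid\mathcal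 F_{t-1}]\le\nu$ for all $i,j\in\mathcal V$ and $t$. Mirror-map assumption. $\|\nabla\Phi(x)-\nabla\Phi(y)\|\le L_\Phi\|x-y\|$ for all $x,y\in\mathbb R^n$; and $D_\Phi(a,\sum_{i=1}^N\nu_ib_i)\le\sum_{i=1}^N\nu_iD_\Phi(a,b_i)$ for all $a,b_1,\dots,b_N\in\mathbb R^n$ and $\nu_i\in[0,1]$ with $\sum_i\nu_i=1$. Constants. With $\omega=(1-\frac{\theta}{4N^2})^{-2}$ and $\gamma=(1-\frac{\theta}{4N^2})^{1/B}$: $C_1=\frac{2N\omega}{1-\gamma}[(N+1)G_f+NG_\chi]\sum_{j=1}^N\|x_j^0\|$; $C_2=ND_{\Phi,\mathcal X}^2$; $C_3=\big((4N+\frac{2N^2\omega}{1-\gamma})[(N+1)G_f+NG_\chi]+NG_\chi\big)\frac{G_f+G_\chi}{\sigma_\Phi}+\frac{NG_f^2}{2\sigma_\Phi}$; $C_4=(4N+\frac{2N^2\omega}{1-\gamma})[(N+1)G_f+NG_\chi]N\sqrt\nu+(G_f+G_\chi)N^2\sqrt\nu$; $C_5=\sqrt{2/\sigma_\Phi}\,D_{\Phi,\mathcal X}L_\Phi N\sqrt\nu$; $C_6=NL_\Phi\nu$. *)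

theory Defs
  imports
    "Graph_Theory.Digraph_Component"
    "HOL-Probability.Probability"
begin

definition subdifferential :: "('a::real_inner \<Rightarrow> real) \<Rightarrow> 'a \<Rightarrow> 'a set" where
  "subdifferential f x = {g. \<forall>z. f z \<ge> f x + g \<bullet> (z - x)}"

text \<open>\<open>d\<Phi>\<close> stands for the gradient of \<open>\<Phi>\<close>.\<close>

definition bregman :: "('a::real_inner \<Rightarrow> real) \<Rightarrow> ('a \<Rightarrow> 'a) \<Rightarrow> 'a \<Rightarrow> 'a \<Rightarrow> real" where
  "bregman \<Phi> d\<Phi> x y = \<Phi> x - \<Phi> y - d\<Phi> y \<bullet> (x - y)"

definition doubly_stochastic :: "real^'v^'v \<Rightarrow> bool" where
  "doubly_stochastic P \<longleftrightarrow>
     (\<forall>i j. P $ i $ j \<ge> 0) \<and>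
     (\<forall>i. (\<Sum>j\<in>UNIV. P $ i $ j) = 1) \<and> (\<forall>j. (\<Sum>i\<in>UNIV. P $ i $ j) = 1)"

definition edges :: "real^'v^'v \<Rightarrow> ('v \<times> 'v) set" where
  "edges P = {(i, j). P $ i $ j > 0}"

text \<open>
  If \<open>F t\<close> is the history up to time \<open>t\<close>, then \<open>past M F t\<close> is the history up to
  time \<open>t - 1\<close>; for \<open>t = 0\<close> it is the trivial sigma-algebra.
\<close>

definition past :: "'w measure \<Rightarrow> (nat \<Rightarrow> 'w measure) \<Rightarrow> nat \<Rightarrow> 'w measure" where
  "past M F t = (case t of 0 \<Rightarrow> sigma (space M) {} | Suc s \<Rightarrow> F s)"

text \<open>The sigma-algebra generated by the history up to time \<open>t - 1\<close> and all the noises of time \<open>t\<close>.\<close>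

definition past_and_noise ::
    "'w measure \<Rightarrow> (nat \<Rightarrow> 'w measure) \<Rightarrow> (nat \<Rightarrow> 'v \<Rightarrow> 'v \<Rightarrow> 'w \<Rightarrow> real^'n) \<Rightarrow> nat \<Rightarrow> 'w measure" where
  "past_and_noise M F \<xi> t =
     sigma (space M)
       (sets (past M F t) \<union> {\<xi> t i j -` A \<inter> space M | i j A. A \<in> sets borel})"

text \<open>
  Conditional expectation of a random vector, component by component. It is meaningful only for
  integrable vectors; square integrability of the stochastic subgradients is expressed
  through \<^const>\<open>nn_cond_exp\<close>, which, unlike \<^const>\<open>real_cond_exp\<close>, does not
  turn an infinite conditional expectation into zero.
\<close>

definition vec_cond_exp :: "'w measure \<Rightarrow> 'w measure \<Rightarrow> ('w \<Rightarrow> real^'n) \<Rightarrow> 'w \<Rightarrow> real^'n" where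
  "vec_cond_exp M G Z \<omega> = (\<chi> k. real_cond_exp M G (\<lambda>\<omega>'. Z \<omega>' $ k) \<omega>)"

end

theory Submission
  imports Defs
begin

text \<open>
  Let \<open>G = Gf + Gchi\<close>, and let \<open>ybar t i\<close> be the noise-free average of the \<open>x t j\<close>, which lies in \<open>X\<close>.
  The three-point inequality for the mirror step gives the usual descent estimate, and replacing the
  query point \<open>y t i\<close> by \<open>ybar t i\<close> in the martingale part makes its increments bounded by
  \<open>2 N Gf DX\<close>, so that Azuma-Hoeffding applies.

  The delicate point is the consensus error. As \<open>y t i\<close> may leave \<open>X\<close>, the displacement
  \<open>norm (x (Suc t) i - ybar t i)\<close> is only bounded by \<open>(\<alpha> G + L r sqrt \<nu>) / \<sigma>\<close>, and the term with \<open>L / \<sigma>\<close>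
  is not covered by \<open>C4\<close>. Let \<open>\<tau>\<close> be the last time \<open>t \<le> T\<close> with \<open>(\<Sum>s=1..t. L sqrt \<nu> r s / \<alpha> s) \<ge> G t\<close>.
  Up to time \<open>\<tau>\<close> the trivial bound \<open>N G DX\<close> on the loss is paid for by the \<open>C5\<close> sum. After \<open>\<tau>\<close>,
  Abel summation against the non-increasing stepsizes bounds the sum of the \<open>L sqrt \<nu> r\<close> by that of the
  \<open>\<alpha> G\<close>, which the slack in the network constant of \<open>C3\<close> absorbs. The disagreement present at
  time \<open>\<tau>\<close> costs a multiple of \<open>DX\<close>, and \<open>DX \<le> 2 G / \<sigma> (\<Sum>t=1..T. \<alpha> t)\<close> unless \<open>C2 / \<alpha> T\<close> alone
  dominates the trivial bound.

  For the mixing rate, consider one coordinate over a window of \<open>B\<close> steps. Its sorted values have a gap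
  of at least \<open>1 / N\<close> of their range, and the first edge crossing this gap decreases the
  sum of squared deviations by \<open>\<theta> / 2\<close> times the squared gap.
\<close>

section \<open>Subgradients\<close>

text \<open>A hyperplane separates \<open>(z, f z)\<close> from the strict epigraph of
  \<open>f\<close>. It cannot be vertical because \<open>f\<close> is finite everywhere, so its
  normal can be scaled to have last component one; the other component is then minus a
  subgradient.\<close>

lemma subgradient_exists:
  fixes f :: "'a::euclidean_space \<Rightarrow> real"
  assumes "convex_on UNIV f"
  obtains s where "s \<in> subdifferential f z"
proof -
  let ?T = "{(x, y). f x < y}"
  have cT: "convex ?T"
  proof (rule convexI, clarsimp)
    fix x x' and y y' u v :: real
    assume a: "f x < y" "f x' < y'" "0 \<le> u" "0 \<le> v" "u + v = 1"
    have "f (u *\<^sub>R x + v *\<^sub>R x') \<le> u * f x + v * f x'"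
      using assms a unfolding convex_on_def by auto
    also have "\<dots> < u * y + v * y'"
    proof (cases "u = 0")
      case False
      then have "u * f x < u * y" using a by simp
      moreover have "v * f x' \<le> v * y'" using a by (intro mult_left_mono) auto
      ultimately show ?thesis by simp
    qed (use a in auto)
    finally show "f (u *\<^sub>R x + v *\<^sub>R x') < u * y + v * y'" .
  qed
  have "(z, f z + 1) \<in> ?T" by simp
  then have "?T \<noteq> {}" "{(z, f z)} \<inter> ?T = {}" by blast+
  then obtain a b where a: "a \<noteq> 0" "a \<bullet> (z, f z) \<le> b" "\<And>w. w \<in> ?T \<Longrightarrow> b \<le> a \<bullet> w"
    using separating_hyperplane_sets[of "{(z, f z)}" ?T] cT by auto
  obtain p c where pc: "a = (p, c)" by (cases a)
  have ineq: "p \<bullet> z + c * f z \<le> p \<bullet> x + c * y" if "f x < y" for x y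
    using a(2) a(3)[of "(x, y)"] that by (simp add: pc)
  have "0 \<le> c"
    using ineq[of z "f z + 1"] by (simp add: algebra_simps)
  have "c \<noteq> 0"
  proof
    assume "c = 0"
    then have "p \<bullet> z \<le> p \<bullet> (z - p)"
      using ineq[of "z - p" "f (z - p) + 1"] by simp
    then have "p \<bullet> p \<le> 0" by (simp add: inner_diff_right)
    then have "p = 0" by (metis inner_eq_zero_iff inner_ge_zero order_antisym)
    with \<open>c = 0\<close> a(1) show False by (simp add: pc zero_prod_def)
  qed
  with \<open>0 \<le> c\<close> have c: "c > 0" by simp
  have "f x \<ge> f z + (- (1 / c)) *\<^sub>R p \<bullet> (x - z)" for x
  \<comment> \<open>The epigraph is strict, so \<open>(x, f x)\<close> is only approached from
    above.\<close>
  proof (rule field_le_epsilon)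
    fix e :: real assume "e > 0"
    then have "p \<bullet> z + c * f z \<le> p \<bullet> x + c * (f x + e)" by (intro ineq) simp
    then show "f z + (- (1 / c)) *\<^sub>R p \<bullet> (x - z) \<le> f x + e"
      using c by (simp add: field_simps inner_diff_right)
  qed
  then show thesis by (intro that[of "(- (1 / c)) *\<^sub>R p"]) (auto simp: subdifferential_def)
qed

text \<open>A unit step from \<open>z\<close> along \<open>s\<close> raises \<open>f\<close> by at
  least \<open>norm s\<close>, and \<open>f\<close> is bounded on the compact unit neighbourhood
  \<open>K\<close> of \<open>X\<close>.\<close>

lemma bdd_above_subgradient_norms:
  fixes f :: "'a::euclidean_space \<Rightarrow> real"
  assumes "convex_on UNIV f" "compact X"
  shows "bdd_above {norm s | s z. z \<in> X \<and> s \<in> subdifferential f z}"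
proof -
  have cont: "continuous_on UNIV f" using assms convex_on_continuous by blast
  define K where "K = {x + y | x y. x \<in> X \<and> y \<in> cball 0 (1::real)}"
  have "compact K" unfolding K_def by (intro compact_sums assms compact_cball)
  then have "bounded (f ` K)"
    using cont by (intro compact_imp_bounded compact_continuous_image) (auto intro: continuous_on_subset)
  then obtain m where m: "\<And>x. x \<in> K \<Longrightarrow> \<bar>f x\<bar> \<le> m" by (auto simp: bounded_iff)
  show ?thesis
  proof (rule bdd_aboveI[of _ "2 * m"], clarify)
    fix s z assume z: "z \<in> X" and s: "s \<in> subdifferential f z"
    have K: "z \<in> K" "z + sgn s \<in> K"
      unfolding K_def using z by (force simp: norm_sgn)+
    have "f z + s \<bullet> sgn s \<le> f (z + sgn s)" using s by (auto simp: subdifferential_def dest: spec[of _ "z + sgn s"])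
    moreover have "s \<bullet> sgn s = norm s"
      by (simp add: sgn_div_norm power2_norm_eq_inner[symmetric] power2_eq_square divide_simps)
    ultimately show "norm s \<le> 2 * m" using m[OF K(1)] m[OF K(2)] by linarith
  qed
qed

text \<open>Only the subgradient at \<open>a\<close> enters, so \<open>b\<close> is arbitrary. Later
  \<open>a\<close> is an iterate in \<open>X\<close> while \<open>b\<close> may be a query point
  outside \<open>X\<close>.\<close>

lemma subgradient_norm_le_imp_diff_le:
  assumes "s \<in> subdifferential f a" "norm s \<le> G"
  shows "f a - f b \<le> G * norm (a - b)"
proof -
  have "f a - f b \<le> s \<bullet> (a - b)"
    using assms(1) by (auto simp: subdifferential_def inner_diff_right algebra_simps dest: spec[of _ b])
  also have "\<dots> \<le> norm s * norm (a - b)" by (rule norm_cauchy_schwarz)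
  also have "\<dots> \<le> G * norm (a - b)" by (intro mult_right_mono assms) auto
  finally show ?thesis .
qed

lemma convex_diff_le_Sup_subgradient_norms:
  fixes f :: "'a::euclidean_space \<Rightarrow> real"
  assumes "convex_on UNIV f" "compact X" "a \<in> X"
  shows "f a - f b \<le> Sup {norm s | s z. z \<in> X \<and> s \<in> subdifferential f z} * norm (a - b)"
proof -
  obtain s where s: "s \<in> subdifferential f a" using subgradient_exists assms(1) by blast
  have "norm s \<le> Sup {norm s | s z. z \<in> X \<and> s \<in> subdifferential f z}"
    using s assms(3) by (intro cSup_upper bdd_above_subgradient_norms assms) auto
  then show ?thesis by (rule subgradient_norm_le_imp_diff_le[OF s])
qed

lemma Sup_subgradient_norms_nonneg:
  fixes f :: "'a::euclidean_space \<Rightarrow> real"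
  assumes "convex_on UNIV f" "compact X" "X \<noteq> {}"
  shows "0 \<le> Sup {norm s | s z. z \<in> X \<and> s \<in> subdifferential f z}"
proof -
  obtain a s where "a \<in> X" "s \<in> subdifferential f a"
    using subgradient_exists assms by (metis ex_in_conv)
  then have "norm s \<le> Sup {norm s | s z. z \<in> X \<and> s \<in> subdifferential f z}"
    by (intro cSup_upper bdd_above_subgradient_norms assms) auto
  then show ?thesis using norm_ge_zero[of s] by linarith
qed

section \<open>Bregman divergences and proximal steps\<close>

locale mirror_map =
  fixes \<Phi> :: "'a::real_inner \<Rightarrow> real" and d\<Phi> :: "'a \<Rightarrow> 'a" and \<sigma> L :: real
  assumes \<sigma>_pos: "\<sigma> > 0"
    and strong_convex: "\<And>a b. \<Phi> a \<ge> \<Phi> b + d\<Phi> b \<bullet> (a - b) + \<sigma> / 2 * (norm (a - b))\<^sup>2"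
    and lipschitz: "\<And>a b. norm (d\<Phi> a - d\<Phi> b) \<le> L * norm (a - b)"
begin

abbreviation "D \<equiv> bregman \<Phi> d\<Phi>"

lemma bregman_ge: "\<sigma> / 2 * (norm (a - b))\<^sup>2 \<le> D a b"
  using strong_convex[of b a] by (simp add: bregman_def)

lemma bregman_nonneg: "0 \<le> D a b"
  using bregman_ge[of a b] \<sigma>_pos by (smt (verit) divide_nonneg_nonneg mult_nonneg_nonneg zero_le_power2)

lemma gradient_strongly_monotone: "\<sigma> * (norm (a - b))\<^sup>2 \<le> (d\<Phi> a - d\<Phi> b) \<bullet> (a - b)"
  using strong_convex[of b a] strong_convex[of a b]
  by (simp add: norm_minus_commute inner_diff_left inner_diff_right algebra_simps)

text \<open>Strong monotonicity and the Lipschitz bound give \<open>\<sigma> \<le> L\<close> as soon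
  as there are two distinct points.\<close>

lemma L_pos: assumes "(a::'a) \<noteq> b" shows "L > 0"
proof -
  have "\<sigma> * (norm (a - b))\<^sup>2 \<le> norm (d\<Phi> a - d\<Phi> b) * norm (a - b)"
    using gradient_strongly_monotone norm_cauchy_schwarz order_trans by blast
  also have "\<dots> \<le> L * norm (a - b) * norm (a - b)" by (intro mult_right_mono lipschitz) auto
  finally have "\<sigma> * (norm (a - b))\<^sup>2 \<le> L * (norm (a - b))\<^sup>2" by (simp add: power2_eq_square mult.assoc)
  then show ?thesis using assms \<sigma>_pos by (simp add: mult_le_cancel_right)
qed

lemma bregman_three_point: "(d\<Phi> b - d\<Phi> c) \<bullet> (a - b) = D a c - D a b - D b c"
  by (simp add: bregman_def inner_diff_left inner_diff_right algebra_simps)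

text \<open>Expanding around \<open>b\<close> leaves \<open>D b b'\<close>, which is at most the
  symmetrised divergence \<open>D b b' + D b' b\<close>, an inner product that the Lipschitz bound
  controls. The quadratic factor \<open>L\<close> is the one that reappears in
  \<open>C6\<close>.\<close>

lemma bregman_perturb:
  "D a b' \<le> D a b + L * norm (b' - b) * norm (a - b) + L * (norm (b' - b))\<^sup>2"
proof -
  have "D a b' = D a b + D b b' + (d\<Phi> b - d\<Phi> b') \<bullet> (a - b)"
    by (simp add: bregman_def inner_diff_left inner_diff_right algebra_simps)
  moreover have "D b b' \<le> (d\<Phi> b - d\<Phi> b') \<bullet> (b - b')"
    using bregman_nonneg[of b' b] by (simp add: bregman_def inner_diff_left inner_diff_right algebra_simps)
  moreover have "(d\<Phi> b - d\<Phi> b') \<bullet> (b - b') \<le> L * (norm (b' - b))\<^sup>2"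
  proof -
    have "(d\<Phi> b - d\<Phi> b') \<bullet> (b - b') \<le> norm (d\<Phi> b - d\<Phi> b') * norm (b - b')" by (rule norm_cauchy_schwarz)
    also have "\<dots> \<le> L * norm (b - b') * norm (b - b')" by (intro mult_right_mono lipschitz) auto
    finally show ?thesis by (simp add: power2_eq_square norm_minus_commute)
  qed
  moreover have "(d\<Phi> b - d\<Phi> b') \<bullet> (a - b) \<le> L * norm (b' - b) * norm (a - b)"
  proof -
    have "(d\<Phi> b - d\<Phi> b') \<bullet> (a - b) \<le> norm (d\<Phi> b - d\<Phi> b') * norm (a - b)" by (rule norm_cauchy_schwarz)
    also have "\<dots> \<le> L * norm (b - b') * norm (a - b)" by (intro mult_right_mono lipschitz) auto
    finally show ?thesis by (simp add: norm_minus_commute)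
  qed
  ultimately show ?thesis by linarith
qed

text \<open>First-order optimality of \<open>p\<close>, obtained by moving a fraction
  \<open>s\<close> of the way to \<open>x\<close>. The Lipschitz gradient bounds the change of
  \<open>\<Phi>\<close> with an error quadratic in \<open>s\<close>, which disappears after division
  by \<open>s\<close>; the three-point identity turns the result into divergences.\<close>

lemma prox_variational_inequality:
  assumes "convex X" "convex_on UNIV h" "\<alpha> > 0"
    and min: "is_arg_min (\<lambda>z. v \<bullet> z + 1 / \<alpha> * D z y + h z) (\<lambda>z. z \<in> X) p"
    and "x \<in> X"
  shows "v \<bullet> (p - x) + h p - h x \<le> 1 / \<alpha> * (D x y - D x p - D p y)"
proof -
  have p: "p \<in> X" and le: "\<And>z. z \<in> X \<Longrightarrow> v \<bullet> p + 1 / \<alpha> * D p y + h p \<le> v \<bullet> z + 1 / \<alpha> * D z y + h z"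
    using min by (auto simp: is_arg_min_linorder)
  define A where "A = v \<bullet> (p - x) + h p - h x - 1 / \<alpha> * ((d\<Phi> p - d\<Phi> y) \<bullet> (x - p))"
  define C where "C = L * (norm (x - p))\<^sup>2 / \<alpha>"
  have main: "A \<le> s * C" if s: "0 < s" "s \<le> 1" for s
  proof -
    define z where "z = p + s *\<^sub>R (x - p)"
    have z_alt: "z = (1 - s) *\<^sub>R p + s *\<^sub>R x" by (simp add: z_def algebra_simps)
    have "z \<in> X" unfolding z_alt using assms(1,5) p s by (simp add: convexD)
    have "h z \<le> (1 - s) * h p + s * h x"
      unfolding z_alt using assms(2) s by (intro convex_onD) auto
    moreover have "D z y - D p y = \<Phi> z - \<Phi> p - s * (d\<Phi> y \<bullet> (x - p))"
      by (simp add: bregman_def z_def inner_diff_right inner_add_right algebra_simps)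
    moreover have "\<Phi> z - \<Phi> p \<le> s * (d\<Phi> z \<bullet> (x - p))"
      using bregman_nonneg[of p z] by (simp add: bregman_def z_def)
    moreover have "d\<Phi> z \<bullet> (x - p) \<le> d\<Phi> p \<bullet> (x - p) + s * \<alpha> * C"
    proof -
      have "(d\<Phi> z - d\<Phi> p) \<bullet> (x - p) \<le> norm (d\<Phi> z - d\<Phi> p) * norm (x - p)" by (rule norm_cauchy_schwarz)
      also have "\<dots> \<le> L * norm (z - p) * norm (x - p)" by (intro mult_right_mono lipschitz) auto
      also have "\<dots> = s * \<alpha> * C" using s assms(3) by (simp add: C_def z_def power2_eq_square)
      finally show ?thesis by (simp add: inner_diff_left)
    qed
    ultimately have "D z y - D p y \<le> s * ((d\<Phi> p - d\<Phi> y) \<bullet> (x - p)) + s * (s * \<alpha> * C)"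
      using s by (smt (verit) distrib_left inner_diff_left mult_left_mono right_diff_distrib')
    then have "1 / \<alpha> * (D z y - D p y) \<le> 1 / \<alpha> * (s * ((d\<Phi> p - d\<Phi> y) \<bullet> (x - p)) + s * (s * \<alpha> * C))"
      using assms(3) by (intro mult_left_mono) auto
    also have "\<dots> = s * (1 / \<alpha> * ((d\<Phi> p - d\<Phi> y) \<bullet> (x - p))) + s * (s * C)"
      using assms(3) by (simp add: field_simps)
    finally have 1: "1 / \<alpha> * D z y - 1 / \<alpha> * D p y \<le> \<dots>" by (simp only: right_diff_distrib)
    have 2: "v \<bullet> z - v \<bullet> p = s * (v \<bullet> (x - p))" by (simp add: z_def inner_add_right)
    have 3: "h z - h p \<le> s * (h x - h p)" using \<open>h z \<le> _\<close> by (simp add: algebra_simps)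
    have "0 \<le> s * (v \<bullet> (x - p)) + (s * (1 / \<alpha> * ((d\<Phi> p - d\<Phi> y) \<bullet> (x - p))) + s * (s * C)) + s * (h x - h p)"
      using 1 2 3 le[OF \<open>z \<in> X\<close>] by linarith
    also have "\<dots> = s * (s * C - A)" by (simp add: A_def algebra_simps inner_diff_right)
    finally show ?thesis using s by (simp add: zero_le_mult_iff)
  qed
  have "A \<le> 0"
  proof (rule ccontr)
    assume "\<not> A \<le> 0"
    then have "A > 0" by simp
    then have C: "C > 0" using main[of 1] by simp
    \<comment> \<open>If \<open>A\<close> were positive, this fraction would make the error
      \<open>s * C\<close> at most \<open>A / 2\<close>, contradicting
      \<open>A \<le> s * C\<close>.\<close>
    define s where "s = min 1 (A / (2 * C))"
    have s: "0 < s" "s \<le> 1" "s \<le> A / (2 * C)" using \<open>A > 0\<close> C by (auto simp: s_def)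
    have "s * C \<le> A / (2 * C) * C" using s C by (intro mult_right_mono) auto
    also have "\<dots> = A / 2" using C by simp
    finally show False using main[OF s(1,2)] \<open>A > 0\<close> by simp
  qed
  then show ?thesis by (simp add: A_def bregman_three_point)
qed

text \<open>Young's inequality trades the term \<open>v \<bullet> (y - p)\<close> for
  \<open>\<alpha> * G\<^sup>2 / (2 * \<sigma>)\<close> and a square that strong convexity absorbs
  into the \<open>- D p y\<close> of the variational inequality.\<close>

lemma prox_descent:
  assumes "convex X" "convex_on UNIV h" "\<alpha> > 0"
    and min: "is_arg_min (\<lambda>z. v \<bullet> z + 1 / \<alpha> * D z y + h z) (\<lambda>z. z \<in> X) p"
    and "x \<in> X" and "norm v \<le> G"
  shows "v \<bullet> (y - x) + h p - h x \<le> 1 / \<alpha> * (D x y - D x p) + \<alpha> * G\<^sup>2 / (2 * \<sigma>)"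
proof -
  have "v \<bullet> (y - p) \<le> norm v * norm (y - p)" by (rule norm_cauchy_schwarz)
  also have "\<dots> \<le> G * norm (y - p)" by (intro mult_right_mono assms) auto
  also have "\<dots> \<le> \<alpha> * G\<^sup>2 / (2 * \<sigma>) + 1 / \<alpha> * (\<sigma> / 2 * (norm (y - p))\<^sup>2)"
  proof -
    have "0 \<le> (\<alpha> * G - \<sigma> * norm (y - p))\<^sup>2" by simp
    then show ?thesis using \<sigma>_pos assms(3)
      by (simp add: field_simps power2_eq_square)
  qed
  also have "\<dots> \<le> \<alpha> * G\<^sup>2 / (2 * \<sigma>) + 1 / \<alpha> * D p y"
    using assms(3) bregman_ge[of p y] by (intro add_left_mono mult_left_mono) (auto simp: norm_minus_commute)
  finally show ?thesis
    using prox_variational_inequality[OF assms(1-5)]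
    by (simp add: algebra_simps inner_diff_right)
qed

text \<open>The variational inequality is tested at \<open>x\<close>. Strong monotonicity bounds
  \<open>\<sigma> * (norm (p - x))\<^sup>2\<close>, and inserting \<open>d\<Phi> y\<close> separates
  the pull of \<open>v\<close> and \<open>h\<close> from the offset between \<open>y\<close> and
  \<open>x\<close>; one factor \<open>norm (p - x)\<close> then cancels.\<close>

lemma prox_displacement:
  assumes "convex X" "convex_on UNIV h" "\<alpha> > 0"
    and min: "is_arg_min (\<lambda>z. v \<bullet> z + 1 / \<alpha> * D z y + h z) (\<lambda>z. z \<in> X) p"
    and "x \<in> X" and v: "norm v \<le> G" and h: "h x - h p \<le> H * norm (x - p)" and "0 \<le> H"
  shows "norm (p - x) \<le> (\<alpha> * (G + H) + L * norm (y - x)) / \<sigma>"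
proof (cases "p = x")
  case True
  have "0 \<le> G" using v norm_ge_zero order_trans by blast
  have "0 \<le> L * norm (y - x)" using lipschitz[of y x] norm_ge_zero order_trans by blast
  then show ?thesis using True \<open>0 \<le> G\<close> \<open>0 \<le> H\<close> assms(3) \<sigma>_pos by simp
next
  case False
  have 1: "v \<bullet> (p - x) + h p - h x \<le> 1 / \<alpha> * ((d\<Phi> p - d\<Phi> y) \<bullet> (x - p))"
    using prox_variational_inequality[OF assms(1-5)] by (simp only: bregman_three_point)
  have "v \<bullet> (x - p) \<le> norm v * norm (x - p)" by (rule norm_cauchy_schwarz)
  also have "\<dots> \<le> G * norm (x - p)" by (intro mult_right_mono assms) auto
  finally have "1 / \<alpha> * ((d\<Phi> p - d\<Phi> y) \<bullet> (p - x)) \<le> (G + H) * norm (x - p)"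
    using 1 h by (simp add: inner_diff_right algebra_simps)
  then have 2: "(d\<Phi> p - d\<Phi> y) \<bullet> (p - x) \<le> \<alpha> * (G + H) * norm (p - x)"
    using assms(3) by (simp add: field_simps norm_minus_commute)
  have "(d\<Phi> y - d\<Phi> x) \<bullet> (p - x) \<le> norm (d\<Phi> y - d\<Phi> x) * norm (p - x)" by (rule norm_cauchy_schwarz)
  also have "\<dots> \<le> L * norm (y - x) * norm (p - x)" by (intro mult_right_mono lipschitz) auto
  finally have "\<sigma> * (norm (p - x))\<^sup>2 \<le> \<alpha> * (G + H) * norm (p - x) + L * norm (y - x) * norm (p - x)"
    using 2 gradient_strongly_monotone[of p x] by (simp add: inner_diff_left)
  then have "(\<sigma> * norm (p - x)) * norm (p - x) \<le> (\<alpha> * (G + H) + L * norm (y - x)) * norm (p - x)"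
    by (simp add: power2_eq_square algebra_simps)
  then have "\<sigma> * norm (p - x) \<le> \<alpha> * (G + H) + L * norm (y - x)"
    using False by (simp add: mult_le_cancel_right)
  then show ?thesis using \<sigma>_pos by (simp add: pos_le_divide_eq mult.commute)
qed

text \<open>The sum of the two variational inequalities, each tested at the other minimiser, no
  longer contains \<open>h\<close>. The result yields uniqueness of the minimiser and, later,
  measurability of the iterates.\<close>

lemma prox_lipschitz:
  assumes "convex X" "convex_on UNIV h" "\<alpha> > 0"
    and min: "is_arg_min (\<lambda>z. v \<bullet> z + 1 / \<alpha> * D z y + h z) (\<lambda>z. z \<in> X) p"
    and min': "is_arg_min (\<lambda>z. v' \<bullet> z + 1 / \<alpha> * D z y' + h z) (\<lambda>z. z \<in> X) p'"
  shows "norm (p - p') \<le> (\<alpha> * norm (v - v') + L * norm (y - y')) / \<sigma>"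
proof (cases "p = p'")
  case True
  have "0 \<le> L * norm (y - y')" using lipschitz[of y y'] norm_ge_zero order_trans by blast
  then show ?thesis using True assms(3) \<sigma>_pos by simp
next
  case False
  have X: "p \<in> X" "p' \<in> X" using min min' by (auto simp: is_arg_min_def)
  have "v \<bullet> (p - p') + h p - h p' \<le> 1 / \<alpha> * ((d\<Phi> p - d\<Phi> y) \<bullet> (p' - p))"
    using prox_variational_inequality[OF assms(1-3) min X(2)] by (simp only: bregman_three_point)
  moreover have "v' \<bullet> (p' - p) + h p' - h p \<le> 1 / \<alpha> * ((d\<Phi> p' - d\<Phi> y') \<bullet> (p - p'))"
    using prox_variational_inequality[OF assms(1-3) min' X(1)] by (simp only: bregman_three_point)
  ultimately have "v \<bullet> (p - p') + v' \<bullet> (p' - p)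
      \<le> 1 / \<alpha> * ((d\<Phi> p - d\<Phi> y) \<bullet> (p' - p) + (d\<Phi> p' - d\<Phi> y') \<bullet> (p - p'))"
    by (simp only: distrib_left)
  then have 1: "\<alpha> * ((v - v') \<bullet> (p - p')) \<le> - ((d\<Phi> p - d\<Phi> p') \<bullet> (p - p')) + (d\<Phi> y - d\<Phi> y') \<bullet> (p - p')"
    using assms(3) by (simp add: field_simps inner_diff_left inner_diff_right)
  have "- ((v - v') \<bullet> (p - p')) \<le> norm (v - v') * norm (p - p')"
    using norm_cauchy_schwarz[of "v' - v" "p - p'"] by (simp add: norm_minus_commute inner_diff_left)
  then have 2: "\<alpha> * - ((v - v') \<bullet> (p - p')) \<le> \<alpha> * (norm (v - v') * norm (p - p'))"
    using assms(3) by (intro mult_left_mono) auto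
  have "(d\<Phi> y - d\<Phi> y') \<bullet> (p - p') \<le> norm (d\<Phi> y - d\<Phi> y') * norm (p - p')" by (rule norm_cauchy_schwarz)
  also have "\<dots> \<le> L * norm (y - y') * norm (p - p')" by (intro mult_right_mono lipschitz) auto
  finally have "(\<sigma> * norm (p - p')) * norm (p - p') \<le> (\<alpha> * norm (v - v') + L * norm (y - y')) * norm (p - p')"
    using 1 2 gradient_strongly_monotone[of p p'] by (simp add: power2_eq_square algebra_simps)
  then have "\<sigma> * norm (p - p') \<le> \<alpha> * norm (v - v') + L * norm (y - y')"
    using False by (simp add: mult_le_cancel_right)
  then show ?thesis using \<sigma>_pos by (simp add: pos_le_divide_eq mult.commute)
qed

end

section \<open>Consensus\<close>

definition avg :: "('v::finite \<Rightarrow> 'a::real_vector) \<Rightarrow> 'a" where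
  "avg x = (1 / real CARD('v)) *\<^sub>R (\<Sum>i\<in>UNIV. x i)"

definition mix :: "real^'v^'v \<Rightarrow> ('v::finite \<Rightarrow> 'a::real_vector) \<Rightarrow> 'v \<Rightarrow> 'a" where
  "mix P x i = (\<Sum>j\<in>UNIV. P $ i $ j *\<^sub>R x j)"

definition disagreement :: "('v::finite \<Rightarrow> 'a::real_inner) \<Rightarrow> real" where
  "disagreement x = (\<Sum>i\<in>UNIV. (norm (x i - avg x))\<^sup>2)"

text \<open>The matrices \<open>P t\<close> to \<open>P (t + k - 1)\<close> applied one after
  another, written as an iteration so that no matrix products occur.\<close>

primrec mixes :: "(nat \<Rightarrow> real^'v^'v) \<Rightarrow> nat \<Rightarrow> nat \<Rightarrow> ('v::finite \<Rightarrow> 'a::real_vector) \<Rightarrow> 'v \<Rightarrow> 'a" where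
  "mixes P t 0 x = x"
| "mixes P t (Suc k) x = mix (P (t + k)) (mixes P t k x)"

lemma mixes_add: "mixes P t (k + m) x = mixes P (t + k) m (mixes P t k x)"
  by (induction m) (simp_all add: add.assoc)

lemma mixes_Suc': "mixes P t (Suc k) x = mixes P (Suc t) k (mix (P t) x)"
  using mixes_add[of P t 1 k x] by simp

lemma mix_add: "mix P (\<lambda>i. x i + y i) = (\<lambda>i. mix P x i + mix P y i)"
  by (simp add: fun_eq_iff mix_def scaleR_add_right sum.distrib)

lemma mixes_plus: "mixes P t k (\<lambda>i. x i + y i) = (\<lambda>i. mixes P t k x i + mixes P t k y i)"
  by (induction k) (simp_all add: mix_add)

lemma mix_component: "mix P x i $ c = mix P (\<lambda>i. x i $ c) i"
  by (simp add: mix_def)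

lemma mixes_component: "mixes P t k x i $ c = mixes P t k (\<lambda>i. x i $ c) i"
  by (induction k arbitrary: i) (simp_all add: mix_component)

lemma avg_add: "avg (\<lambda>i. x i + y i) = avg x + avg y"
  by (simp add: avg_def sum.distrib scaleR_add_right)

text \<open>Reduces vector-valued states to real ones, whose values can be sorted.\<close>

lemma disagreement_component:
  fixes x :: "'v::finite \<Rightarrow> real^'n"
  shows "disagreement x = (\<Sum>c\<in>UNIV. disagreement (\<lambda>i. x i $ c))"
proof -
  have "disagreement x = (\<Sum>i\<in>UNIV. \<Sum>c\<in>UNIV. (x i $ c - avg (\<lambda>i. x i $ c))\<^sup>2)"
    by (simp add: disagreement_def norm_vec_def L2_set_def real_sqrt_pow2[OF sum_nonneg] avg_def)
  also have "\<dots> = (\<Sum>c\<in>UNIV. \<Sum>i\<in>UNIV. (x i $ c - avg (\<lambda>i. x i $ c))\<^sup>2)" by (rule sum.swap)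
  finally show ?thesis by (simp add: disagreement_def)
qed

lemma disagreement_nonneg: "0 \<le> disagreement x"
  by (simp add: disagreement_def sum_nonneg)

lemma sum_avg_diff:
  fixes x :: "'v::finite \<Rightarrow> 'a::real_vector"
  shows "(\<Sum>i\<in>UNIV. x i - avg x) = 0"
  by (simp add: avg_def sum_subtractf scaleR_right.sum[symmetric] sum_constant_scaleR)

text \<open>The parallel axis identity: the cross term vanishes because deviations from the average
  sum to zero. In particular the average is the best centre.\<close>

lemma sum_sqnorm_diff_eq_disagreement:
  fixes x :: "'v::finite \<Rightarrow> 'a::real_inner"
  shows "disagreement x + real CARD('v) * (norm (avg x - m))\<^sup>2 = (\<Sum>i\<in>UNIV. (norm (x i - m))\<^sup>2)"
proof -
  have "(norm (x i - m))\<^sup>2 = (norm (x i - avg x))\<^sup>2 + 2 * ((x i - avg x) \<bullet> (avg x - m)) + (norm (avg x - m))\<^sup>2" for i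
  proof -
    have "x i - m = (x i - avg x) + (avg x - m)" by simp
    then show ?thesis
      by (simp only: power2_norm_eq_inner inner_add_left inner_add_right) (simp only: inner_commute)
  qed
  then have "(\<Sum>i\<in>UNIV. (norm (x i - m))\<^sup>2)
      = disagreement x + 2 * ((\<Sum>i\<in>UNIV. x i - avg x) \<bullet> (avg x - m)) + real CARD('v) * (norm (avg x - m))\<^sup>2"
    by (simp add: sum.distrib disagreement_def inner_sum_left sum_distrib_left)
  then show ?thesis by (simp only: sum_avg_diff) simp
qed

lemma weighted_variance:
  fixes w :: "'v::finite \<Rightarrow> 'a::real_inner"
  assumes "(\<Sum>j\<in>UNIV. p j) = 1"
  shows "(norm (\<Sum>j\<in>UNIV. p j *\<^sub>R w j))\<^sup>2 =
    (\<Sum>j\<in>UNIV. p j * (norm (w j))\<^sup>2) - (\<Sum>j\<in>UNIV. p j * (norm (w j - (\<Sum>j\<in>UNIV. p j *\<^sub>R w j)))\<^sup>2)"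
proof -
  define m where "m = (\<Sum>j\<in>UNIV. p j *\<^sub>R w j)"
  have "p j * (norm (w j - m))\<^sup>2 = p j * (norm (w j))\<^sup>2 - 2 * (p j *\<^sub>R w j \<bullet> m) + p j * (norm m)\<^sup>2" for j
    by (simp add: power2_norm_eq_inner inner_diff_left inner_diff_right inner_commute algebra_simps)
  then have "(\<Sum>j\<in>UNIV. p j * (norm (w j - m))\<^sup>2)
     = (\<Sum>j\<in>UNIV. p j * (norm (w j))\<^sup>2) - 2 * ((\<Sum>j\<in>UNIV. p j *\<^sub>R w j) \<bullet> m) + (\<Sum>j\<in>UNIV. p j) * (norm m)\<^sup>2"
    by (simp only: sum.distrib sum_subtractf inner_sum_left sum_distrib_left sum_distrib_right)
  then show ?thesis
    by (simp add: m_def[symmetric] assms power2_norm_eq_inner)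
qed

context
  fixes P :: "real^'v::finite^'v"
  assumes ds: "doubly_stochastic P"
begin

lemma weights: "P $ i $ j \<ge> 0" "(\<Sum>j\<in>UNIV. P $ i $ j) = 1" "(\<Sum>i\<in>UNIV. P $ i $ j) = 1"
  using ds by (auto simp: doubly_stochastic_def)

lemma avg_mix: "avg (mix P x) = avg x"
proof -
  have "(\<Sum>i\<in>UNIV. mix P x i) = (\<Sum>j\<in>UNIV. (\<Sum>i\<in>UNIV. P $ i $ j) *\<^sub>R x j)"
    unfolding mix_def scaleR_sum_left by (rule sum.swap)
  then show ?thesis by (simp add: avg_def weights)
qed

text \<open>The variance identity is applied in every row; the unit column sums then turn the
  weighted second moments into the plain sum of squares.\<close>

lemma sum_sqnorm_mix:
  fixes w :: "'v \<Rightarrow> 'a::real_inner"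
  shows "(\<Sum>i\<in>UNIV. (norm (mix P w i))\<^sup>2) =
    (\<Sum>j\<in>UNIV. (norm (w j))\<^sup>2) - (\<Sum>i\<in>UNIV. \<Sum>j\<in>UNIV. P $ i $ j * (norm (w j - mix P w i))\<^sup>2)"
proof -
  have "(\<Sum>i\<in>UNIV. \<Sum>j\<in>UNIV. P $ i $ j * (norm (w j))\<^sup>2) = (\<Sum>j\<in>UNIV. (\<Sum>i\<in>UNIV. P $ i $ j) * (norm (w j))\<^sup>2)"
    unfolding sum_distrib_right by (rule sum.swap)
  then show ?thesis
    by (simp add: mix_def weighted_variance weights sum_subtractf)
qed

lemma disagreement_mix:
  "disagreement (mix P x) =
    disagreement x - (\<Sum>i\<in>UNIV. \<Sum>j\<in>UNIV. P $ i $ j * (norm (x j - mix P x i))\<^sup>2)"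
proof -
  have *: "mix P (\<lambda>i. x i - avg x) i = mix P x i - avg x" for i
    by (simp add: mix_def scaleR_diff_right sum_subtractf scaleR_sum_left[symmetric] weights)
  show ?thesis
    using sum_sqnorm_mix[of "\<lambda>i. x i - avg x"] by (simp add: disagreement_def avg_mix *)
qed

lemma disagreement_mix_le: "disagreement (mix P x) \<le> disagreement x"
  unfolding disagreement_mix by (simp add: sum_nonneg weights)

text \<open>Keeps only the entries \<open>(i, i)\<close> and \<open>(i, j)\<close> of the dissipated
  variance. Wherever the mean of row \<open>i\<close> lies, the two squared distances to it add up
  to at least half the squared distance between \<open>x i\<close> and \<open>x j\<close>.\<close>

lemma disagreement_mix_drop:
  assumes "i \<noteq> j" "P $ i $ i \<ge> \<theta>" "P $ i $ j \<ge> \<theta>" "\<theta> \<ge> 0"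
  shows "disagreement (mix P x) \<le> disagreement x - \<theta> / 2 * (norm (x i - x j))\<^sup>2"
proof -
  let ?m = "mix P x i"
  have "norm (x i - x j) \<le> norm (x i - ?m) + norm (x j - ?m)"
    using dist_triangle2[of "x i" "x j" ?m] by (simp add: dist_norm)
  then have "(norm (x i - x j))\<^sup>2 \<le> (norm (x i - ?m) + norm (x j - ?m))\<^sup>2"
    by (intro power_mono) auto
  also have "\<dots> \<le> 2 * ((norm (x i - ?m))\<^sup>2 + (norm (x j - ?m))\<^sup>2)"
    using sum_squares_bound[of "norm (x i - ?m)" "norm (x j - ?m)"] by (simp add: power2_sum)
  finally have "\<theta> / 2 * (norm (x i - x j))\<^sup>2 \<le> \<theta> / 2 * (2 * ((norm (x i - ?m))\<^sup>2 + (norm (x j - ?m))\<^sup>2))"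
    using assms(4) by (intro mult_left_mono) auto
  also have "\<dots> = \<theta> * (norm (x i - ?m))\<^sup>2 + \<theta> * (norm (x j - ?m))\<^sup>2" by (simp add: distrib_left)
  also have "\<dots> \<le> P $ i $ i * (norm (x i - ?m))\<^sup>2 + P $ i $ j * (norm (x j - ?m))\<^sup>2"
    by (intro add_mono mult_right_mono assms) auto
  also have "\<dots> = (\<Sum>k\<in>{i, j}. P $ i $ k * (norm (x k - ?m))\<^sup>2)" using assms(1) by simp
  also have "\<dots> \<le> (\<Sum>k\<in>UNIV. P $ i $ k * (norm (x k - ?m))\<^sup>2)"
    by (intro sum_mono2) (auto simp: weights)
  also have "\<dots> \<le> (\<Sum>i\<in>UNIV. \<Sum>k\<in>UNIV. P $ i $ k * (norm (x k - mix P x i))\<^sup>2)"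
    by (rule member_le_sum) (auto intro!: sum_nonneg simp: weights)
  finally show ?thesis unfolding disagreement_mix by simp
qed

text \<open>Only neighbours with positive weight have to satisfy the bound, so a group of agents
  that receives nothing from outside keeps its lower bound.\<close>

lemma mix_ge_on_closed:
  fixes u :: "'v \<Rightarrow> real"
  assumes "\<And>j. P $ i $ j > 0 \<Longrightarrow> b \<le> u j"
  shows "b \<le> mix P u i"
proof -
  have "b = (\<Sum>j\<in>UNIV. P $ i $ j * b)" by (simp add: sum_distrib_right[symmetric] weights)
  also have "\<dots> \<le> (\<Sum>j\<in>UNIV. P $ i $ j * u j)"
    using assms weights(1) by (intro sum_mono) (metis less_eq_real_def mult_left_mono mult_zero_left order_refl)
  finally show ?thesis by (simp add: mix_def)
qed

lemma mix_le_on_closed: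
  fixes u :: "'v \<Rightarrow> real"
  assumes "\<And>j. P $ i $ j > 0 \<Longrightarrow> u j \<le> a"
  shows "mix P u i \<le> a"
  using mix_ge_on_closed[of i "- a" "\<lambda>j. - u j"] assms by (simp add: mix_def sum_negf)

lemma mix_in_convex:
  assumes "convex X" "\<And>j. x j \<in> X" shows "mix P x i \<in> X"
  unfolding mix_def by (rule convex_sum) (use assms weights in auto)

end

text \<open>Popoviciu's inequality: the midpoint of the range serves as centre in the parallel axis
  identity.\<close>

lemma disagreement_le_range:
  fixes u :: "'v::finite \<Rightarrow> real"
  assumes "\<And>i. lo \<le> u i" "\<And>i. u i \<le> hi"
  shows "disagreement u \<le> real CARD('v) * (hi - lo)\<^sup>2 / 4"
proof -
  have "disagreement u \<le> (\<Sum>i\<in>UNIV. (norm (u i - (lo + hi) / 2))\<^sup>2)"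
    unfolding sum_sqnorm_diff_eq_disagreement[of u "(lo + hi) / 2", symmetric] by simp
  also have "\<dots> \<le> (\<Sum>i\<in>(UNIV::'v set). ((hi - lo) / 2)\<^sup>2)"
  proof (rule sum_mono)
    fix i
    have "norm (u i - (lo + hi) / 2) \<le> (hi - lo) / 2"
      using assms[of i] by (simp add: abs_le_iff field_simps)
    from power_mono[OF this norm_ge_zero]
    show "(norm (u i - (lo + hi) / 2))\<^sup>2 \<le> ((hi - lo) / 2)\<^sup>2" .
  qed
  finally show ?thesis by (simp add: power_divide)
qed

text \<open>Pigeonhole: the at most \<open>CARD('v) - 1\<close> gaps between consecutive distinct
  values add up to the range.\<close>

lemma large_gap:
  fixes u :: "'v::finite \<Rightarrow> real"
  assumes "Min (range u) < Max (range u)"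
  shows "\<exists>a b. (Max (range u) - Min (range u)) / real CARD('v) \<le> b - a \<and> a < b \<and>
    (\<forall>i. u i \<le> a \<or> b \<le> u i) \<and> (\<exists>i. u i \<le> a) \<and> (\<exists>i. b \<le> u i)"
proof -
  define xs where "xs = sorted_list_of_set (range u)"
  define n where "n = length xs"
  define R where "R = Max (range u) - Min (range u)"
  have set: "set xs = range u" "sorted xs" "distinct xs" by (simp_all add: xs_def)
  have n: "n \<le> CARD('v)" unfolding n_def xs_def using card_image_le[of UNIV u] by simp
  have "n > 0" using set(1) by (auto simp: n_def)
  have first: "xs ! 0 \<le> Min (range u)"
  proof -
    have "Min (range u) \<in> set xs" using set by simp
    then obtain k where "k < n" "Min (range u) = xs ! k" by (auto simp: in_set_conv_nth n_def)
    then show ?thesis using sorted_nth_mono[OF set(2), of 0 k] by (simp add: n_def)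
  qed
  have last: "Max (range u) \<le> xs ! (n - 1)"
  proof -
    have "Max (range u) \<in> set xs" using set by simp
    then obtain k where "k < n" "Max (range u) = xs ! k" by (auto simp: in_set_conv_nth n_def)
    then show ?thesis using sorted_nth_mono[OF set(2), of k "n - 1"] by (simp add: n_def)
  qed
  have tele: "(\<Sum>i<n - 1. xs ! Suc i - xs ! i) = xs ! (n - 1) - xs ! 0"
    by (rule sum_lessThan_telescope)
  have "n - 1 \<noteq> 0"
  proof
    assume "n - 1 = 0"
    then have "xs ! (n - 1) = xs ! 0" by simp
    then show False using assms first last by linarith
  qed
  then have "n - 1 > 0" by simp
  have "R > 0" using assms by (simp add: R_def)
  have "\<exists>i < n - 1. R / real CARD('v) \<le> xs ! Suc i - xs ! i"
  proof (rule ccontr)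
    assume "\<not> ?thesis"
    then have "(\<Sum>i<n - 1. xs ! Suc i - xs ! i) < (\<Sum>i<n - 1. R / real CARD('v))"
      using \<open>n - 1 > 0\<close> by (intro sum_strict_mono) (auto simp: not_le lessThan_empty_iff)
    also have "\<dots> = real (n - 1) * (R / real CARD('v))" by simp
    also have "\<dots> \<le> real CARD('v) * (R / real CARD('v))"
      using n \<open>R > 0\<close> by (intro mult_right_mono) auto
    also have "\<dots> = R" by simp
    finally show False using tele first last unfolding R_def by linarith
  qed
  then obtain i where i: "i < n - 1" "R / real CARD('v) \<le> xs ! Suc i - xs ! i" by blast
  have "0 < R / real CARD('v)" using \<open>R > 0\<close> by simp
  then have "xs ! i < xs ! Suc i" using i(2) by linarith
  moreover have "u k \<le> xs ! i \<or> xs ! Suc i \<le> u k" for k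
  proof -
    have "u k \<in> set xs" using set by simp
    then obtain m where m: "m < n" "u k = xs ! m" by (auto simp: in_set_conv_nth n_def)
    show ?thesis
    proof (cases "m \<le> i")
      case True
      then show ?thesis using sorted_nth_mono[OF set(2), of m i] m i(1) by (simp add: n_def)
    next
      case False
      then show ?thesis using sorted_nth_mono[OF set(2), of "Suc i" m] m by (simp add: n_def)
    qed
  qed
  moreover have "xs ! i \<in> range u" "xs ! Suc i \<in> range u"
    using i by (auto simp: set(1)[symmetric] n_def)
  then have "\<exists>k. u k \<le> xs ! i" "\<exists>k. xs ! Suc i \<le> u k" by (metis rangeE order_refl)+
  ultimately show ?thesis using i(2) unfolding R_def by blast
qed

text \<open>A path from \<open>u\<close> to \<open>v\<close> has to leave \<open>U\<close>
  somewhere.\<close>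

lemma strongly_connected_crossing_edge:
  assumes "strongly_connected (with_proj \<lparr>pverts = UNIV, parcs = E\<rparr>)" "u \<in> U" "v \<notin> U"
  obtains a b where "(a, b) \<in> E" "a \<in> U" "b \<notin> U"
proof -
  have "(u, v) \<in> rtrancl_on UNIV E"
    using assms(1) by (simp add: strongly_connected_def reachable_def)
  then have "v \<notin> U \<longrightarrow> (\<exists>a b. (a, b) \<in> E \<and> a \<in> U \<and> b \<notin> U)"
    by (induction rule: rtrancl_on_induct) (use assms(2) in blast)+
  then show thesis using assms(3) that by blast
qed

lemma disagreement_le_sum: "disagreement x \<le> (\<Sum>i\<in>UNIV. (norm (x i - m))\<^sup>2)"
  unfolding sum_sqnorm_diff_eq_disagreement[of x m, symmetric] by simp

text \<open>The Euclidean distance of the state to the consensus subspace. Unlike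
  \<open>disagreement\<close> it is subadditive, so the effects of perturbations can be
  superposed.\<close>

definition dev :: "('v::finite \<Rightarrow> 'a::real_inner) \<Rightarrow> real" where
  "dev x = sqrt (disagreement x)"

lemma dev_nonneg: "0 \<le> dev x"
  by (simp add: dev_def disagreement_nonneg)

lemma dev_triangle: "dev (\<lambda>i. x i + y i) \<le> dev x + dev y"
proof -
  have "dev (\<lambda>i. x i + y i) = L2_set (\<lambda>i. norm ((x i - avg x) + (y i - avg y))) UNIV"
    by (simp add: dev_def disagreement_def L2_set_def avg_add algebra_simps)
  also have "\<dots> \<le> L2_set (\<lambda>i. norm (x i - avg x) + norm (y i - avg y)) UNIV"
    by (intro L2_set_mono norm_triangle_ineq) auto
  also have "\<dots> \<le> L2_set (\<lambda>i. norm (x i - avg x)) UNIV + L2_set (\<lambda>i. norm (y i - avg y)) UNIV"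
    by (rule L2_set_triangle_ineq)
  finally show ?thesis by (simp add: dev_def disagreement_def L2_set_def)
qed

lemma dev_le:
  fixes x :: "'v::finite \<Rightarrow> 'a::real_inner"
  assumes "\<And>i. norm (x i - m) \<le> e"
  shows "dev x \<le> sqrt (real CARD('v)) * e"
proof -
  have "0 \<le> e" using assms norm_ge_zero order_trans by blast
  have "disagreement x \<le> (\<Sum>i\<in>(UNIV::'v set). e\<^sup>2)"
    using assms by (intro order_trans[OF disagreement_le_sum[of x m]] sum_mono power_mono) auto
  then have "dev x \<le> sqrt (real CARD('v) * e\<^sup>2)" by (simp add: dev_def)
  then show ?thesis using \<open>0 \<le> e\<close> by (simp add: real_sqrt_mult)
qed

text \<open>The deviation of agent \<open>l\<close> is minus the sum of the other
  \<open>CARD('v) - 1\<close> deviations, so Cauchy-Schwarz applies with that many terms.\<close>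

lemma sqnorm_diff_avg_le:
  fixes x :: "'v::finite \<Rightarrow> 'a::real_inner"
  shows "real CARD('v) * (norm (x l - avg x))\<^sup>2 \<le> (real CARD('v) - 1) * disagreement x"
proof -
  let ?d = "\<lambda>j. x j - avg x"
  have "?d l + (\<Sum>j\<in>UNIV - {l}. ?d j) = 0"
    unfolding sum_avg_diff[of x, symmetric] by (rule sum.remove[symmetric]) auto
  then have "?d l = - (\<Sum>j\<in>UNIV - {l}. ?d j)" by (simp add: eq_neg_iff_add_eq_0)
  then have "norm (?d l) \<le> (\<Sum>j\<in>UNIV - {l}. norm (?d j))"
    by (simp only: norm_minus_cancel norm_sum)
  then have "(norm (?d l))\<^sup>2 \<le> (\<Sum>j\<in>UNIV - {l}. norm (?d j))\<^sup>2" by (intro power_mono) auto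
  also have "\<dots> \<le> (\<Sum>j\<in>UNIV - {l}. (norm (?d j))\<^sup>2) * card (UNIV - {l})"
    by (rule sum_squared_le_sum_of_squares)
  also have "(\<Sum>j\<in>UNIV - {l}. (norm (?d j))\<^sup>2) = disagreement x - (norm (?d l))\<^sup>2"
    by (simp add: disagreement_def sum_diff1)
  also have "real (card (UNIV - {l})) = real CARD('v) - 1"
    by (simp add: card_Diff_singleton of_nat_diff)
  finally show ?thesis by (simp add: algebra_simps)
qed

text \<open>Cauchy-Schwarz over the agents, then the parallel axis identity centred at
  \<open>x l\<close>. Mixing preserves the average, and the factor \<open>real CARD('v) - 1\<close>
  of \<open>sqnorm_diff_avg_le\<close> makes the two contributions add up to exactly
  \<open>real CARD('v)\<close> times the disagreement.\<close>

lemma sum_norm_diff_mix_le: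
  fixes x :: "'v::finite \<Rightarrow> 'a::real_inner"
  assumes "doubly_stochastic P"
  shows "(\<Sum>i\<in>UNIV. norm (mix P x i - x l)) \<le> real CARD('v) * dev x"
proof -
  have "(\<Sum>i\<in>UNIV. norm (mix P x i - x l))\<^sup>2 \<le> (\<Sum>i\<in>UNIV. (norm (mix P x i - x l))\<^sup>2) * real CARD('v)"
    by (rule sum_squared_le_sum_of_squares)
  also have "(\<Sum>i\<in>UNIV. (norm (mix P x i - x l))\<^sup>2)
      = disagreement (mix P x) + real CARD('v) * (norm (x l - avg x))\<^sup>2"
    using sum_sqnorm_diff_eq_disagreement[of "mix P x" "x l"] by (simp add: avg_mix[OF assms] norm_minus_commute)
  also have "\<dots> \<le> disagreement x + (real CARD('v) - 1) * disagreement x"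
    by (intro add_mono disagreement_mix_le[OF assms] sqnorm_diff_avg_le)
  also have "\<dots> = real CARD('v) * (dev x)\<^sup>2"
    by (simp add: dev_def disagreement_nonneg algebra_simps)
  finally have "(\<Sum>i\<in>UNIV. norm (mix P x i - x l))\<^sup>2 \<le> (real CARD('v) * dev x)\<^sup>2"
    by (simp add: power_mult_distrib power2_eq_square algebra_simps)
  then show ?thesis by (rule power2_le_imp_le) (simp add: dev_nonneg)
qed

section \<open>Contraction over connectivity windows\<close>

locale network =
  fixes P :: "nat \<Rightarrow> real^'v::finite^'v" and B :: nat and \<theta> :: real
  assumes ds: "\<And>t. doubly_stochastic (P t)"
    and B_ge_1: "B \<ge> 1"
    and connected: "\<And>s. strongly_connected
           (with_proj \<lparr>pverts = UNIV, parcs = (\<Union>t\<in>{s * B + 1..(s + 1) * B}. edges (P t))\<rparr>)"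
    and \<theta>: "0 < \<theta>" "\<theta> < 1"
    and diag: "\<And>t i. P t $ i $ i \<ge> \<theta>"
    and reverse_edge: "\<And>t i j. (j, i) \<in> edges (P t) \<Longrightarrow> P t $ i $ j \<ge> \<theta>"
begin

text \<open>One use of \<open>reverse_edge\<close> bounds the reverse entry from below, and a second
  use bounds the entry itself; the support is therefore symmetric.\<close>

lemma edge_ge: "P t $ i $ j > 0 \<Longrightarrow> P t $ i $ j \<ge> \<theta> \<and> P t $ j $ i \<ge> \<theta>"
  using reverse_edge[of i j t] reverse_edge[of j i t] \<theta> by (auto simp: edges_def)

lemma disagreement_mixes_antimono: "k \<le> m \<Longrightarrow> disagreement (mixes P t m x) \<le> disagreement (mixes P t k x)"
proof (induction m rule: dec_induct)
  case (step m)
  then show ?case using disagreement_mix_le[OF ds, of "t + m" "mixes P t m x"] by simp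
qed simp

lemma disagreement_window_scalar:
  fixes u :: "'v \<Rightarrow> real"
  shows "disagreement (mixes P (s * B + 1) B u) \<le> (1 - 2 * \<theta> / real CARD('v) ^ 3) * disagreement u"
proof (cases "Min (range u) < Max (range u)")
  \<comment> \<open>All values coincide, so there is no gap and both sides vanish.\<close>
  case False
  have range: "Min (range u) \<le> u i" "u i \<le> Max (range u)" for i by auto
  then have "Min (range u) = Max (range u)" using False by (meson antisym_conv2 order_trans)
  then have "disagreement u \<le> 0"
    using disagreement_le_range[of "Min (range u)" u "Max (range u)", OF range] by simp
  moreover have "disagreement (mixes P (s * B + 1) B u) \<le> disagreement u"
    using disagreement_mixes_antimono[of 0 B "s * B + 1" u] by simp
  ultimately show ?thesis using disagreement_nonneg[of u] by simp
next
  case True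
  define t where "t = s * B + 1"
  define R where "R = Max (range u) - Min (range u)"
  define N where "N = real CARD('v)"
  have N: "N > 0" by (simp add: N_def)
  obtain a b where ab: "R / N \<le> b - a" "a < b" "\<forall>i. u i \<le> a \<or> b \<le> u i" "\<exists>i. u i \<le> a" "\<exists>i. b \<le> u i"
    using large_gap[OF True, folded R_def N_def] by blast
  \<comment> \<open>The agents above the gap. \<open>Q k\<close> says that the matrix at offset
    \<open>k\<close> of the window links this set to its complement.\<close>
  define U where "U = {i. b \<le> u i}"
  define Q where "Q k \<longleftrightarrow> (\<exists>i\<in>U. \<exists>j. j \<notin> U \<and> P (t + k) $ i $ j > 0)" for k
  obtain i0 i1 where "b \<le> u i0" "u i1 \<le> a" using ab by blast
  then have "i0 \<in> U" "i1 \<notin> U" using ab(2) by (auto simp: U_def)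
  then obtain i j where "(i, j) \<in> (\<Union>t\<in>{s * B + 1..(s + 1) * B}. edges (P t))" "i \<in> U" "j \<notin> U"
    by (rule strongly_connected_crossing_edge[OF connected])
  then obtain t' where t': "t' \<in> {s * B + 1..(s + 1) * B}" "P t' $ i $ j > 0" "i \<in> U" "j \<notin> U"
    by (auto simp: edges_def)
  have "\<exists>k<B. Q k"
    using t' by (intro exI[of _ "t' - t"]) (auto simp: Q_def t_def)
  then have ex: "\<exists>k. Q k" and L: "Least Q < B" by (blast, meson Least_le le_less_trans)
  define k where "k = Least Q"
  have Qk: "Q k" and notQ: "\<And>k'. k' < k \<Longrightarrow> \<not> Q k'"
    unfolding k_def using LeastI_ex[OF ex] by (auto dest: not_less_Least)
  \<comment> \<open>Before the first crossing each side only averages its own values, so nothing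
    enters the gap between \<open>a\<close> and \<open>b\<close>. For the lower side this uses the
    symmetry of the support.\<close>
  have inv: "(\<forall>i\<in>U. b \<le> mixes P t m u i) \<and> (\<forall>i. i \<notin> U \<longrightarrow> mixes P t m u i \<le> a)" if "m \<le> k" for m
    using that
  proof (induction m)
    case 0
    then show ?case using ab(3) by (auto simp: U_def)
  next
    case (Suc m)
    have nQ: "\<not> Q m" using notQ Suc by simp
    have 1: "j \<in> U" if "i \<in> U" "P (t + m) $ i $ j > 0" for i j
      using nQ that by (auto simp: Q_def)
    have 2: "j \<notin> U" if "i \<notin> U" "P (t + m) $ i $ j > 0" for i j
      using nQ that edge_ge[of "t + m" i j] \<theta> by (force simp: Q_def)
    have IH: "\<And>j. j \<in> U \<Longrightarrow> b \<le> mixes P t m u j" "\<And>j. j \<notin> U \<Longrightarrow> mixes P t m u j \<le> a"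
      using Suc by simp_all
    show ?case
      unfolding mixes.simps using 1 2 IH
      by (intro conjI ballI allI impI mix_ge_on_closed[OF ds] mix_le_on_closed[OF ds]) blast+
  qed
  obtain i j where ij: "i \<in> U" "j \<notin> U" "P (t + k) $ i $ j > 0" using Qk by (auto simp: Q_def)
  let ?z = "mixes P t k u"
  have "disagreement (mixes P t B u) \<le> disagreement (mixes P t (Suc k) u)"
    using L by (intro disagreement_mixes_antimono) (simp add: k_def)
  also have "\<dots> \<le> disagreement ?z - \<theta> / 2 * (norm (?z i - ?z j))\<^sup>2"
    unfolding mixes.simps using edge_ge[OF ij(3)] ij(1,2) \<theta>
    by (intro disagreement_mix_drop ds diag) auto
  also have "\<dots> \<le> disagreement u - \<theta> / 2 * (R / N)\<^sup>2"
  proof (rule diff_mono)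
    show "disagreement ?z \<le> disagreement u" using disagreement_mixes_antimono[of 0 k t u] by simp
    have "b \<le> ?z i" "?z j \<le> a" using inv[OF order_refl] ij(1,2) by blast+
    then have "R / N \<le> norm (?z i - ?z j)" using ab(1) unfolding real_norm_def by linarith
    then show "\<theta> / 2 * (R / N)\<^sup>2 \<le> \<theta> / 2 * (norm (?z i - ?z j))\<^sup>2"
      using \<theta> True N by (intro mult_left_mono power_mono) (auto simp: R_def)
  qed
  \<comment> \<open>As the disagreement is at most \<open>N * R\<^sup>2 / 4\<close>, the absolute
    drop \<open>\<theta> / 2 * (R / N)\<^sup>2\<close> is at least a fraction
    \<open>2 * \<theta> / N ^ 3\<close> of it.\<close>
  also have "\<dots> \<le> disagreement u - 2 * \<theta> / N ^ 3 * disagreement u"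
  proof -
    have "disagreement u \<le> N * R\<^sup>2 / 4"
      unfolding R_def N_def by (rule disagreement_le_range) auto
    then have "2 * \<theta> / N ^ 3 * disagreement u \<le> 2 * \<theta> / N ^ 3 * (N * R\<^sup>2 / 4)"
      using \<theta> N by (intro mult_left_mono) auto
    also have "\<dots> = \<theta> / 2 * (R / N)\<^sup>2"
      using N by (simp add: field_simps power2_eq_square power3_eq_cube)
    finally show ?thesis by simp
  qed
  finally show ?thesis by (simp add: t_def N_def algebra_simps)
qed

lemma disagreement_window:
  fixes x :: "'v \<Rightarrow> real^'n"
  shows "disagreement (mixes P (s * B + 1) B x) \<le> (1 - 2 * \<theta> / real CARD('v) ^ 3) * disagreement x"
  unfolding disagreement_component[of x] disagreement_component[of "mixes P (s * B + 1) B x"] sum_distrib_left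
  unfolding mixes_component by (intro sum_mono disagreement_window_scalar)

text \<open>Windows begin at the times \<open>s * B + 1\<close>, so every stretch of
  \<open>2 * B\<close> steps from a positive time contains a whole one.\<close>

lemma disagreement_two_windows:
  fixes x :: "'v \<Rightarrow> real^'n"
  assumes "t \<ge> 1"
  shows "disagreement (mixes P t (2 * B) x) \<le> (1 - 2 * \<theta> / real CARD('v) ^ 3) * disagreement x"
proof -
  \<comment> \<open>The quotient of \<open>t - 1\<close> by \<open>B\<close> rounded up, which
    selects the first window starting at or after \<open>t\<close>.\<close>
  define s where "s = (t - 1 + (B - 1)) div B"
  have "s * B \<le> t - 1 + (B - 1)" by (simp add: s_def)
  moreover have "t - 1 + (B - 1) < Suc s * B"
    unfolding s_def using B_ge_1 dividend_less_div_times[of B "t - 1 + (B - 1)"] by simp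
  ultimately have s: "t \<le> s * B + 1" "s * B + 1 + B \<le> t + 2 * B"
    using assms B_ge_1 by auto
  define c where "c = s * B + 1 - t"
  have c: "s * B + 1 = t + c" "c + B \<le> 2 * B" using s by (auto simp: c_def)
  have le: "disagreement (mixes P t c x) \<le> disagreement x"
    using disagreement_mixes_antimono[of 0 c t x] by simp
  have "disagreement (mixes P t (2 * B) x) \<le> disagreement (mixes P t (c + B) x)"
    by (rule disagreement_mixes_antimono) fact
  also have "\<dots> = disagreement (mixes P (s * B + 1) B (mixes P t c x))"
    by (simp only: c mixes_add)
  also have "\<dots> \<le> (1 - 2 * \<theta> / real CARD('v) ^ 3) * disagreement (mixes P t c x)"
    by (rule disagreement_window)
  also have "\<dots> \<le> (1 - 2 * \<theta> / real CARD('v) ^ 3) * disagreement x"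
  \<comment> \<open>Monotonicity in the disagreement requires a nonnegative factor. For a single
    agent \<open>1 - 2 * \<theta>\<close> can be negative, but then the disagreement is zero;
    otherwise the cube is at least 8.\<close>
  proof (cases "CARD('v) = 1")
    case True
    have "x i = avg x" for i
    proof -
      have "(UNIV :: 'v set) = {i}" using True by (metis UNIV_I card_1_singletonE singletonD)
      then have "sum x UNIV = x i" by (metis finite.emptyI sum.insert sum.empty add.right_neutral empty_iff)
      then show ?thesis by (simp add: avg_def True)
    qed
    then have "disagreement x = 0" by (simp add: disagreement_def)
    then show ?thesis using le disagreement_nonneg[of "mixes P t c x"] by simp
  next
    case False
    then have "CARD('v) \<ge> 2" using zero_less_card_finite[where 'a='v] by linarith
    then have "(2::real) ^ 3 \<le> real CARD('v) ^ 3" by (intro power_mono) auto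
    then have "2 * \<theta> / real CARD('v) ^ 3 \<le> 2 * \<theta> / 8" using \<theta> by (intro divide_left_mono) auto
    then have "2 * \<theta> / real CARD('v) ^ 3 \<le> 1" using \<theta> by linarith
    then show ?thesis using le by (intro mult_left_mono) auto
  qed
  finally show ?thesis .
qed

lemma card_cube_ge_1: "1 \<le> real CARD('v) ^ 3"
  using one_le_power[of "real CARD('v)" 3] zero_less_card_finite[where 'a='v] by (simp add: Suc_leI)

text \<open>Passing to square roots uses \<open>1 - 2 * c \<le> (1 - c)\<^sup>2\<close>.\<close>

lemma dev_two_windows:
  fixes x :: "'v \<Rightarrow> real^'n"
  assumes "t \<ge> 1"
  shows "dev (mixes P t (2 * B) x) \<le> (1 - \<theta> / real CARD('v) ^ 3) * dev x"
proof -
  define c where "c = \<theta> / real CARD('v) ^ 3"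
  have "c \<le> 1" unfolding c_def by (subst divide_le_eq_1_pos) (use \<theta> card_cube_ge_1 in linarith)+
  have "disagreement (mixes P t (2 * B) x) \<le> (1 - 2 * c) * disagreement x"
    using disagreement_two_windows[OF assms] by (simp add: c_def)
  also have "\<dots> \<le> (1 - c)\<^sup>2 * disagreement x"
    by (intro mult_right_mono disagreement_nonneg) (simp add: power2_diff)
  finally have "dev (mixes P t (2 * B) x) \<le> sqrt ((1 - c)\<^sup>2 * disagreement x)"
    unfolding dev_def by (rule real_sqrt_le_mono)
  then show ?thesis using \<open>c \<le> 1\<close> by (simp add: real_sqrt_mult dev_def c_def)
qed

text \<open>The value of a geometric series: blocks of \<open>2 * B\<close> steps, with the factor
  \<open>1 - \<theta> / real CARD('v) ^ 3\<close> from one block to the next.\<close>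

definition mixing_time :: real where
  "mixing_time = 2 * real B * real CARD('v) ^ 3 / \<theta>"

lemma mixing_time_pos: "mixing_time > 0"
  using B_ge_1 \<theta> by (simp add: mixing_time_def)

text \<open>Strong induction splits off the first \<open>2 * B\<close> steps; the equation
  \<open>S\<close> is the fixed-point equation of the geometric series.\<close>

lemma sum_dev_mixes_le:
  fixes x :: "'v \<Rightarrow> real^'n"
  assumes "t \<ge> 1"
  shows "(\<Sum>k<m. dev (mixes P t k x)) \<le> mixing_time * dev x"
  using assms
proof (induction m arbitrary: t x rule: less_induct)
  case (less m)
  have le: "dev (mixes P t k x) \<le> dev x" for k
    using disagreement_mixes_antimono[of 0 k t x] by (simp add: dev_def)
  have S: "2 * real B + mixing_time * (1 - \<theta> / real CARD('v) ^ 3) = mixing_time"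
    using \<theta> card_cube_ge_1 by (simp add: mixing_time_def field_simps)
  have S1: "2 * real B \<le> mixing_time"
  proof -
    have "\<theta> \<le> real CARD('v) ^ 3" using \<theta> card_cube_ge_1 by linarith
    then show ?thesis using \<theta> B_ge_1 by (simp add: mixing_time_def field_simps)
  qed
  have first: "(\<Sum>k<n. dev (mixes P t k x)) \<le> real n * dev x" for n
    using sum_bounded_above[of "{..<n}" "\<lambda>k. dev (mixes P t k x)" "dev x"] le by simp
  show ?case
  proof (cases "m \<le> 2 * B")
    case True
    have "(\<Sum>k<m. dev (mixes P t k x)) \<le> real m * dev x" by (rule first)
    also have "\<dots> \<le> mixing_time * dev x"
      using True S1 by (intro mult_right_mono dev_nonneg) linarith
    finally show ?thesis .
  next
    case False
    define m' where "m' = m - 2 * B"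
    have m: "m = 2 * B + m'" using False by (simp add: m'_def)
    have "(\<Sum>k<m. dev (mixes P t k x)) = (\<Sum>k<2 * B. dev (mixes P t k x)) + (\<Sum>k<m'. dev (mixes P t (2 * B + k) x))"
      unfolding m by (induction m') (simp_all add: add.assoc)
    also have "(\<Sum>k<m'. dev (mixes P t (2 * B + k) x)) = (\<Sum>k<m'. dev (mixes P (t + 2 * B) k (mixes P t (2 * B) x)))"
      by (simp only: mixes_add)
    also have "\<dots> \<le> mixing_time * dev (mixes P t (2 * B) x)"
      using less.prems B_ge_1 False by (intro less.IH) (auto simp: m'_def)
    also have "\<dots> \<le> mixing_time * ((1 - \<theta> / real CARD('v) ^ 3) * dev x)"
      using mixing_time_pos less.prems by (intro mult_left_mono dev_two_windows) auto
    also have "(\<Sum>k<2 * B. dev (mixes P t k x)) \<le> 2 * real B * dev x"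
      using first[of "2 * B"] by simp
    finally have "(\<Sum>k<m. dev (mixes P t k x))
        \<le> (2 * real B + mixing_time * (1 - \<theta> / real CARD('v) ^ 3)) * dev x"
      by (simp add: algebra_simps)
    then show ?thesis by (simp only: S)
  qed
qed

text \<open>By linearity the state is the free evolution of \<open>x a\<close> plus the free
  evolutions of the errors, and each of these is summed over time with the same constant.\<close>

lemma sum_dev_perturbed_le:
  fixes x \<epsilon> :: "nat \<Rightarrow> 'v \<Rightarrow> real^'n"
  assumes step: "\<And>t i. x (Suc t) i = mix (P t) (x t) i + \<epsilon> t i" and "a \<ge> 1"
  shows "(\<Sum>k<m. dev (x (a + k))) \<le> mixing_time * (dev (x a) + (\<Sum>k<m. dev (\<epsilon> (a + k))))"
proof -
  have "(\<Sum>k<m. dev (x (a + k))) \<le> (\<Sum>k<m. dev (mixes P a k (x a))) + mixing_time * (\<Sum>k<m. dev (\<epsilon> (a + k)))"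
  proof (induction m arbitrary: a)
    case (Suc m)
    have x: "x (Suc a) = (\<lambda>i. mix (P a) (x a) i + \<epsilon> a i)" by (simp add: step fun_eq_iff)
    have "(\<Sum>k<m. dev (mixes P (Suc a) k (x (Suc a))))
        \<le> (\<Sum>k<m. dev (mixes P (Suc a) k (mix (P a) (x a))) + dev (mixes P (Suc a) k (\<epsilon> a)))"
      unfolding x mixes_plus by (intro sum_mono dev_triangle)
    also have "\<dots> \<le> (\<Sum>k<m. dev (mixes P a (Suc k) (x a))) + mixing_time * dev (\<epsilon> a)"
      unfolding sum.distrib mixes_Suc' by (intro add_left_mono sum_dev_mixes_le) simp
    finally show ?case
      using Suc[of "Suc a"] by (simp add: sum.lessThan_Suc_shift distrib_left del: sum.lessThan_Suc mixes.simps(2))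
  qed simp
  also have "\<dots> \<le> mixing_time * dev (x a) + mixing_time * (\<Sum>k<m. dev (\<epsilon> (a + k)))"
    by (intro add_right_mono sum_dev_mixes_le assms)
  finally show ?thesis by (simp add: distrib_left)
qed

end

section \<open>Azuma-Hoeffding and conditional expectations\<close>

text \<open>The derivative of \<open>x\<^sup>2 / 2 - ln (cosh x)\<close> is
  \<open>x - tanh x\<close>, whose derivative is \<open>(tanh x)\<^sup>2\<close>; both functions are
  therefore nonnegative for \<open>x \<ge> 0\<close>, and evenness covers the rest.\<close>

lemma cosh_le_exp_half_square: "cosh (x::real) \<le> exp (x\<^sup>2 / 2)"
proof -
  have pos: "cosh x \<le> exp (x\<^sup>2 / 2)" if "x \<ge> 0" for x :: real
  proof -
    have tanh_le: "tanh y \<le> y" if "y \<ge> 0" for y :: real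
    proof -
      have "(\<lambda>y. y - tanh y) 0 \<le> (\<lambda>y. y - tanh y) y"
      proof (rule DERIV_nonneg_imp_nondecreasing[OF that])
        fix z :: real
        have "((\<lambda>y. y - tanh y) has_real_derivative (tanh z)\<^sup>2) (at z)"
          by (auto intro!: derivative_eq_intros)
        then show "\<exists>d. ((\<lambda>y. y - tanh y) has_real_derivative d) (at z) \<and> 0 \<le> d"
          by (intro exI[of _ "(tanh z)\<^sup>2"]) simp
      qed
      then show ?thesis by simp
    qed
    have "(\<lambda>x. x\<^sup>2 / 2 - ln (cosh x)) 0 \<le> (\<lambda>x. x\<^sup>2 / 2 - ln (cosh x)) x"
    proof (rule DERIV_nonneg_imp_nondecreasing[OF that])
      fix z :: real assume "0 \<le> z" "z \<le> x"
      have "((\<lambda>x. x\<^sup>2 / 2 - ln (cosh x)) has_real_derivative (z - tanh z)) (at z)"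
        by (auto intro!: derivative_eq_intros simp: tanh_def)
      then show "\<exists>d. ((\<lambda>x. x\<^sup>2 / 2 - ln (cosh x)) has_real_derivative d) (at z) \<and> 0 \<le> d"
        using tanh_le[OF \<open>0 \<le> z\<close>] by (intro exI[of _ "z - tanh z"]) simp
    qed
    then have "ln (cosh x) \<le> x\<^sup>2 / 2" by simp
    then show ?thesis by (metis cosh_real_pos exp_le_cancel_iff exp_ln)
  qed
  show ?thesis
  proof (cases "x \<ge> 0")
    case False
    then show ?thesis using pos[of "- x"] by simp
  qed (rule pos)
qed

text \<open>Convexity of \<open>exp\<close>, with \<open>z\<close> written as a convex combination
  of \<open>c\<close> and \<open>- c\<close>.\<close>

lemma exp_le_chord:
  fixes z c l :: real
  assumes "\<bar>z\<bar> \<le> c" "c > 0"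
  shows "exp (l * z) \<le> cosh (l * c) + sinh (l * c) / c * z"
proof -
  define u where "u = (c - z) / (2 * c)"
  have u: "0 \<le> u" "u \<le> 1" using assms by (auto simp: u_def abs_le_iff field_simps)
  have z: "l * z = (1 - u) * (l * c) + u * (- (l * c))"
    using assms(2) by (simp add: u_def field_simps)
  have "exp (l * z) \<le> (1 - u) * exp (l * c) + u * exp (- (l * c))"
    unfolding z using convex_onD[OF exp_convex u, of "l * c" "- (l * c)"] by simp
  also have "\<dots> = cosh (l * c) + (1 - 2 * u) * sinh (l * c)"
    unfolding cosh_plus_sinh[symmetric] cosh_minus_sinh[symmetric] by (simp add: algebra_simps)
  also have "1 - 2 * u = z / c"
    using assms(2) by (simp add: u_def field_simps)
  finally show ?thesis by (simp add: mult.commute)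
qed

lemma borel_measurable_vec_nth [measurable]: "(\<lambda>x::real^'n. x $ k) \<in> borel_measurable borel"
  by (rule borel_measurable_continuous_onI) (rule continuous_on_component[OF continuous_on_id])

lemma borel_measurable_vec_lambda:
  fixes f :: "'n::finite \<Rightarrow> 'a \<Rightarrow> real"
  assumes "\<And>k. f k \<in> borel_measurable M"
  shows "(\<lambda>x. \<chi> k. f k x) \<in> borel_measurable M"
proof (rule borel_measurable_euclidean_space[THEN iffD2], rule)
  fix b :: "real^'n" assume "b \<in> Basis"
  then obtain k where b: "b = axis k 1" by (auto simp: Basis_vec_def)
  show "(\<lambda>x. (\<chi> k. f k x) \<bullet> b) \<in> borel_measurable M"
    unfolding b inner_axis using assms by simp
qed

lemma (in prob_space) sigma_finite_subalgebraI:
  assumes "subalgebra M F"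
  shows "sigma_finite_subalgebra M F"
proof -
  interpret finite_measure_subalgebra M F by unfold_locales (rule assms)
  show ?thesis by (rule sigma_finite_subalgebra_axioms)
qed

section \<open>Exponential moments of bounded martingale differences\<close>

context prob_space
begin

context
  fixes G :: "nat \<Rightarrow> 'a measure" and D :: "nat \<Rightarrow> 'a \<Rightarrow> real" and c :: real
  assumes sub: "\<And>t. subalgebra M (G t)"
    and adapted: "\<And>s t. s < t \<Longrightarrow> D s \<in> borel_measurable (G t)"
    and bounded: "\<And>t. AE \<omega> in M. \<bar>D t \<omega>\<bar> \<le> c"
    and martingale: "\<And>t. AE \<omega> in M. real_cond_exp M (G t) (D t) \<omega> = 0"
begin

lemma martingale_difference_measurable [measurable]: "D t \<in> borel_measurable M"
  using measurable_from_subalg[OF sub adapted[of t "Suc t"]] by simp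

lemma AE_partial_sum_bounded: "AE \<omega> in M. \<bar>\<Sum>s<n. D s \<omega>\<bar> \<le> real n * c"
proof -
  have "AE \<omega> in M. \<forall>s\<in>{..<n}. \<bar>D s \<omega>\<bar> \<le> c" using bounded by (simp add: AE_ball_countable)
  then show ?thesis
  proof eventually_elim
    case (elim \<omega>)
    have "\<bar>\<Sum>s<n. D s \<omega>\<bar> \<le> (\<Sum>s<n. \<bar>D s \<omega>\<bar>)" by (rule sum_abs)
    also have "\<dots> \<le> real n * c" using elim sum_bounded_above[of "{..<n}" "\<lambda>s. \<bar>D s \<omega>\<bar>" c] by simp
    finally show ?case .
  qed
qed

lemma integrable_exp_partial_sum: "integrable M (\<lambda>\<omega>. exp (l * (\<Sum>s<n. D s \<omega>)))"
proof (rule integrable_const_bound)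
  show "AE \<omega> in M. norm (exp (l * (\<Sum>s<n. D s \<omega>))) \<le> exp (\<bar>l\<bar> * (real n * c))"
    using AE_partial_sum_bounded[of n]
  proof eventually_elim
    case (elim \<omega>)
    have "l * (\<Sum>s<n. D s \<omega>) \<le> \<bar>l\<bar> * \<bar>\<Sum>s<n. D s \<omega>\<bar>" by (metis abs_ge_self abs_mult)
    also have "\<dots> \<le> \<bar>l\<bar> * (real n * c)" using elim by (intro mult_left_mono) auto
    finally show ?case by simp
  qed
qed measurable

text \<open>
  On \<open>[-c, c]\<close> the exponential lies below its chord, whose linear part integrates to zero; this avoids a
  conditional version of Hoeffding's lemma.
\<close>

lemma expectation_exp_partial_sum_le:
  assumes "c > 0"
  shows "expectation (\<lambda>\<omega>. exp (l * (\<Sum>s<n. D s \<omega>))) \<le> exp (real n * (l * c)\<^sup>2 / 2)"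
proof (induction n)
  case 0
  then show ?case by (simp add: prob_space)
next
  case (Suc n)
  interpret sf: sigma_finite_subalgebra M "G n" using sub by (rule sigma_finite_subalgebraI)
  define E where "E \<omega> = exp (l * (\<Sum>s<n. D s \<omega>))" for \<omega>
  have E_int: "integrable M E" unfolding E_def by (rule integrable_exp_partial_sum)
  have E_G: "E \<in> borel_measurable (G n)"
    unfolding E_def by (intro borel_measurable_exp[THEN measurable_compose[rotated]] borel_measurable_times borel_measurable_sum adapted measurable_const) auto
  have ED_int: "integrable M (\<lambda>\<omega>. E \<omega> * D n \<omega>)"
  proof (rule Bochner_Integration.integrable_bound[of M "\<lambda>\<omega>. c * E \<omega>"])
    show "AE \<omega> in M. norm (E \<omega> * D n \<omega>) \<le> norm (c * E \<omega>)"
      using bounded[of n]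
    proof eventually_elim
      case (elim \<omega>)
      then have "E \<omega> * \<bar>D n \<omega>\<bar> \<le> E \<omega> * c" by (intro mult_left_mono) (auto simp: E_def)
      then show ?case using assms by (simp add: abs_mult E_def mult.commute)
    qed
    show "(\<lambda>\<omega>. E \<omega> * D n \<omega>) \<in> borel_measurable M" using E_int by measurable
  qed (use E_int in simp)
  have "expectation (\<lambda>\<omega>. E \<omega> * real_cond_exp M (G n) (D n) \<omega>) = expectation (\<lambda>\<omega>. E \<omega> * D n \<omega>)"
    by (rule sf.real_cond_exp_intg(2)[OF ED_int E_G]) measurable
  moreover have "expectation (\<lambda>\<omega>. E \<omega> * real_cond_exp M (G n) (D n) \<omega>) = 0"
    using martingale[of n] by (intro integral_eq_zero_AE) (auto elim: eventually_mono)
  ultimately have zero: "expectation (\<lambda>\<omega>. E \<omega> * D n \<omega>) = 0" by simp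
  have "expectation (\<lambda>\<omega>. exp (l * (\<Sum>s<Suc n. D s \<omega>)))
      \<le> expectation (\<lambda>\<omega>. cosh (l * c) * E \<omega> + sinh (l * c) / c * (E \<omega> * D n \<omega>))"
  proof (rule integral_mono_AE)
    show "integrable M (\<lambda>\<omega>. exp (l * (\<Sum>s<Suc n. D s \<omega>)))" by (rule integrable_exp_partial_sum)
    show "integrable M (\<lambda>\<omega>. cosh (l * c) * E \<omega> + sinh (l * c) / c * (E \<omega> * D n \<omega>))"
      using E_int ED_int by simp
    show "AE \<omega> in M. exp (l * (\<Sum>s<Suc n. D s \<omega>)) \<le> cosh (l * c) * E \<omega> + sinh (l * c) / c * (E \<omega> * D n \<omega>)"
      using bounded[of n]
    proof eventually_elim
      case (elim \<omega>)
      have "exp (l * (\<Sum>s<Suc n. D s \<omega>)) = E \<omega> * exp (l * D n \<omega>)"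
        by (simp add: E_def exp_add distrib_left)
      also have "\<dots> \<le> E \<omega> * (cosh (l * c) + sinh (l * c) / c * D n \<omega>)"
        using elim assms by (intro mult_left_mono exp_le_chord) (auto simp: E_def)
      finally show ?case by (simp add: algebra_simps)
    qed
  qed
  also have "\<dots> = cosh (l * c) * expectation E"
    using E_int ED_int zero by simp
  also have "\<dots> \<le> exp ((l * c)\<^sup>2 / 2) * exp (real n * (l * c)\<^sup>2 / 2)"
    using Suc by (intro mult_mono cosh_le_exp_half_square) (auto simp: E_def[abs_def] cosh_real_nonneg)
  also have "\<dots> = exp (real (Suc n) * (l * c)\<^sup>2 / 2)"
    by (simp add: exp_add[symmetric] field_simps)
  finally show ?case .
qed

text \<open>Chernoff's bound with the optimal exponent. The deviation is stated for any
  \<open>m \<ge> n\<close> because later only the steps after a certain time are summed while the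
  bound refers to the whole horizon.\<close>

theorem azuma_hoeffding:
  assumes "0 < \<delta>" "\<delta> < 1" "n \<le> m" "0 \<le> c"
  shows "prob {\<omega> \<in> space M. (\<Sum>s<n. D s \<omega>) \<le> c * sqrt (2 * real m * ln (1 / \<delta>))} \<ge> 1 - \<delta>"
\<comment> \<open>The exponent \<open>l\<close> below divides by \<open>real m * c\<^sup>2\<close>;
  in the degenerate case the sum vanishes almost surely.\<close>
proof (cases "c = 0 \<or> m = 0")
  case True
  have nn: "0 \<le> c * sqrt (2 * real m * ln (1 / \<delta>))" using assms by simp
  have "AE \<omega> in M. (\<Sum>s<n. D s \<omega>) \<le> c * sqrt (2 * real m * ln (1 / \<delta>))"
    using AE_partial_sum_bounded[of n]
  proof eventually_elim
    case (elim \<omega>)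
    then show ?case using True assms nn by auto
  qed
  then have "prob {\<omega> \<in> space M. (\<Sum>s<n. D s \<omega>) \<le> c * sqrt (2 * real m * ln (1 / \<delta>))} = 1"
    by (subst prob_Collect_eq_1) auto
  then show ?thesis using assms by simp
next
  case False
  then have c: "c > 0" and m: "m > 0" using assms by auto
  define L where "L = ln (1 / \<delta>)"
  define \<epsilon> where "\<epsilon> = c * sqrt (2 * real m * L)"
  have L: "L > 0" using assms by (simp add: L_def)
  have \<epsilon>: "\<epsilon> > 0" "\<epsilon>\<^sup>2 = c\<^sup>2 * (2 * real m * L)" using c m L by (auto simp: \<epsilon>_def power_mult_distrib)
  \<comment> \<open>Minimises \<open>- l * \<epsilon> + real m * (l * c)\<^sup>2 / 2\<close> over
    \<open>l\<close>.\<close>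
  define l where "l = \<epsilon> / (real m * c\<^sup>2)"
  have l: "l > 0" using \<epsilon> c m by (simp add: l_def)
  have le: "l * \<epsilon> = 2 * L" "(l * c)\<^sup>2 = 2 * L / real m"
    using \<epsilon>(2) c m by (simp_all add: l_def power_divide power_mult_distrib power2_eq_square[of \<epsilon>, symmetric] field_simps)
       (simp_all add: power2_eq_square)
  let ?S = "\<lambda>\<omega>. \<Sum>s<n. D s \<omega>"
  have "set_integrable M (space M) (\<lambda>\<omega>. exp (l * ?S \<omega>))"
    unfolding set_integrable_def by (intro integrable_mult_indicator integrable_exp_partial_sum) simp
  then have "prob {\<omega> \<in> space M. \<epsilon> \<le> ?S \<omega>} \<le> exp (- l * \<epsilon>) * (\<integral>\<omega>\<in>space M. exp (l * ?S \<omega>) \<partial>M)"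
    by (intro Chernoff_ineq_ge l) auto
  also have "\<dots> = exp (- l * \<epsilon>) * expectation (\<lambda>\<omega>. exp (l * ?S \<omega>))"
    using integrable_exp_partial_sum[of l n] by (simp add: set_integral_space)
  also have "\<dots> \<le> exp (- l * \<epsilon>) * exp (real n * (l * c)\<^sup>2 / 2)"
    by (intro mult_left_mono expectation_exp_partial_sum_le c) auto
  also have "\<dots> \<le> exp (- l * \<epsilon>) * exp (real m * (l * c)\<^sup>2 / 2)"
    using assms(3) by (simp add: mult_right_mono divide_right_mono)
  also have "\<dots> = exp (- L)"
    using m le by (simp add: exp_add[symmetric])
  also have "\<dots> = \<delta>" using assms by (simp add: L_def ln_div)
  finally have *: "prob {\<omega> \<in> space M. \<epsilon> \<le> ?S \<omega>} \<le> \<delta>" .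
  have "1 - \<delta> \<le> 1 - prob {\<omega> \<in> space M. \<epsilon> \<le> ?S \<omega>}" using * by simp
  also have "\<dots> = prob (space M - {\<omega> \<in> space M. \<epsilon> \<le> ?S \<omega>})"
    by (rule prob_compl[symmetric]) measurable
  also have "\<dots> \<le> prob {\<omega> \<in> space M. ?S \<omega> \<le> \<epsilon>}"
    by (intro finite_measure_mono) (auto, measurable)
  finally show ?thesis by (simp add: \<epsilon>_def L_def)
qed

end

section \<open>Conditional means of random vectors\<close>

context
  fixes G :: "'a measure" and Z :: "'a \<Rightarrow> real^'n" and K :: real
  assumes sub: "subalgebra M G"
    and Z [measurable]: "Z \<in> borel_measurable M"
    and Z_le: "AE \<omega> in M. norm (Z \<omega>) \<le> K"
begin

interpretation sf: sigma_finite_subalgebra M G using sub by (rule sigma_finite_subalgebraI)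

lemma vec_cond_exp_measurable: "vec_cond_exp M G Z \<in> borel_measurable G"
  unfolding vec_cond_exp_def by (rule borel_measurable_vec_lambda) (rule borel_measurable_cond_exp)

lemma component_measurable [measurable]: "(\<lambda>\<omega>. Z \<omega> $ k) \<in> borel_measurable M"
  by (rule measurable_compose[OF Z borel_measurable_vec_nth])

text \<open>The pull-out property for each product of components, summed over the
  components.\<close>

lemma AE_vec_cond_exp_inner:
  assumes v: "v \<in> borel_measurable G" and v_le: "AE \<omega> in M. norm (v \<omega>) \<le> V"
  shows "integrable M (\<lambda>\<omega>. v \<omega> \<bullet> Z \<omega>)"
    and "AE \<omega> in M. real_cond_exp M G (\<lambda>\<omega>. v \<omega> \<bullet> Z \<omega>) \<omega> = v \<omega> \<bullet> vec_cond_exp M G Z \<omega>"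
proof -
  have v_M [measurable]: "v \<in> borel_measurable M" by (rule measurable_from_subalg[OF sub v])
  have vk [measurable]: "(\<lambda>\<omega>. v \<omega> $ k) \<in> borel_measurable G" for k
    by (rule measurable_compose[OF v borel_measurable_vec_nth])
  note [measurable] = measurable_from_subalg[OF sub vk]
  have int: "integrable M (\<lambda>\<omega>. v \<omega> $ k * Z \<omega> $ k)" for k
  proof (rule integrable_const_bound[of _ "V * K"])
    show "AE \<omega> in M. norm (v \<omega> $ k * Z \<omega> $ k) \<le> V * K"
      using v_le Z_le
    proof eventually_elim
      case (elim \<omega>)
      have "norm (v \<omega> $ k * Z \<omega> $ k) \<le> norm (v \<omega>) * norm (Z \<omega>)"
        by (simp add: abs_mult component_le_norm_cart mult_mono)
      also have "\<dots> \<le> V * K" using elim by (intro mult_mono) (auto intro: order_trans[OF norm_ge_zero])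
      finally show ?case .
    qed
  qed measurable
  show "integrable M (\<lambda>\<omega>. v \<omega> \<bullet> Z \<omega>)"
    using int by (simp add: inner_vec_def)
  have "AE \<omega> in M. \<forall>k. real_cond_exp M G (\<lambda>\<omega>. v \<omega> $ k * Z \<omega> $ k) \<omega> = v \<omega> $ k * real_cond_exp M G (\<lambda>\<omega>. Z \<omega> $ k) \<omega>"
    using int by (simp add: AE_all_countable sf.real_cond_exp_mult)
  moreover have "AE \<omega> in M. real_cond_exp M G (\<lambda>\<omega>. \<Sum>k\<in>UNIV. v \<omega> $ k * Z \<omega> $ k) \<omega>
      = (\<Sum>k\<in>UNIV. real_cond_exp M G (\<lambda>\<omega>. v \<omega> $ k * Z \<omega> $ k) \<omega>)"
    by (rule sf.real_cond_exp_sum) (rule int)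
  ultimately show "AE \<omega> in M. real_cond_exp M G (\<lambda>\<omega>. v \<omega> \<bullet> Z \<omega>) \<omega> = v \<omega> \<bullet> vec_cond_exp M G Z \<omega>"
    by eventually_elim (simp add: inner_vec_def vec_cond_exp_def)
qed

text \<open>The conditional mean is tested against its own direction, a \<open>G\<close>-measurable
  vector of norm at most one, which reduces the claim to monotonicity of real conditional
  expectations.\<close>

lemma AE_norm_vec_cond_exp_le: "AE \<omega> in M. norm (vec_cond_exp M G Z \<omega>) \<le> K"
proof -
  let ?v = "\<lambda>\<omega>. sgn (vec_cond_exp M G Z \<omega>)"
  have v: "?v \<in> borel_measurable G"
    using vec_cond_exp_measurable by (simp add: sgn_div_norm)
  have v_le: "AE \<omega> in M. norm (?v \<omega>) \<le> 1" by (simp add: norm_sgn)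
  note * = AE_vec_cond_exp_inner[OF v v_le]
  have "AE \<omega> in M. ?v \<omega> \<bullet> Z \<omega> \<le> K"
    using Z_le
  proof eventually_elim
    case (elim \<omega>)
    have "?v \<omega> \<bullet> Z \<omega> \<le> norm (?v \<omega>) * norm (Z \<omega>)" by (rule norm_cauchy_schwarz)
    also have "\<dots> \<le> 1 * norm (Z \<omega>)" by (intro mult_right_mono) (auto simp: norm_sgn)
    finally show ?case using elim by simp
  qed
  then have "AE \<omega> in M. real_cond_exp M G (\<lambda>\<omega>. ?v \<omega> \<bullet> Z \<omega>) \<omega> \<le> real_cond_exp M G (\<lambda>_. K) \<omega>"
    by (intro sf.real_cond_exp_mono * integrable_const)
  moreover have "AE \<omega> in M. real_cond_exp M G (\<lambda>_. K) \<omega> = K"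
    by (intro sf.real_cond_exp_F_meas) auto
  ultimately show ?thesis
    using *(2)
  proof eventually_elim
    case (elim \<omega>)
    have "?v \<omega> \<bullet> vec_cond_exp M G Z \<omega> = norm (vec_cond_exp M G Z \<omega>)"
      by (simp add: sgn_div_norm power2_norm_eq_inner[symmetric] power2_eq_square divide_simps)
    then show ?case using elim by simp
  qed
qed

text \<open>By the pull-out property both parts of the difference have the same conditional
  expectation. This is the martingale property of the subgradient noise.\<close>

lemma vec_cond_exp_residual_orthogonal:
  assumes v: "v \<in> borel_measurable G" and v_le: "AE \<omega> in M. norm (v \<omega>) \<le> V"
  shows "integrable M (\<lambda>\<omega>. v \<omega> \<bullet> (vec_cond_exp M G Z \<omega> - Z \<omega>))"
    and "AE \<omega> in M. real_cond_exp M G (\<lambda>\<omega>. v \<omega> \<bullet> (vec_cond_exp M G Z \<omega> - Z \<omega>)) \<omega> = 0"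
proof -
  have [measurable]: "(\<lambda>\<omega>. v \<omega> \<bullet> vec_cond_exp M G Z \<omega>) \<in> borel_measurable G"
    using v vec_cond_exp_measurable by measurable
  have int: "integrable M (\<lambda>\<omega>. v \<omega> \<bullet> vec_cond_exp M G Z \<omega>)"
  proof (rule integrable_const_bound[of _ "V * K"])
    show "AE \<omega> in M. norm (v \<omega> \<bullet> vec_cond_exp M G Z \<omega>) \<le> V * K"
      using v_le AE_norm_vec_cond_exp_le
    proof eventually_elim
      case (elim \<omega>)
      have "norm (v \<omega> \<bullet> vec_cond_exp M G Z \<omega>) \<le> norm (v \<omega>) * norm (vec_cond_exp M G Z \<omega>)"
        by (simp add: Cauchy_Schwarz_ineq2)
      also have "\<dots> \<le> V * K" using elim by (intro mult_mono) (auto intro: order_trans[OF norm_ge_zero])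
      finally show ?case .
    qed
    show "(\<lambda>\<omega>. v \<omega> \<bullet> vec_cond_exp M G Z \<omega>) \<in> borel_measurable M"
      by (rule measurable_from_subalg[OF sub]) measurable
  qed
  note * = AE_vec_cond_exp_inner[OF v v_le]
  show "integrable M (\<lambda>\<omega>. v \<omega> \<bullet> (vec_cond_exp M G Z \<omega> - Z \<omega>))"
    using int *(1) by (simp add: inner_diff_right)
  have "AE \<omega> in M. real_cond_exp M G (\<lambda>\<omega>. v \<omega> \<bullet> vec_cond_exp M G Z \<omega> - v \<omega> \<bullet> Z \<omega>) \<omega>
     = real_cond_exp M G (\<lambda>\<omega>. v \<omega> \<bullet> vec_cond_exp M G Z \<omega>) \<omega> - real_cond_exp M G (\<lambda>\<omega>. v \<omega> \<bullet> Z \<omega>) \<omega>"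
    by (rule sf.real_cond_exp_diff[OF int *(1)])
  moreover have "AE \<omega> in M. real_cond_exp M G (\<lambda>\<omega>. v \<omega> \<bullet> vec_cond_exp M G Z \<omega>) \<omega> = v \<omega> \<bullet> vec_cond_exp M G Z \<omega>"
    by (rule sf.real_cond_exp_F_meas[OF int]) measurable
  ultimately show "AE \<omega> in M. real_cond_exp M G (\<lambda>\<omega>. v \<omega> \<bullet> (vec_cond_exp M G Z \<omega> - Z \<omega>)) \<omega> = 0"
    using *(2) unfolding inner_diff_right by eventually_elim simp
qed

end

text \<open>As \<open>m\<close> is constant, it is the expectation of \<open>Z\<close>, and Young's
  inequality bounds \<open>(norm m)\<^sup>2\<close> by the mean of itself and the second moment. At
  a fixed point \<open>z\<close> of \<open>X\<close> this bounds the deterministic subgradient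
  \<open>g i z\<close> by \<open>Gf\<close>.\<close>

lemma norm_cond_mean_le_of_second_moment:
  fixes Z :: "'a \<Rightarrow> real^'n"
  assumes sub: "subalgebra M G" and Z [measurable]: "Z \<in> borel_measurable M"
    and mean: "AE \<omega> in M. vec_cond_exp M G Z \<omega> = m"
    and second: "AE \<omega> in M. nn_cond_exp M G (\<lambda>\<omega>. ennreal ((norm (Z \<omega>))\<^sup>2)) \<omega> \<le> ennreal (K\<^sup>2)"
    and "0 \<le> K"
  shows "norm m \<le> K"
proof -
  interpret sf: sigma_finite_subalgebra M G using sub by (rule sigma_finite_subalgebraI)
  have "(\<integral>\<^sup>+ \<omega>. ennreal ((norm (Z \<omega>))\<^sup>2) \<partial>M) = (\<integral>\<^sup>+ \<omega>. nn_cond_exp M G (\<lambda>\<omega>. ennreal ((norm (Z \<omega>))\<^sup>2)) \<omega> \<partial>M)"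
    using sf.nn_cond_exp_intg[of "\<lambda>_. 1" "\<lambda>\<omega>. ennreal ((norm (Z \<omega>))\<^sup>2)"] by simp
  also have "\<dots> \<le> (\<integral>\<^sup>+ \<omega>. ennreal (K\<^sup>2) \<partial>M)" by (rule nn_integral_mono_AE[OF second])
  finally have nn: "(\<integral>\<^sup>+ \<omega>. ennreal ((norm (Z \<omega>))\<^sup>2) \<partial>M) \<le> ennreal (K\<^sup>2)"
    by (simp add: emeasure_space_1)
  have sq_int: "integrable M (\<lambda>\<omega>. (norm (Z \<omega>))\<^sup>2)"
    by (rule integrableI_nonneg) (use nn in \<open>auto intro: le_less_trans\<close>)
  have sq_le: "expectation (\<lambda>\<omega>. (norm (Z \<omega>))\<^sup>2) \<le> K\<^sup>2"
    using nn nn_integral_eq_integral[OF sq_int] by (simp add: ennreal_le_iff)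
  \<comment> \<open>The finite second moment gives integrability, without which
    \<open>vec_cond_exp\<close> would not be a genuine conditional mean.\<close>
  have Z_int: "integrable M Z"
  proof (rule Bochner_Integration.integrable_bound[of M "\<lambda>\<omega>. 1 + (norm (Z \<omega>))\<^sup>2"])
    show "AE \<omega> in M. norm (Z \<omega>) \<le> norm (1 + (norm (Z \<omega>))\<^sup>2)"
    proof (rule AE_I2)
      fix \<omega>
      have "0 \<le> (norm (Z \<omega>) - 1)\<^sup>2 + (norm (Z \<omega>))\<^sup>2" by simp
      then have "2 * norm (Z \<omega>) \<le> 1 + 2 * (norm (Z \<omega>))\<^sup>2" by (simp add: power2_diff)
      then have "norm (Z \<omega>) \<le> 1 + (norm (Z \<omega>))\<^sup>2" by simp
      then show "norm (Z \<omega>) \<le> norm (1 + (norm (Z \<omega>))\<^sup>2)" by simp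
    qed
  qed (use sq_int in auto)
  have comp_int: "integrable M (\<lambda>\<omega>. Z \<omega> $ k)" for k
    by (rule Bochner_Integration.integrable_bound[OF Z_int]) (auto simp: component_le_norm_cart)
  have m_k: "m $ k = expectation (\<lambda>\<omega>. Z \<omega> $ k)" for k
  proof -
    have "expectation (\<lambda>\<omega>. Z \<omega> $ k) = expectation (real_cond_exp M G (\<lambda>\<omega>. Z \<omega> $ k))"
      using sf.real_cond_exp_int(2)[OF comp_int] by simp
    also have "\<dots> = expectation (\<lambda>_. m $ k)"
    proof (rule integral_cong_AE)
      show "AE \<omega> in M. real_cond_exp M G (\<lambda>\<omega>. Z \<omega> $ k) \<omega> = m $ k"
        using mean by eventually_elim (auto simp: vec_cond_exp_def)
    qed auto
    finally show ?thesis by (simp add: prob_space)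
  qed
  have "(norm m)\<^sup>2 = expectation (\<lambda>\<omega>. m \<bullet> Z \<omega>)"
    using comp_int by (simp add: power2_norm_eq_inner inner_vec_def m_k[symmetric])
  also have "\<dots> \<le> expectation (\<lambda>\<omega>. ((norm m)\<^sup>2 + (norm (Z \<omega>))\<^sup>2) / 2)"
  proof (rule integral_mono)
    fix \<omega>
    have "m \<bullet> Z \<omega> \<le> norm m * norm (Z \<omega>)" by (rule norm_cauchy_schwarz)
    also have "\<dots> \<le> ((norm m)\<^sup>2 + (norm (Z \<omega>))\<^sup>2) / 2"
      using sum_squares_bound[of "norm m" "norm (Z \<omega>)"] by simp
    finally show "m \<bullet> Z \<omega> \<le> ((norm m)\<^sup>2 + (norm (Z \<omega>))\<^sup>2) / 2" .
  qed (use sq_int Z_int in auto)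
  also have "\<dots> = ((norm m)\<^sup>2 + expectation (\<lambda>\<omega>. (norm (Z \<omega>))\<^sup>2)) / 2"
    using sq_int by (simp add: prob_space)
  finally have "(norm m)\<^sup>2 \<le> K\<^sup>2" using sq_le by simp
  then show ?thesis using \<open>0 \<le> K\<close> by (rule power2_le_imp_le)
qed

end

section \<open>A trajectory of the algorithm\<close>

lemma sum_atLeast1_split:
  fixes h :: "nat \<Rightarrow> 'a::comm_monoid_add"
  shows "(\<Sum>t = 1..\<tau> + m. h t) = (\<Sum>t = 1..\<tau>. h t) + (\<Sum>k<m. h (Suc \<tau> + k))"
  by (induction m) (simp_all add: add.assoc)

text \<open>Abel summation through the invariant \<open>(\<Sum>k<n. \<alpha> k * d k) \<le> \<alpha>
  n * (\<Sum>k<n. d k)\<close>: lowering the weight of a nonpositive partial sum only increases the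
  product.\<close>

lemma decseq_weighted_sum_nonpos:
  fixes \<alpha> d :: "nat \<Rightarrow> real"
  assumes "decseq \<alpha>" "\<And>k. 0 \<le> \<alpha> k" "\<And>n. n \<le> m \<Longrightarrow> (\<Sum>k<n. d k) \<le> 0"
  shows "(\<Sum>k<m. \<alpha> k * d k) \<le> 0"
proof -
  have "(\<Sum>k<n. \<alpha> k * d k) \<le> \<alpha> n * (\<Sum>k<n. d k)" if "n \<le> m" for n
    using that
  proof (induction n)
    case (Suc n)
    have "(\<Sum>k<Suc n. \<alpha> k * d k) \<le> \<alpha> n * (\<Sum>k<Suc n. d k)"
      using Suc by (simp add: distrib_left)
    also have "\<dots> \<le> \<alpha> (Suc n) * (\<Sum>k<Suc n. d k)"
      using assms(1) assms(3)[OF Suc.prems] by (intro mult_right_mono_neg) (auto simp: decseq_Suc_iff)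
    finally show ?case .
  qed simp
  from this[of m] show ?thesis
    using mult_nonneg_nonpos[OF assms(2)[of m] assms(3)[of m]] by simp
qed

text \<open>The partial sums stay below \<open>(c - S m) / \<alpha> m\<close>. The last term is
  treated separately so that the final weight is \<open>\<alpha> (m - 1)\<close>, which later is
  exactly \<open>\<alpha> T\<close>.\<close>

lemma telescope_over_decseq:
  fixes \<alpha> S :: "nat \<Rightarrow> real"
  assumes \<alpha>: "decseq \<alpha>" "\<And>k. 0 < \<alpha> k" and S: "\<And>k. 0 \<le> S k" "\<And>k. S k \<le> c"
  shows "(\<Sum>k<m. 1 / \<alpha> k * (S k - S (Suc k))) \<le> c / \<alpha> (m - 1)"
proof -
  have le: "(\<Sum>k<m. 1 / \<alpha> k * (S k - S (Suc k))) \<le> (c - S m) / \<alpha> m" for m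
  proof (induction m)
    case 0
    have "0 \<le> (c - S 0) / \<alpha> 0" using S(2)[of 0] \<alpha>(2)[of 0] by (intro divide_nonneg_pos) auto
    then show ?case by simp
  next
    case (Suc m)
    have "(\<Sum>k<Suc m. 1 / \<alpha> k * (S k - S (Suc k))) \<le> (c - S m) / \<alpha> m + 1 / \<alpha> m * (S m - S (Suc m))"
      using Suc by simp
    also have "\<dots> = (c - S (Suc m)) / \<alpha> m" by (simp add: diff_divide_distrib)
    also have "\<dots> \<le> (c - S (Suc m)) / \<alpha> (Suc m)"
      using \<alpha> S by (intro divide_left_mono) (auto simp: decseq_Suc_iff)
    finally show ?case .
  qed
  show ?thesis
  proof (cases m)
    case 0
    have "0 \<le> c" using S[of 0] by linarith
    then show ?thesis using 0 \<alpha>(2)[of 0] by simp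
  next
    case (Suc n)
    have "(\<Sum>k<m. 1 / \<alpha> k * (S k - S (Suc k))) \<le> (c - S n) / \<alpha> n + 1 / \<alpha> n * (S n - S (Suc n))"
      using le[of n] Suc by simp
    also have "\<dots> = (c - S (Suc n)) / \<alpha> n" by (simp add: diff_divide_distrib)
    also have "\<dots> \<le> c / \<alpha> n" using \<alpha>(2)[of n] S by (intro divide_right_mono) (auto simp: less_imp_le)
    finally show ?thesis using Suc by simp
  qed
qed

text \<open>\<open>\<tau>\<close> is the largest time up to \<open>T\<close> at which the cumulative
  sum of \<open>b\<close> reaches \<open>G\<close> times the time; time 0 qualifies. A positive
  partial sum of \<open>b - G\<close> after \<open>\<tau>\<close> would produce a later such
  time.\<close>

lemma last_time_average_ge:
  fixes b :: "nat \<Rightarrow> real"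
  shows "\<exists>\<tau> m. T = \<tau> + m \<and> G * real \<tau> \<le> (\<Sum>t = 1..\<tau>. b t) \<and>
    (\<forall>n\<le>m. (\<Sum>k<n. b (Suc \<tau> + k) - G) \<le> 0)"
proof -
  define Q where "Q t \<longleftrightarrow> t \<le> T \<and> G * real t \<le> (\<Sum>t = 1..t. b t)" for t
  define \<tau> where "\<tau> = Greatest Q"
  have "Q 0" by (simp add: Q_def)
  have Q\<tau>: "Q \<tau>" unfolding \<tau>_def using \<open>Q 0\<close> by (rule GreatestI_nat[where b = T]) (simp add: Q_def)
  have max: "t \<le> \<tau>" if "Q t" for t
    unfolding \<tau>_def using that by (rule Greatest_le_nat[where b = T]) (simp add: Q_def)
  show ?thesis
  proof (intro exI conjI allI impI)
    show "T = \<tau> + (T - \<tau>)" "G * real \<tau> \<le> (\<Sum>t = 1..\<tau>. b t)" using Q\<tau> by (auto simp: Q_def)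
    fix n assume n: "n \<le> T - \<tau>"
    show "(\<Sum>k<n. b (Suc \<tau> + k) - G) \<le> 0"
    proof (cases "n = 0")
      case False
      then have "\<not> Q (\<tau> + n)" using max[of "\<tau> + n"] by auto
      then have "(\<Sum>t = 1..\<tau> + n. b t) < G * real (\<tau> + n)" using n Q\<tau> by (auto simp: Q_def)
      then show ?thesis using Q\<tau> unfolding sum_atLeast1_split
        by (simp add: Q_def sum_subtractf algebra_simps)
    qed simp
  qed
qed

text \<open>The constants are represented by the inequalities they supply. In
  \<open>f_diff_le\<close> only \<open>a\<close> is confined to \<open>X\<close>, so that
  \<open>b\<close> may be a query point.\<close>

locale dscmd = network P B \<theta> + mirror_map \<Phi> d\<Phi> \<sigma> L
  for P :: "nat \<Rightarrow> real^'v::finite^'v" and B \<theta> and \<Phi> :: "real^'n \<Rightarrow> real" and d\<Phi> \<sigma> L +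
  fixes X :: "(real^'n) set" and f chi :: "'v \<Rightarrow> real^'n \<Rightarrow> real" and xstar :: "real^'n"
    and \<alpha> r :: "nat \<Rightarrow> real" and Gf Gchi \<nu> DX DPhi N :: real
  assumes N: "N = real CARD('v)" and convex_X: "convex X" and xstar: "xstar \<in> X"
    and bregman_convex: "\<And>a (b :: 'v \<Rightarrow> real^'n) w. (\<forall>i. w i \<in> {0..1}) \<Longrightarrow> (\<Sum>i\<in>UNIV. w i) = 1 \<Longrightarrow>
           bregman \<Phi> d\<Phi> a (\<Sum>i\<in>UNIV. w i *\<^sub>R b i) \<le> (\<Sum>i\<in>UNIV. w i * bregman \<Phi> d\<Phi> a (b i))"
    and convex_chi: "\<And>i. convex_on UNIV (chi i)"
    and \<alpha>: "\<And>t. \<alpha> t > 0" "decseq \<alpha>" and r: "\<And>t. r t > 0"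
    and f_diff_le: "\<And>i a b. a \<in> X \<Longrightarrow> f i a - f i b \<le> Gf * norm (a - b)"
    and chi_diff_le: "\<And>i a b. a \<in> X \<Longrightarrow> chi i a - chi i b \<le> Gchi * norm (a - b)"
    and Gf: "0 \<le> Gf" and Gchi: "0 \<le> Gchi" and \<nu>: "0 \<le> \<nu>"
    and DX: "\<And>a b. a \<in> X \<Longrightarrow> b \<in> X \<Longrightarrow> norm (a - b) \<le> DX"
    and DPhi: "0 \<le> DPhi" "\<And>a b. a \<in> X \<Longrightarrow> b \<in> X \<Longrightarrow> bregman \<Phi> d\<Phi> a b \<le> DPhi\<^sup>2"
    and DX_le: "DX \<le> sqrt (2 / \<sigma>) * DPhi"
begin

abbreviation "G \<equiv> Gf + Gchi"
abbreviation "C2 \<equiv> N * DPhi\<^sup>2"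
abbreviation "C5 \<equiv> sqrt (2 / \<sigma>) * DPhi * L * N * sqrt \<nu>"
abbreviation "C6 \<equiv> N * L * \<nu>"

definition objective :: "real^'n \<Rightarrow> real" where "objective z = (\<Sum>i\<in>UNIV. f i z + chi i z)"

lemma L_nonneg: "0 \<le> L"
proof -
  have "axis undefined 1 \<noteq> (0::real^'n)" by (simp add: axis_eq_0_iff)
  then show ?thesis using L_pos by (metis less_imp_le)
qed

lemma DX_nonneg: "0 \<le> DX"
  using DX[OF xstar xstar] by simp

lemma DX_sq_le: "\<sigma> / 2 * DX\<^sup>2 \<le> DPhi\<^sup>2"
proof -
  have "DX\<^sup>2 \<le> (sqrt (2 / \<sigma>) * DPhi)\<^sup>2" using DX_le DX_nonneg by (intro power_mono)
  then show ?thesis using \<sigma>_pos by (simp add: power_mult_distrib field_simps)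
qed

lemma objective_diff_le: "a \<in> X \<Longrightarrow> objective a - objective xstar \<le> N * G * DX"
proof -
  assume a: "a \<in> X"
  have "objective a - objective xstar = (\<Sum>i\<in>UNIV. (f i a - f i xstar) + (chi i a - chi i xstar))"
    by (simp add: objective_def sum.distrib sum_subtractf)
  also have "\<dots> \<le> (\<Sum>i\<in>(UNIV::'v set). G * DX)"
  proof (rule sum_mono)
    fix i
    have "(f i a - f i xstar) + (chi i a - chi i xstar) \<le> Gf * norm (a - xstar) + Gchi * norm (a - xstar)"
      by (intro add_mono f_diff_le chi_diff_le a)
    also have "\<dots> \<le> G * DX"
      using Gf Gchi DX[OF a xstar] by (simp add: distrib_right[symmetric] mult_left_mono)
    finally show "(f i a - f i xstar) + (chi i a - chi i xstar) \<le> G * DX" .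
  qed
  finally show ?thesis by (simp add: mult.assoc N)
qed

end

text \<open>
  \<open>v\<close> stands for the stochastic subgradients and \<open>s\<close> for their conditional means.
\<close>

locale dscmd_run = dscmd +
  fixes x y :: "nat \<Rightarrow> 'a \<Rightarrow> real^'b" and \<xi> :: "nat \<Rightarrow> 'a \<Rightarrow> 'a \<Rightarrow> real^'b"
    and v s :: "nat \<Rightarrow> 'a \<Rightarrow> real^'b"
  assumes x_in_X: "\<And>t i. x t i \<in> X"
    and y: "\<And>t i. y t i = (\<Sum>j\<in>UNIV. P t $ i $ j *\<^sub>R (x t j + r t *\<^sub>R \<xi> t i j))"
    and x_Suc: "\<And>t i. is_arg_min (\<lambda>z. v t i \<bullet> z + 1 / \<alpha> t * bregman \<Phi> d\<Phi> z (y t i) + chi i z)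
             (\<lambda>z. z \<in> X) (x (Suc t) i)"
    and s: "\<And>t i. s t i \<in> subdifferential (f i) (y t i)"
    and norm_v: "\<And>t i. norm (v t i) \<le> Gf" and norm_s: "\<And>t i. norm (s t i) \<le> Gf"
    and norm_\<xi>: "\<And>t i j. norm (\<xi> t i j) \<le> sqrt \<nu>"
begin

definition ybar :: "nat \<Rightarrow> 'a \<Rightarrow> real^'b" where "ybar t = mix (P t) (x t)"
definition step_bound :: "nat \<Rightarrow> real" where "step_bound t = (\<alpha> t * G + L * (r t * sqrt \<nu>)) / \<sigma>"
definition potential :: "nat \<Rightarrow> real" where "potential t = (\<Sum>j\<in>UNIV. bregman \<Phi> d\<Phi> xstar (x t j))"
definition noise_term :: "nat \<Rightarrow> real" where "noise_term t = (\<Sum>i\<in>UNIV. (ybar t i - xstar) \<bullet> (s t i - v t i))"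

lemmas P_weights = weights[OF ds]

lemma ybar_in_X: "ybar t i \<in> X"
  unfolding ybar_def by (rule mix_in_convex[OF ds convex_X x_in_X])

lemma norm_y_ybar: "norm (y t i - ybar t i) \<le> r t * sqrt \<nu>"
proof -
  have "y t i - ybar t i = (\<Sum>j\<in>UNIV. P t $ i $ j *\<^sub>R (r t *\<^sub>R \<xi> t i j))"
    by (simp add: y ybar_def mix_def scaleR_add_right sum.distrib)
  also have "norm \<dots> \<le> (\<Sum>j\<in>UNIV. P t $ i $ j * (r t * sqrt \<nu>))"
    using r[of t] norm_\<xi> P_weights(1)
    by (intro sum_norm_le) (simp add: mult_left_mono mult.assoc)
  also have "\<dots> = r t * sqrt \<nu>" by (simp add: sum_distrib_right[symmetric] P_weights)
  finally show ?thesis .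
qed

text \<open>The proximal displacement is measured from \<open>ybar t i\<close>, which lies in
  \<open>X\<close> and differs from the query point only by noise.\<close>

lemma norm_step: "norm (x (Suc t) i - ybar t i) \<le> step_bound t"
proof -
  have "norm (x (Suc t) i - ybar t i) \<le> (\<alpha> t * G + L * norm (y t i - ybar t i)) / \<sigma>"
    by (rule prox_displacement[OF convex_X convex_chi \<alpha>(1) x_Suc ybar_in_X norm_v chi_diff_le Gchi])
       (rule ybar_in_X)
  also have "\<dots> \<le> step_bound t"
    unfolding step_bound_def using \<sigma>_pos L_nonneg norm_y_ybar by (intro divide_right_mono add_left_mono mult_left_mono) auto
  finally show ?thesis .
qed

text \<open>Convexity in the second argument moves the divergence inside the mixing, where the noise
  is split off each shifted state at cost \<open>c\<close>. The unit column sums recombine the rest,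
  and \<open>N * c\<close> produces the terms with \<open>C5\<close> and \<open>C6\<close>.\<close>

lemma bregman_mixing:
  "(\<Sum>i\<in>UNIV. bregman \<Phi> d\<Phi> xstar (y t i)) \<le> potential t + C5 * r t + C6 * (r t)\<^sup>2"
proof -
  define c where "c = L * (r t * sqrt \<nu>) * (sqrt (2 / \<sigma>) * DPhi) + L * ((r t)\<^sup>2 * \<nu>)"
  have "bregman \<Phi> d\<Phi> xstar (x t j + r t *\<^sub>R \<xi> t i j) \<le> bregman \<Phi> d\<Phi> xstar (x t j) + c" for i j
  proof -
    have n: "norm (r t *\<^sub>R \<xi> t i j) \<le> r t * sqrt \<nu>" using r[of t] norm_\<xi> by (simp add: mult_left_mono)
    have "norm (xstar - x t j) \<le> sqrt (2 / \<sigma>) * DPhi" using DX[OF xstar x_in_X] DX_le by (rule order_trans)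
    then have "L * norm (r t *\<^sub>R \<xi> t i j) * norm (xstar - x t j) \<le> L * (r t * sqrt \<nu>) * (sqrt (2 / \<sigma>) * DPhi)"
      using n L_nonneg r[of t] \<nu> by (intro mult_mono) auto
    moreover have "(norm (r t *\<^sub>R \<xi> t i j))\<^sup>2 \<le> (r t * sqrt \<nu>)\<^sup>2"
      using n by (intro power_mono) auto
    then have "L * (norm (r t *\<^sub>R \<xi> t i j))\<^sup>2 \<le> L * ((r t)\<^sup>2 * \<nu>)"
      using L_nonneg \<nu> by (intro mult_left_mono) (auto simp: power_mult_distrib)
    ultimately show ?thesis
      using bregman_perturb[of xstar "x t j + r t *\<^sub>R \<xi> t i j" "x t j"] by (simp add: c_def)
  qed
  then have "bregman \<Phi> d\<Phi> xstar (y t i) \<le> (\<Sum>j\<in>UNIV. P t $ i $ j * (bregman \<Phi> d\<Phi> xstar (x t j) + c))" for i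
  proof -
    have "P t $ i $ j \<le> 1" for j
      using member_le_sum[of j UNIV "\<lambda>j. P t $ i $ j"] P_weights by simp
    then have "bregman \<Phi> d\<Phi> xstar (y t i)
        \<le> (\<Sum>j\<in>UNIV. P t $ i $ j * bregman \<Phi> d\<Phi> xstar (x t j + r t *\<^sub>R \<xi> t i j))"
      unfolding y using P_weights by (intro bregman_convex) auto
    also have "\<dots> \<le> (\<Sum>j\<in>UNIV. P t $ i $ j * (bregman \<Phi> d\<Phi> xstar (x t j) + c))"
      using P_weights(1) \<open>\<And>i j. bregman \<Phi> d\<Phi> xstar (x t j + r t *\<^sub>R \<xi> t i j) \<le> _\<close>
      by (intro sum_mono mult_left_mono) auto
    finally show ?thesis .
  qed
  then have "(\<Sum>i\<in>UNIV. bregman \<Phi> d\<Phi> xstar (y t i))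
      \<le> (\<Sum>i\<in>UNIV. \<Sum>j\<in>UNIV. P t $ i $ j * (bregman \<Phi> d\<Phi> xstar (x t j) + c))"
    by (intro sum_mono)
  also have "\<dots> = (\<Sum>j\<in>UNIV. \<Sum>i\<in>UNIV. P t $ i $ j * (bregman \<Phi> d\<Phi> xstar (x t j) + c))" by (rule sum.swap)
  also have "\<dots> = potential t + N * c"
    by (simp add: sum_distrib_right[symmetric] P_weights sum.distrib potential_def N)
  also have "\<dots> = potential t + C5 * r t + C6 * (r t)\<^sup>2"
    by (simp add: c_def algebra_simps)
  finally show ?thesis .
qed

lemma descent:
  "(\<Sum>i\<in>UNIV. f i (y t i) + chi i (x (Suc t) i)) - objective xstar
    \<le> 1 / \<alpha> t * (potential t - potential (Suc t)) + N * Gf\<^sup>2 / (2 * \<sigma>) * \<alpha> t + C5 * (r t / \<alpha> t) + C6 * ((r t)\<^sup>2 / \<alpha> t)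
       + noise_term t + 2 * N * Gf * sqrt \<nu> * r t"
proof -
  have "(f i (y t i) - f i xstar) + (chi i (x (Suc t) i) - chi i xstar)
      \<le> 1 / \<alpha> t * (bregman \<Phi> d\<Phi> xstar (y t i) - bregman \<Phi> d\<Phi> xstar (x (Suc t) i)) + Gf\<^sup>2 / (2 * \<sigma>) * \<alpha> t
        + (ybar t i - xstar) \<bullet> (s t i - v t i) + 2 * Gf * sqrt \<nu> * r t" for i
  proof -
    have "f i (y t i) - f i xstar \<le> s t i \<bullet> (y t i - xstar)"
      using s[of t i] by (auto simp: subdifferential_def inner_diff_right dest!: spec[of _ xstar])
    \<comment> \<open>The first part feeds the proximal descent, the second is a summand of the
      martingale increment, centred at a point of \<open>X\<close>, and the third is of the order of
      the noise.\<close>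
    also have "\<dots> = v t i \<bullet> (y t i - xstar) + (ybar t i - xstar) \<bullet> (s t i - v t i) + (s t i - v t i) \<bullet> (y t i - ybar t i)"
      by (simp add: inner_diff_left inner_diff_right inner_commute)
    also have "(s t i - v t i) \<bullet> (y t i - ybar t i) \<le> 2 * Gf * (r t * sqrt \<nu>)"
    proof -
      have "(s t i - v t i) \<bullet> (y t i - ybar t i) \<le> norm (s t i - v t i) * norm (y t i - ybar t i)"
        by (rule norm_cauchy_schwarz)
      also have "\<dots> \<le> 2 * Gf * (r t * sqrt \<nu>)"
        using norm_triangle_ineq4[of "s t i" "v t i"] norm_s[of t i] norm_v[of t i] Gf
        by (intro mult_mono norm_y_ybar) auto
      finally show ?thesis .
    qed
    finally show ?thesis
      using prox_descent[OF convex_X convex_chi \<alpha>(1) x_Suc xstar norm_v, of t i] by (simp add: algebra_simps)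
  qed
  then have "(\<Sum>i\<in>UNIV. (f i (y t i) - f i xstar) + (chi i (x (Suc t) i) - chi i xstar))
    \<le> (\<Sum>i\<in>UNIV. 1 / \<alpha> t * (bregman \<Phi> d\<Phi> xstar (y t i) - bregman \<Phi> d\<Phi> xstar (x (Suc t) i)) + Gf\<^sup>2 / (2 * \<sigma>) * \<alpha> t
        + (ybar t i - xstar) \<bullet> (s t i - v t i) + 2 * Gf * sqrt \<nu> * r t)"
    by (intro sum_mono)
  also have "\<dots> = 1 / \<alpha> t * ((\<Sum>i\<in>UNIV. bregman \<Phi> d\<Phi> xstar (y t i)) - potential (Suc t)) + N * (Gf\<^sup>2 / (2 * \<sigma>) * \<alpha> t)
        + noise_term t + N * (2 * Gf * sqrt \<nu> * r t)"
    by (simp add: sum.distrib sum_distrib_left[symmetric] sum_subtractf potential_def noise_term_def N sum_divide_distrib[symmetric])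
  also have "\<dots> \<le> 1 / \<alpha> t * ((potential t + C5 * r t + C6 * (r t)\<^sup>2) - potential (Suc t)) + N * (Gf\<^sup>2 / (2 * \<sigma>) * \<alpha> t)
        + noise_term t + N * (2 * Gf * sqrt \<nu> * r t)"
    using \<alpha>(1)[of t] bregman_mixing[of t] by (intro add_mono mult_left_mono diff_mono order_refl) auto
  also have "\<dots> = 1 / \<alpha> t * (potential t - potential (Suc t)) + N * Gf\<^sup>2 / (2 * \<sigma>) * \<alpha> t + C5 * (r t / \<alpha> t) + C6 * ((r t)\<^sup>2 / \<alpha> t)
       + noise_term t + 2 * N * Gf * sqrt \<nu> * r t"
    by (simp add: add_divide_distrib diff_divide_distrib)
  finally show ?thesis by (simp add: objective_def sum.distrib sum_subtractf)
qed

text \<open>Both comparisons pass through \<open>ybar t i\<close>: the query point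
  \<open>y t i\<close> lies within the noise of it and \<open>x (Suc t) i\<close> within
  \<open>step_bound t\<close>. The difference bounds are taken at \<open>x t l\<close>, a point of
  \<open>X\<close>.\<close>

lemma network_error:
  "objective (x t l) - (\<Sum>i\<in>UNIV. f i (y t i) + chi i (x (Suc t) i))
    \<le> G * N * dev (x t) + N * Gf * sqrt \<nu> * r t + N * Gchi * step_bound t"
proof -
  have "(f i (x t l) - f i (y t i)) + (chi i (x t l) - chi i (x (Suc t) i))
      \<le> G * norm (ybar t i - x t l) + Gf * (r t * sqrt \<nu>) + Gchi * step_bound t" for i
  proof -
    have "norm (x t l - y t i) \<le> norm (ybar t i - x t l) + r t * sqrt \<nu>"
      using norm_y_ybar[of t i] dist_triangle[of "x t l" "y t i" "ybar t i"]
      by (simp add: dist_norm norm_minus_commute)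
    moreover have "norm (x t l - x (Suc t) i) \<le> norm (ybar t i - x t l) + step_bound t"
      using norm_step[of t i] dist_triangle[of "x t l" "x (Suc t) i" "ybar t i"]
      by (simp add: dist_norm norm_minus_commute)
    ultimately have "Gf * norm (x t l - y t i) + Gchi * norm (x t l - x (Suc t) i)
        \<le> Gf * (norm (ybar t i - x t l) + r t * sqrt \<nu>) + Gchi * (norm (ybar t i - x t l) + step_bound t)"
      using Gf Gchi by (intro add_mono mult_left_mono) auto
    then show ?thesis
      using f_diff_le[OF x_in_X, of i t l "y t i"] chi_diff_le[OF x_in_X, of i t l "x (Suc t) i"]
      by (simp add: algebra_simps)
  qed
  then have "(\<Sum>i\<in>UNIV. (f i (x t l) - f i (y t i)) + (chi i (x t l) - chi i (x (Suc t) i)))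
      \<le> (\<Sum>i\<in>UNIV. G * norm (ybar t i - x t l) + Gf * (r t * sqrt \<nu>) + Gchi * step_bound t)"
    by (intro sum_mono)
  also have "\<dots> = G * (\<Sum>i\<in>UNIV. norm (ybar t i - x t l)) + N * (Gf * (r t * sqrt \<nu>)) + N * (Gchi * step_bound t)"
    by (simp add: sum.distrib sum_distrib_left[symmetric] N)
  also have "\<dots> \<le> G * (N * dev (x t)) + N * (Gf * (r t * sqrt \<nu>)) + N * (Gchi * step_bound t)"
    unfolding ybar_def using Gf Gchi sum_norm_diff_mix_le[OF ds, folded N]
    by (intro add_right_mono mult_left_mono) auto
  finally show ?thesis by (simp add: objective_def sum.distrib sum_subtractf algebra_simps)
qed

text \<open>Each iteration is read as exact mixing followed by the perturbation
  \<open>\<epsilon>\<close>, and the disagreement at the starting time is bounded through the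
  diameter.\<close>

lemma sum_dev_le:
  assumes "a \<ge> 1"
  shows "(\<Sum>k<m. dev (x (a + k))) \<le> mixing_time * sqrt N * (DX + (\<Sum>k<m. step_bound (a + k)))"
proof -
  define \<epsilon> where "\<epsilon> t i = x (Suc t) i - ybar t i" for t i
  have "(\<Sum>k<m. dev (x (a + k))) \<le> mixing_time * (dev (x a) + (\<Sum>k<m. dev (\<epsilon> (a + k))))"
    using assms by (intro sum_dev_perturbed_le) (auto simp: \<epsilon>_def ybar_def)
  also have "\<dots> \<le> mixing_time * (sqrt N * DX + (\<Sum>k<m. sqrt N * step_bound (a + k)))"
  proof (intro mult_left_mono add_mono sum_mono)
    show "dev (x a) \<le> sqrt N * DX" unfolding N by (rule dev_le[of _ xstar]) (rule DX[OF x_in_X xstar])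
    show "dev (\<epsilon> (a + k)) \<le> sqrt N * step_bound (a + k)" for k
      unfolding N by (rule dev_le[of _ 0]) (simp add: \<epsilon>_def norm_step[simplified])
  qed (use mixing_time_pos in simp)
  also have "\<dots> = mixing_time * sqrt N * (DX + (\<Sum>k<m. step_bound (a + k)))"
    by (simp add: sum_distrib_left[symmetric] algebra_simps)
  finally show ?thesis .
qed

lemma total_loss_le:
  assumes T: "T = \<tau> + m" "1 \<le> T"
    and early: "G * real \<tau> \<le> (\<Sum>t = 1..\<tau>. L * sqrt \<nu> * r t / \<alpha> t)"
    and late: "\<And>n. n \<le> m \<Longrightarrow> (\<Sum>k<n. L * sqrt \<nu> * r (Suc \<tau> + k) / \<alpha> (Suc \<tau> + k) - G) \<le> 0"
    and noise_term: "(\<Sum>k<m. noise_term (Suc \<tau> + k)) \<le> E" and E: "0 \<le> E"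
  shows "(\<Sum>t = 1..T. objective (x t l) - objective xstar) \<le> C2 / \<alpha> T
     + (4 * mixing_time * N * sqrt N * G\<^sup>2 / \<sigma> + 2 * N * Gchi * G / \<sigma> + N * Gf\<^sup>2 / (2 * \<sigma>)) * (\<Sum>t = 1..T. \<alpha> t)
     + 3 * N * Gf * sqrt \<nu> * (\<Sum>t = 1..T. r t)
     + C5 * (\<Sum>t = 1..T. r t / \<alpha> t) + C6 * (\<Sum>t = 1..T. (r t)\<^sup>2 / \<alpha> t) + E"
    (is "?lhs \<le> C2 / \<alpha> T + ?c3 * _ + _ + _ + _ + E")
proof -
  note nonneg = Gf Gchi \<nu> L_nonneg DX_nonneg DPhi(1) \<sigma>_pos mixing_time_pos
  have N_pos: "N > 0" by (simp add: N)
  have pos: "0 \<le> \<alpha> t" "0 \<le> r t" "0 \<le> r t / \<alpha> t" "0 \<le> (r t)\<^sup>2 / \<alpha> t" for t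
    using \<alpha>(1)[of t] r[of t] by auto
  have sums: "0 \<le> (\<Sum>t\<in>I. \<alpha> t)" "0 \<le> (\<Sum>t\<in>I. r t)" "0 \<le> (\<Sum>t\<in>I. r t / \<alpha> t)" "0 \<le> (\<Sum>t\<in>I. (r t)\<^sup>2 / \<alpha> t)" for I
    using pos by (auto intro: sum_nonneg)
  have c: "0 \<le> ?c3" "0 \<le> 3 * N * Gf * sqrt \<nu>" "0 \<le> C5" "0 \<le> C6" "0 \<le> C2"
    using nonneg N_pos by (auto intro!: add_nonneg_nonneg divide_nonneg_pos mult_nonneg_nonneg)
  have trivial: "(\<Sum>t\<in>I. objective (x t l) - objective xstar) \<le> real (card I) * (N * G * DX)" for I
    by (rule sum_bounded_above) (rule objective_diff_le[OF x_in_X])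
  show ?thesis
  \<comment> \<open>If the crude bound is covered by \<open>C2 / \<alpha> T\<close>, the other terms
    only have to be nonnegative. Otherwise \<open>DX\<close> is small compared with the
    stepsizes.\<close>
  proof (cases "real T * (N * G * DX) \<le> C2 / \<alpha> T")
    case True
    have "?lhs \<le> real T * (N * G * DX)" using trivial[of "{1..T}"] by simp
    also have "\<dots> \<le> C2 / \<alpha> T" by fact
    finally show ?thesis
      using mult_nonneg_nonneg[OF c(1) sums(1)[of "{1..T}"]] mult_nonneg_nonneg[OF c(2) sums(2)[of "{1..T}"]]
        mult_nonneg_nonneg[OF c(3) sums(3)[of "{1..T}"]] mult_nonneg_nonneg[OF c(4) sums(4)[of "{1..T}"]] E
      by linarith
  next
    case False
    define A where "A = (\<Sum>t = 1..T. \<alpha> t)"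
    \<comment> \<open>Since \<open>C2\<close> is at least
      \<open>N * (\<sigma> / 2 * DX\<^sup>2)\<close>, the failure of the crude bound is an
      inequality in which a factor \<open>N * DX\<close> cancels; \<open>real T * \<alpha> T\<close>
      is at most the sum of the non-increasing stepsizes.\<close>
    have DX_A: "DX \<le> 2 * G / \<sigma> * A"
    proof -
      have "N * (\<sigma> / 2 * DX\<^sup>2) \<le> C2" using N_pos by (intro mult_left_mono DX_sq_le) auto
      also have "\<dots> < real T * (N * G * DX) * \<alpha> T"
        using False \<alpha>(1)[of T] by (simp add: not_le pos_divide_less_eq)
      finally have *: "N * DX * (\<sigma> / 2 * DX) < N * DX * (G * (real T * \<alpha> T))"
        by (simp add: power2_eq_square algebra_simps)
      have "N * DX \<ge> 0" using N_pos DX_nonneg by simp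
      with * have "\<sigma> / 2 * DX < G * (real T * \<alpha> T)"
        by (metis mult_left_mono not_less)
      moreover have "real T * \<alpha> T \<le> A"
        unfolding A_def using sum_bounded_below[of "{1..T}" "\<alpha> T" \<alpha>] \<alpha>(2) by (simp add: decseq_def)
      then have "G * (real T * \<alpha> T) \<le> G * A" using nonneg by (intro mult_left_mono) auto
      ultimately have "\<sigma> / 2 * DX \<le> G * A" by linarith
      then show ?thesis using \<sigma>_pos by (simp add: field_simps)
    qed
    let ?a = "\<lambda>k. Suc \<tau> + k"
    define A' where "A' = (\<Sum>k<m. \<alpha> (?a k))"
    define R' where "R' = (\<Sum>k<m. r (?a k))"
    have "A' \<le> A" "R' \<le> (\<Sum>t = 1..T. r t)"
      unfolding A'_def A_def R'_def T(1) sum_atLeast1_split using sums by simp_all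
    \<comment> \<open>Up to \<open>\<tau>\<close> the inequality \<open>early\<close> lets part of
      the \<open>C5\<close> sum pay for the crude bound, so the proximal analysis starts only at
      \<open>Suc \<tau>\<close>.\<close>
    have first: "(\<Sum>t = 1..\<tau>. objective (x t l) - objective xstar) \<le> C5 * (\<Sum>t = 1..\<tau>. r t / \<alpha> t)"
    proof -
      have "(\<Sum>t = 1..\<tau>. objective (x t l) - objective xstar) \<le> N * DX * (G * real \<tau>)"
        using trivial[of "{1..\<tau>}"] by (simp add: algebra_simps)
      also have "\<dots> \<le> N * DX * (\<Sum>t = 1..\<tau>. L * sqrt \<nu> * r t / \<alpha> t)"
        using N_pos DX_nonneg by (intro mult_left_mono early) auto
      also have "\<dots> \<le> N * (sqrt (2 / \<sigma>) * DPhi) * (\<Sum>t = 1..\<tau>. L * sqrt \<nu> * r t / \<alpha> t)"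
        using N_pos DX_le L_nonneg \<nu> pos by (intro mult_right_mono mult_left_mono sum_nonneg) auto
      also have "\<dots> = C5 * (\<Sum>t = 1..\<tau>. r t / \<alpha> t)"
        by (simp add: sum_distrib_left algebra_simps)
      finally show ?thesis .
    qed
    \<comment> \<open>Abel summation with weights \<open>\<alpha>\<close>: multiplying the
      nonpositive partial sums in \<open>late\<close> by the stepsizes restores exactly the terms of
      \<open>R'\<close> and \<open>A'\<close>.\<close>
    have noise: "L * sqrt \<nu> * R' \<le> G * A'"
    proof -
      have "(\<Sum>k<m. \<alpha> (?a k) * (L * sqrt \<nu> * r (?a k) / \<alpha> (?a k) - G)) \<le> 0"
        using \<alpha>(2) pos(1) late by (intro decseq_weighted_sum_nonpos) (auto simp: decseq_def)
      also have "(\<Sum>k<m. \<alpha> (?a k) * (L * sqrt \<nu> * r (?a k) / \<alpha> (?a k) - G)) = L * sqrt \<nu> * R' - G * A'"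
        unfolding R'_def A'_def sum_distrib_left sum_subtractf[symmetric]
        using \<alpha>(1) by (intro sum.cong) (auto simp: field_simps less_imp_neq[symmetric])
      finally show ?thesis by simp
    qed
    have step_bound: "(\<Sum>k<m. step_bound (?a k)) \<le> 2 * G / \<sigma> * A'"
    proof -
      have "(\<Sum>k<m. step_bound (?a k)) = (G * A' + L * sqrt \<nu> * R') / \<sigma>"
        by (simp add: step_bound_def A'_def R'_def sum_divide_distrib[symmetric] sum.distrib sum_distrib_left algebra_simps)
      also have "\<dots> \<le> (2 * G * A') / \<sigma>" using noise \<sigma>_pos by (intro divide_right_mono) (simp_all add: algebra_simps)
      finally show ?thesis by simp
    qed
    \<comment> \<open>Two equal shares \<open>2 * G / \<sigma> * A\<close> come from the
      disagreement at time \<open>Suc \<tau>\<close>, through \<open>DX\<close>, and from the later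
      steps; hence the factor 4.\<close>
    have dev: "(\<Sum>k<m. dev (x (?a k))) \<le> 4 * mixing_time * sqrt N * G / \<sigma> * A"
    proof -
      have "(\<Sum>k<m. dev (x (?a k))) \<le> mixing_time * sqrt N * (DX + (\<Sum>k<m. step_bound (?a k)))"
        by (rule sum_dev_le) simp
      also have "\<dots> \<le> mixing_time * sqrt N * (2 * G / \<sigma> * A + 2 * G / \<sigma> * A)"
        using nonneg N_pos DX_A step_bound mult_left_mono[OF \<open>A' \<le> A\<close>, of "2 * G / \<sigma>"]
        by (intro mult_left_mono add_mono) (auto intro: order_trans)
      finally show ?thesis by (simp add: algebra_simps)
    qed
    have telescope: "(\<Sum>k<m. 1 / \<alpha> (?a k) * (potential (?a k) - potential (Suc (?a k)))) \<le> C2 / \<alpha> T"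
    proof -
      have "0 \<le> potential t" for t unfolding potential_def by (intro sum_nonneg bregman_nonneg)
      moreover have "potential t \<le> C2" for t
        unfolding potential_def N using sum_bounded_above[of UNIV "\<lambda>j. bregman \<Phi> d\<Phi> xstar (x t j)" "DPhi\<^sup>2"] DPhi(2)[OF xstar x_in_X]
        by simp
      ultimately have *: "(\<Sum>k<m. 1 / \<alpha> (?a k) * (potential (?a k) - potential (?a (Suc k)))) \<le> C2 / \<alpha> (?a (m - 1))"
        using \<alpha> by (intro telescope_over_decseq) (auto simp: decseq_def)
      show ?thesis
      proof (cases m)
        case 0
        then show ?thesis using c(5) pos(1)[of T] by simp
      next
        case (Suc m')
        then show ?thesis using * T(1) by simp
      qed
    qed
    \<comment> \<open>The noise coefficient 3 is 2 from \<open>descent\<close> plus 1 from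
      \<open>network_error\<close>.\<close>
    have "objective (x (?a k) l) - objective xstar \<le> 1 / \<alpha> (?a k) * (potential (?a k) - potential (Suc (?a k)))
        + N * Gf\<^sup>2 / (2 * \<sigma>) * \<alpha> (?a k) + C5 * (r (?a k) / \<alpha> (?a k)) + C6 * ((r (?a k))\<^sup>2 / \<alpha> (?a k))
        + noise_term (?a k) + 3 * N * Gf * sqrt \<nu> * r (?a k) + G * N * dev (x (?a k)) + N * Gchi * step_bound (?a k)" for k
      using descent[of "?a k"] network_error[of "?a k" l] by linarith
    then have "(\<Sum>k<m. objective (x (?a k) l) - objective xstar) \<le> (\<Sum>k<m. 1 / \<alpha> (?a k) * (potential (?a k) - potential (Suc (?a k)))
        + N * Gf\<^sup>2 / (2 * \<sigma>) * \<alpha> (?a k) + C5 * (r (?a k) / \<alpha> (?a k)) + C6 * ((r (?a k))\<^sup>2 / \<alpha> (?a k))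
        + noise_term (?a k) + 3 * N * Gf * sqrt \<nu> * r (?a k) + G * N * dev (x (?a k)) + N * Gchi * step_bound (?a k))"
      by (intro sum_mono)
    also have "\<dots> = (\<Sum>k<m. 1 / \<alpha> (?a k) * (potential (?a k) - potential (Suc (?a k))))
        + N * Gf\<^sup>2 / (2 * \<sigma>) * A' + C5 * (\<Sum>k<m. r (?a k) / \<alpha> (?a k)) + C6 * (\<Sum>k<m. (r (?a k))\<^sup>2 / \<alpha> (?a k))
        + (\<Sum>k<m. noise_term (?a k)) + 3 * N * Gf * sqrt \<nu> * R' + G * N * (\<Sum>k<m. dev (x (?a k))) + N * Gchi * (\<Sum>k<m. step_bound (?a k))"
      by (simp only: sum.distrib sum_distrib_left A'_def R'_def)
    also have "\<dots> \<le> C2 / \<alpha> T + N * Gf\<^sup>2 / (2 * \<sigma>) * A + C5 * (\<Sum>k<m. r (?a k) / \<alpha> (?a k))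
        + C6 * (\<Sum>t = 1..T. (r t)\<^sup>2 / \<alpha> t)
        + E + 3 * N * Gf * sqrt \<nu> * (\<Sum>t = 1..T. r t) + G * N * (4 * mixing_time * sqrt N * G / \<sigma> * A)
        + N * Gchi * (2 * G / \<sigma> * A)"
    proof (intro add_mono mult_left_mono telescope noise_term dev order_refl \<open>A' \<le> A\<close> \<open>R' \<le> _\<close> c)
      show "(\<Sum>k<m. (r (?a k))\<^sup>2 / \<alpha> (?a k)) \<le> (\<Sum>t = 1..T. (r t)\<^sup>2 / \<alpha> t)"
        unfolding T(1) sum_atLeast1_split using sums by simp
      have "2 * G / \<sigma> * A' \<le> 2 * G / \<sigma> * A"
        using nonneg \<open>A' \<le> A\<close> by (intro mult_left_mono) auto
      then show "(\<Sum>k<m. step_bound (?a k)) \<le> 2 * G / \<sigma> * A" using step_bound by linarith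
    qed (use nonneg N_pos in auto)
    finally have second: "(\<Sum>k<m. objective (x (?a k) l) - objective xstar) \<le> \<dots>" .
    have "?lhs = (\<Sum>t = 1..\<tau>. objective (x t l) - objective xstar) + (\<Sum>k<m. objective (x (?a k) l) - objective xstar)"
      unfolding T(1) by (rule sum_atLeast1_split)
    moreover have "(\<Sum>t = 1..T. r t / \<alpha> t) = (\<Sum>t = 1..\<tau>. r t / \<alpha> t) + (\<Sum>k<m. r (?a k) / \<alpha> (?a k))"
      unfolding T(1) by (rule sum_atLeast1_split)
    moreover have "?c3 * A = N * Gf\<^sup>2 / (2 * \<sigma>) * A + G * N * (4 * mixing_time * sqrt N * G / \<sigma> * A) + N * Gchi * (2 * G / \<sigma> * A)"
      by (simp add: power2_eq_square algebra_simps)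
    ultimately show ?thesis
      using first second unfolding A_def[symmetric] by (simp only: distrib_left)
  qed
qed

end

section \<open>The random trajectory\<close>

context mirror_map begin

lemma prox_exists:
  assumes "compact X" "X \<noteq> {}" "continuous_on X h" "continuous_on X \<Phi>"
  obtains p where "is_arg_min (\<lambda>z. v \<bullet> z + 1 / \<alpha> * D z y + h z) (\<lambda>z. z \<in> X) p"
proof -
  have "continuous_on X (\<lambda>z. v \<bullet> z + 1 / \<alpha> * D z y + h z)"
    unfolding bregman_def by (intro continuous_intros assms)
  from continuous_attains_inf[OF assms(1,2) this] obtain p where "p \<in> X"
    "\<forall>z\<in>X. v \<bullet> p + 1 / \<alpha> * D p y + h p \<le> v \<bullet> z + 1 / \<alpha> * D z y + h z" by blast
  then show thesis by (intro that[of p]) (auto simp: is_arg_min_linorder)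
qed

end

text \<open>An arbitrarily chosen minimiser \<open>H v y\<close> is a Lipschitz function of the
  pair, hence Borel. By uniqueness the given \<open>x\<close> coincides with it.\<close>

lemma prox_measurable:
  fixes X :: "'a::euclidean_space set"
  assumes mm: "mirror_map \<Phi> d\<Phi> \<sigma> L" and "0 \<le> L"
    and X: "compact X" "X \<noteq> {}" "convex X" and h: "convex_on UNIV h" and \<Phi>: "continuous_on UNIV \<Phi>"
    and "\<alpha> > 0" and v: "v \<in> borel_measurable M" and y: "y \<in> borel_measurable M"
    and x: "\<And>\<omega>. \<omega> \<in> space M \<Longrightarrow>
      is_arg_min (\<lambda>z. v \<omega> \<bullet> z + 1 / \<alpha> * bregman \<Phi> d\<Phi> z (y \<omega>) + h z) (\<lambda>z. z \<in> X) (x \<omega>)"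
  shows "x \<in> borel_measurable M"
proof -
  interpret mirror_map \<Phi> d\<Phi> \<sigma> L by (rule mm)
  define H where "H v y = (SOME p. is_arg_min (\<lambda>z. v \<bullet> z + 1 / \<alpha> * D z y + h z) (\<lambda>z. z \<in> X) p)" for v y
  have H: "is_arg_min (\<lambda>z. v \<bullet> z + 1 / \<alpha> * D z y + h z) (\<lambda>z. z \<in> X) (H v y)" for v y
  proof -
    have "continuous_on X h" "continuous_on X \<Phi>"
      using convex_on_continuous[OF open_UNIV h] \<Phi> by (auto intro: continuous_on_subset)
    then obtain p where "is_arg_min (\<lambda>z. v \<bullet> z + 1 / \<alpha> * D z y + h z) (\<lambda>z. z \<in> X) p"
      using prox_exists[OF X(1,2)] by blast
    then show ?thesis unfolding H_def by (rule someI)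
  qed
  have "((\<alpha> + L) / \<sigma>)-lipschitz_on UNIV (\<lambda>w. H (fst w) (snd w))"
  proof (rule lipschitz_onI)
    fix w w' :: "'a \<times> 'a"
    have "dist (H (fst w) (snd w)) (H (fst w') (snd w'))
        \<le> (\<alpha> * dist (fst w) (fst w') + L * dist (snd w) (snd w')) / \<sigma>"
      unfolding dist_norm by (rule prox_lipschitz[OF X(3) h \<open>\<alpha> > 0\<close> H H])
    also have "\<dots> \<le> (\<alpha> * dist w w' + L * dist w w') / \<sigma>"
      using \<open>\<alpha> > 0\<close> \<open>0 \<le> L\<close> \<sigma>_pos
      by (intro divide_right_mono add_mono mult_left_mono dist_fst_le dist_snd_le) auto
    finally show "dist (H (fst w) (snd w)) (H (fst w') (snd w')) \<le> (\<alpha> + L) / \<sigma> * dist w w'"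
      by (simp add: algebra_simps)
  qed (use \<open>\<alpha> > 0\<close> \<open>0 \<le> L\<close> \<sigma>_pos in simp)
  then have "(\<lambda>\<omega>. H (v \<omega>) (y \<omega>)) \<in> borel_measurable M"
    by (rule borel_measurable_continuous_Pair[OF v y, OF lipschitz_on_continuous_on])
  moreover have "x \<omega> = H (v \<omega>) (y \<omega>)" if "\<omega> \<in> space M" for \<omega>
    using prox_lipschitz[OF X(3) h \<open>\<alpha> > 0\<close> x[OF that] H[of "v \<omega>" "y \<omega>"]] by simp
  ultimately show ?thesis by (simp cong: measurable_cong)
qed

section \<open>Sigma-algebras of the history\<close>

context
  fixes M :: "'w measure" and F :: "nat \<Rightarrow> 'w measure" and \<xi> :: "nat \<Rightarrow> 'v \<Rightarrow> 'v \<Rightarrow> 'w \<Rightarrow> real^'n"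
  assumes filtration: "filtration (space M) F" and sub: "\<And>t. subalgebra M (F t)"
    and \<xi>: "\<And>t i j. \<xi> t i j \<in> borel_measurable (F t)"
begin

lemma subalgebra_history_mono: "s \<le> t \<Longrightarrow> subalgebra (F t) (F s)"
  using filtration unfolding filtration_def subalgebra_def by simp

lemma subalgebra_past: "subalgebra (F t) (past M F t)"
proof (cases t)
  case 0
  then show ?thesis
    using filtration sets.top[of "F 0"] unfolding filtration_def
    by (auto simp: subalgebra_def past_def sigma_sets_empty_eq)
next
  case (Suc s)
  then show ?thesis using subalgebra_history_mono[of s t] by (simp add: past_def)
qed

lemma subalgebra_past_history: "s < t \<Longrightarrow> subalgebra (past M F t) (F s)"
  by (cases t) (auto simp: past_def intro: subalgebra_history_mono)

lemma space_history: "space (F t) = space M"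
  using filtration by (simp add: filtration_def)

lemma past_and_noise_generator_closed:
  "sets (past M F t) \<union> {\<xi> t i j -` A \<inter> space M | i j A. A \<in> sets borel} \<subseteq> Pow (space M)"
  using subalgebra_past[of t] sets.space_closed[of "past M F t"] space_history by (auto simp: subalgebra_def)

lemma space_past_and_noise: "space (past_and_noise M F \<xi> t) = space M"
  unfolding past_and_noise_def by (rule space_measure_of[OF past_and_noise_generator_closed])

lemma sets_past_and_noise:
  "sets (past_and_noise M F \<xi> t) =
    sigma_sets (space M) (sets (past M F t) \<union> {\<xi> t i j -` A \<inter> space M | i j A. A \<in> sets borel})"
  unfolding past_and_noise_def by (rule sets_measure_of[OF past_and_noise_generator_closed])

lemma subalgebra_past_and_noise_past: "subalgebra (past_and_noise M F \<xi> t) (past M F t)"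
  using subalgebra_past[of t] space_history
  by (auto simp: subalgebra_def sets_past_and_noise space_past_and_noise)

lemma subalgebra_history_past_and_noise: "subalgebra (F t) (past_and_noise M F \<xi> t)"
proof -
  have "sigma_sets (space M) (sets (past M F t) \<union> {\<xi> t i j -` A \<inter> space M | i j A. A \<in> sets borel}) \<subseteq> sets (F t)"
    using subalgebra_past[of t] measurable_sets[OF \<xi>, of _ t] sets.sigma_sets_subset[of _ "F t"]
    by (intro sets.sigma_sets_subset[of _ "F t", unfolded space_history]) (auto simp: subalgebra_def space_history)
  then show ?thesis by (simp add: subalgebra_def sets_past_and_noise space_past_and_noise space_history)
qed

lemma subalgebra_past_and_noise: "subalgebra M (past_and_noise M F \<xi> t)"
  using sub[of t] subalgebra_history_past_and_noise[of t] unfolding subalgebra_def by (metis order_trans)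

end

text \<open>The iteration holds at every point of the space, which makes the iterates measurable;
  the bounds and conditional means hold almost surely.\<close>

locale dscmd_process = dscmd P B \<theta> \<Phi> d\<Phi> \<sigma> L X f chi xstar \<alpha> r Gf Gchi \<nu> DX DPhi N + prob_space M
  for P :: "nat \<Rightarrow> real^'v::finite^'v" and B \<theta> and \<Phi> :: "real^'n \<Rightarrow> real" and d\<Phi> \<sigma> L
    and X f chi xstar \<alpha> r Gf Gchi \<nu> DX DPhi N and M :: "'w measure" +
  fixes Hist :: "nat \<Rightarrow> 'w measure" and \<xi> :: "nat \<Rightarrow> 'v \<Rightarrow> 'v \<Rightarrow> 'w \<Rightarrow> real^'n"
    and v s x y :: "nat \<Rightarrow> 'v \<Rightarrow> 'w \<Rightarrow> real^'n" and x0 :: "'v \<Rightarrow> real^'n"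
  assumes compact_X: "compact X" and continuous_\<Phi>: "continuous_on UNIV \<Phi>"
    and filtration_Hist: "filtration (space M) Hist" and sub_Hist: "\<And>t. subalgebra M (Hist t)"
    and \<xi>_measurable: "\<And>t i j. \<xi> t i j \<in> borel_measurable (Hist t)"
    and v_measurable: "\<And>t i. v t i \<in> borel_measurable (Hist t)"
    and x0: "\<And>i. x0 i \<in> X" and x_0: "\<And>i \<omega>. \<omega> \<in> space M \<Longrightarrow> x 0 i \<omega> = x0 i"
    and y_eq: "\<And>t i \<omega>. \<omega> \<in> space M \<Longrightarrow> y t i \<omega> = (\<Sum>j\<in>UNIV. P t $ i $ j *\<^sub>R (x t j \<omega> + r t *\<^sub>R \<xi> t i j \<omega>))"
    and x_Suc: "\<And>t i \<omega>. \<omega> \<in> space M \<Longrightarrow>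
           is_arg_min (\<lambda>z. v t i \<omega> \<bullet> z + 1 / \<alpha> t * bregman \<Phi> d\<Phi> z (y t i \<omega>) + chi i z)
             (\<lambda>z. z \<in> X) (x (Suc t) i \<omega>)"
    and AE_s: "\<And>t i. AE \<omega> in M. s t i \<omega> \<in> subdifferential (f i) (y t i \<omega>)"
    and AE_cond_exp: "\<And>t i. AE \<omega> in M. vec_cond_exp M (past_and_noise M Hist \<xi> t) (v t i) \<omega> = s t i \<omega>"
    and AE_v: "\<And>t i. AE \<omega> in M. norm (v t i \<omega>) \<le> Gf"
    and AE_\<xi>: "\<And>t i j. AE \<omega> in M. (norm (\<xi> t i j \<omega>))\<^sup>2 \<le> \<nu>"
begin

abbreviation "PN \<equiv> past_and_noise M Hist \<xi>"
abbreviation "ce t i \<equiv> vec_cond_exp M (PN t) (v t i)"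

lemmas sub_past = subalgebra_past[where \<xi> = \<xi>, OF filtration_Hist sub_Hist \<xi>_measurable]
lemmas sub_PN_past = subalgebra_past_and_noise_past[where \<xi> = \<xi>, OF filtration_Hist sub_Hist \<xi>_measurable]
lemmas sub_Hist_PN = subalgebra_history_past_and_noise[where \<xi> = \<xi>, OF filtration_Hist sub_Hist \<xi>_measurable]
lemmas sub_PN = subalgebra_past_and_noise[where \<xi> = \<xi>, OF filtration_Hist sub_Hist \<xi>_measurable]
lemmas sub_past_Hist = subalgebra_past_history[where \<xi> = \<xi>, OF filtration_Hist sub_Hist \<xi>_measurable]

lemmas space_Hist = space_history[where \<xi> = \<xi>, OF filtration_Hist sub_Hist \<xi>_measurable]

lemma x_in_X: "\<omega> \<in> space M \<Longrightarrow> x t i \<omega> \<in> X"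
proof (cases t)
  case 0
  then show "x t i \<omega> \<in> X" if "\<omega> \<in> space M" using x_0[OF that] x0 by simp
next
  case (Suc n)
  then show "x t i \<omega> \<in> X" if "\<omega> \<in> space M" using x_Suc[OF that, of n i] by (simp add: is_arg_min_def)
qed

text \<open>\<open>x t\<close> is built from noises and subgradients before time \<open>t\<close>,
  hence \<open>past\<close>; at time 0 this is the trivial sigma-algebra and \<open>x 0\<close> is
  constant.\<close>

lemma x_measurable: "x t i \<in> borel_measurable (past M Hist t)"
proof (induction t arbitrary: i)
  case 0
  have "space (past M Hist 0) = space M" by (simp add: past_def)
  then show ?case using measurable_cong[of "past M Hist 0" "x 0 i" "\<lambda>_. x0 i" borel] x_0 by simp
next
  case (Suc t)
  have x: "x t j \<in> borel_measurable (Hist t)" for j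
    by (rule measurable_from_subalg[OF sub_past Suc])
  have sp: "space (Hist t) = space M" by (rule space_Hist)
  have "(\<lambda>\<omega>. \<Sum>j\<in>UNIV. P t $ i $ j *\<^sub>R (x t j \<omega> + r t *\<^sub>R \<xi> t i j \<omega>)) \<in> borel_measurable (Hist t)"
    using x \<xi>_measurable by measurable
  then have y: "y t i \<in> borel_measurable (Hist t)"
    by (subst measurable_cong) (auto simp: y_eq sp)
  have "x (Suc t) i \<in> borel_measurable (Hist t)"
    using compact_X xstar convex_X continuous_\<Phi>
    by (intro prox_measurable[OF mirror_map_axioms L_nonneg _ _ _ convex_chi _ \<alpha>(1) v_measurable y x_Suc]) (auto simp: sp)
  then show ?case by (simp add: past_def)
qed

text \<open>The conditional mean \<open>ce\<close> stands in for \<open>s\<close>: the two agree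
  almost surely, and \<open>ce\<close> is measurable by construction.\<close>

definition martingale_increment :: "nat \<Rightarrow> 'w \<Rightarrow> real" where
  "martingale_increment t \<omega> = (\<Sum>i\<in>UNIV. (mix (P t) (\<lambda>j. x t j \<omega>) i - xstar) \<bullet> (ce t i \<omega> - v t i \<omega>))"

lemma v_measurable_M: "v t i \<in> borel_measurable M"
  by (rule measurable_from_subalg[OF sub_Hist v_measurable])

lemma AE_norm_ce: "AE \<omega> in M. norm (ce t i \<omega>) \<le> Gf"
  by (rule AE_norm_vec_cond_exp_le[OF sub_PN v_measurable_M AE_v])

lemma ce_measurable: "ce t i \<in> borel_measurable (PN t)"
  by (rule vec_cond_exp_measurable[OF sub_PN v_measurable_M AE_v])

lemma mix_x_measurable: "(\<lambda>\<omega>. mix (P t) (\<lambda>j. x t j \<omega>) i - xstar) \<in> borel_measurable (past M Hist t)"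
  unfolding mix_def
  by (intro borel_measurable_diff borel_measurable_sum borel_measurable_scaleR borel_measurable_const x_measurable)

lemma norm_mix_x: "\<omega> \<in> space M \<Longrightarrow> norm (mix (P t) (\<lambda>j. x t j \<omega>) i - xstar) \<le> DX"
  by (intro DX mix_in_convex[OF ds convex_X] x_in_X xstar)

lemma martingale_increment_measurable: "martingale_increment t \<in> borel_measurable (Hist t)"
  unfolding martingale_increment_def
  by (rule borel_measurable_sum, rule borel_measurable_inner, rule measurable_from_subalg[OF sub_past mix_x_measurable],
    rule borel_measurable_diff, rule measurable_from_subalg[OF sub_Hist_PN ce_measurable], rule v_measurable)

lemma AE_martingale_increment_bounded: "AE \<omega> in M. \<bar>martingale_increment t \<omega>\<bar> \<le> 2 * N * Gf * DX"
proof -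
  have "AE \<omega> in M. \<forall>i. norm (ce t i \<omega>) \<le> Gf \<and> norm (v t i \<omega>) \<le> Gf"
    using AE_norm_ce AE_v by (simp add: AE_all_countable)
  with AE_space show ?thesis
  proof eventually_elim
    case (elim \<omega>)
    have "\<bar>martingale_increment t \<omega>\<bar> \<le> (\<Sum>i\<in>(UNIV::'v set). DX * (2 * Gf))"
      unfolding martingale_increment_def
    proof (rule order_trans[OF sum_abs sum_mono])
      fix i
      have "norm (ce t i \<omega> - v t i \<omega>) \<le> 2 * Gf"
        using elim(2) norm_triangle_ineq4[of "ce t i \<omega>" "v t i \<omega>"] by (smt (verit))
      then have "norm (mix (P t) (\<lambda>j. x t j \<omega>) i - xstar) * norm (ce t i \<omega> - v t i \<omega>) \<le> DX * (2 * Gf)"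
        using norm_mix_x[OF elim(1)] DX_nonneg by (intro mult_mono) auto
      then show "\<bar>(mix (P t) (\<lambda>j. x t j \<omega>) i - xstar) \<bullet> (ce t i \<omega> - v t i \<omega>)\<bar> \<le> DX * (2 * Gf)"
        using Cauchy_Schwarz_ineq2 order_trans by blast
    qed
    then show ?case by (simp add: N algebra_simps)
  qed
qed

text \<open>The mixed states are determined by the past, so they act as bounded measurable test
  vectors against the residual of the conditional mean.\<close>

lemma AE_martingale_increment_martingale: "AE \<omega> in M. real_cond_exp M (PN t) (martingale_increment t) \<omega> = 0"
proof -
  interpret sf: sigma_finite_subalgebra M "PN t" by (rule sigma_finite_subalgebraI[OF sub_PN])
  let ?h = "\<lambda>i \<omega>. (mix (P t) (\<lambda>j. x t j \<omega>) i - xstar) \<bullet> (ce t i \<omega> - v t i \<omega>)"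
  have "AE \<omega> in M. norm (mix (P t) (\<lambda>j. x t j \<omega>) i - xstar) \<le> DX" for i
    using norm_mix_x by (intro AE_I2)
  note * = vec_cond_exp_residual_orthogonal[OF sub_PN v_measurable_M AE_v
      measurable_from_subalg[OF sub_PN_past mix_x_measurable] this]
  have "AE \<omega> in M. \<forall>i. real_cond_exp M (PN t) (?h i) \<omega> = 0"
    using * by (simp add: AE_all_countable)
  moreover have "AE \<omega> in M. real_cond_exp M (PN t) (\<lambda>\<omega>. \<Sum>i\<in>UNIV. ?h i \<omega>) \<omega> = (\<Sum>i\<in>UNIV. real_cond_exp M (PN t) (?h i) \<omega>)"
    using * by (intro sf.real_cond_exp_sum)
  ultimately show ?thesis unfolding martingale_increment_def[abs_def] by eventually_elim simp
qed

lemma prob_sum_martingale_increment: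
  assumes "0 < \<delta>" "\<delta> < 1" "m \<le> T"
  shows "prob {\<omega> \<in> space M. (\<Sum>k<m. martingale_increment (a + k) \<omega>) \<le> 2 * N * Gf * DX * sqrt (2 * real T * ln (1 / \<delta>))} \<ge> 1 - \<delta>"
proof (rule azuma_hoeffding[where G = "\<lambda>k. PN (a + k)"])
  show "subalgebra M (PN (a + t))" for t by (rule sub_PN)
  show "martingale_increment (a + s) \<in> borel_measurable (PN (a + t))" if "s < t" for s t
    by (rule measurable_from_subalg[OF sub_PN_past measurable_from_subalg[OF sub_past_Hist martingale_increment_measurable]]) (use that in simp)
  show "0 \<le> 2 * N * Gf * DX" using Gf DX_nonneg by (simp add: N)
qed (use assms AE_martingale_increment_bounded AE_martingale_increment_martingale in auto)

lemma convex_objective: assumes "\<And>i. convex_on UNIV (f i)" shows "convex_on UNIV objective"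
proof -
  have *: "convex_on UNIV (\<lambda>z. \<Sum>i\<in>I. f i z + chi i z)" if "finite I" for I
    using that by (induction I) (auto intro!: convex_on_add assms convex_chi simp: convex_on_const)
  show ?thesis using *[of UNIV] by (simp add: objective_def[abs_def])
qed

theorem high_probability_bound:
  assumes convex_f: "\<And>i. convex_on UNIV (f i)" and "1 \<le> T" "0 < \<delta>" "\<delta> < 1"
  shows "prob {\<omega> \<in> space M. real T * (objective ((1 / real T) *\<^sub>R (\<Sum>t = 1..T. x t l \<omega>)) - objective xstar)
     \<le> C2 / \<alpha> T
     + (4 * mixing_time * N * sqrt N * G\<^sup>2 / \<sigma> + 2 * N * Gchi * G / \<sigma> + N * Gf\<^sup>2 / (2 * \<sigma>)) * (\<Sum>t = 1..T. \<alpha> t)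
     + 3 * N * Gf * sqrt \<nu> * (\<Sum>t = 1..T. r t)
     + C5 * (\<Sum>t = 1..T. r t / \<alpha> t) + C6 * (\<Sum>t = 1..T. (r t)\<^sup>2 / \<alpha> t)
     + 2 * N * Gf * DX * sqrt (2 * real T * ln (1 / \<delta>))} \<ge> 1 - \<delta>"
    (is "prob {\<omega> \<in> space M. ?lhs \<omega> \<le> ?c + ?E} \<ge> _")
proof -
  let ?b = "\<lambda>t. L * sqrt \<nu> * r t / \<alpha> t"
  \<comment> \<open>\<open>\<tau>\<close> depends only on the deterministic stepsizes and noise
    magnitudes, so Azuma-Hoeffding is applied over a fixed range of times.\<close>
  have "\<exists>\<tau> m. T = \<tau> + m \<and> G * real \<tau> \<le> (\<Sum>t = 1..\<tau>. ?b t) \<and> (\<forall>n\<le>m. (\<Sum>k<n. ?b (Suc \<tau> + k) - G) \<le> 0)"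
    by (rule last_time_average_ge)
  then obtain \<tau> m where *: "T = \<tau> + m \<and> G * real \<tau> \<le> (\<Sum>t = 1..\<tau>. ?b t) \<and> (\<forall>n\<le>m. (\<Sum>k<n. ?b (Suc \<tau> + k) - G) \<le> 0)"
    by (elim exE) (rule that)
  then have T: "T = \<tau> + m" and early: "G * real \<tau> \<le> (\<Sum>t = 1..\<tau>. ?b t)"
    and late: "\<And>n. n \<le> m \<Longrightarrow> (\<Sum>k<n. ?b (Suc \<tau> + k) - G) \<le> 0"
    by simp_all
  have x_M [measurable]: "x t i \<in> borel_measurable M" for t i
    by (rule measurable_from_subalg[OF sub_Hist measurable_from_subalg[OF sub_past x_measurable]])
  have objective_M [measurable]: "objective \<in> borel_measurable borel"
    by (intro borel_measurable_continuous_onI convex_on_continuous convex_objective convex_f) simp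
  have Z_M [measurable]: "martingale_increment t \<in> borel_measurable M" for t
    by (rule measurable_from_subalg[OF sub_Hist martingale_increment_measurable])
  have E: "0 \<le> ?E" using Gf DX_nonneg assms by (simp add: N)
  have "AE \<omega> in M. \<forall>t i. s t i \<omega> \<in> subdifferential (f i) (y t i \<omega>) \<and> ce t i \<omega> = s t i \<omega> \<and>
      norm (v t i \<omega>) \<le> Gf \<and> norm (ce t i \<omega>) \<le> Gf \<and> (\<forall>j. (norm (\<xi> t i j \<omega>))\<^sup>2 \<le> \<nu>)"
    using AE_s AE_cond_exp AE_v AE_norm_ce AE_\<xi> by (simp add: AE_all_countable)
  \<comment> \<open>Outside a null set the path is a deterministic run, and the only random event
    left is the size of the martingale sum.\<close>
  with AE_space have "AE \<omega> in M. (\<Sum>k<m. martingale_increment (Suc \<tau> + k) \<omega>) \<le> ?E \<longrightarrow> ?lhs \<omega> \<le> ?c + ?E"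
  proof eventually_elim
    case (elim \<omega>)
    interpret run: dscmd_run P B \<theta> \<Phi> d\<Phi> \<sigma> L X f chi xstar \<alpha> r Gf Gchi \<nu> DX DPhi N
      "\<lambda>t i. x t i \<omega>" "\<lambda>t i. y t i \<omega>" "\<lambda>t i j. \<xi> t i j \<omega>" "\<lambda>t i. v t i \<omega>" "\<lambda>t i. s t i \<omega>"
    proof
      show "norm (\<xi> t i j \<omega>) \<le> sqrt \<nu>" for t i j
        using elim(2) by (simp add: real_le_rsqrt)
      show "norm (s t i \<omega>) \<le> Gf" for t i using elim(2) by metis
    qed (use elim x_in_X y_eq x_Suc in auto)
    have "run.noise_term t = martingale_increment t \<omega>" for t
      using elim(2) by (simp add: run.noise_term_def run.ybar_def martingale_increment_def)
    then have loss: "(\<Sum>t = 1..T. objective (x t l \<omega>) - objective xstar) \<le> ?c + ?E" if "(\<Sum>k<m. martingale_increment (Suc \<tau> + k) \<omega>) \<le> ?E"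
      using that by (intro run.total_loss_le[OF T \<open>1 \<le> T\<close> early late _ E]) auto
    \<comment> \<open>Jensen's inequality passes from the averaged iterate to the average
      loss.\<close>
    have "objective (\<Sum>t = 1..T. (1 / real T) *\<^sub>R x t l \<omega>) \<le> (\<Sum>t = 1..T. 1 / real T * objective (x t l \<omega>))"
      using \<open>1 \<le> T\<close> by (intro convex_on_sum[OF _ _ convex_objective[OF convex_f]]) auto
    then have "real T * objective ((1 / real T) *\<^sub>R (\<Sum>t = 1..T. x t l \<omega>)) \<le> real T * (1 / real T * (\<Sum>t = 1..T. objective (x t l \<omega>)))"
      unfolding scaleR_sum_right sum_distrib_left[symmetric] by (intro mult_left_mono) auto
    also have "\<dots> = (\<Sum>t = 1..T. objective (x t l \<omega>))" using \<open>1 \<le> T\<close> by simp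
    finally have "?lhs \<omega> \<le> (\<Sum>t = 1..T. objective (x t l \<omega>) - objective xstar)"
      by (simp add: sum_subtractf right_diff_distrib)
    then show ?case using loss by linarith
  qed
  then have "prob {\<omega> \<in> space M. (\<Sum>k<m. martingale_increment (Suc \<tau> + k) \<omega>) \<le> ?E} \<le> prob {\<omega> \<in> space M. ?lhs \<omega> \<le> ?c + ?E}"
    by (intro finite_measure_mono_AE) auto
  moreover have "m \<le> T" using T by simp
  ultimately show ?thesis
    using prob_sum_martingale_increment[OF assms(3,4), of m T "Suc \<tau>"] by linarith
qed

end

text \<open>\<open>2 * mixing_time\<close> equals \<open>real CARD('v) * (real B / (1 - q))\<close>.
  The inequalities \<open>1 - exp u \<le> - u\<close> and \<open>ln (1 / q) \<le> 1 / q - 1\<close>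
  give \<open>1 - \<gamma> \<le> (1 - q) / (q * real B)\<close>, and a further factor
  \<open>1 / q \<ge> 1\<close> completes the power of \<open>q\<close>.\<close>

lemma (in network) mixing_time_le:
  defines "q \<equiv> 1 - \<theta> / (4 * (real CARD('v))\<^sup>2)"
  shows "2 * mixing_time \<le> real CARD('v) * (q powi (-2) / (1 - q powr (1 / real B)))"
proof -
  let ?N = "real CARD('v)"
  have N: "1 \<le> ?N" using zero_less_card_finite[where 'a='v] by linarith
  have "1 \<le> ?N\<^sup>2" using N by (rule one_le_power)
  then have "\<theta> / (4 * ?N\<^sup>2) < 1" using \<theta> by (subst divide_less_eq_1_pos) linarith+
  then have q: "0 < q" "q < 1" using \<theta> N by (auto simp: q_def)
  have B: "real B > 0" using B_ge_1 by simp
  define \<gamma> where "\<gamma> = q powr (1 / real B)"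
  have \<gamma>: "\<gamma> = exp (ln q / real B)" using q by (simp add: \<gamma>_def powr_def)
  have "ln q < 0" using q by simp
  then have *: "0 < 1 - q powr (1 / real B)"
    unfolding \<gamma>_def[symmetric] \<gamma> using B by (simp add: divide_neg_pos)
  have "1 - \<gamma> \<le> - ln q / real B" unfolding \<gamma> using exp_ge_add_one_self[of "ln q / real B"] by linarith
  also have "\<dots> \<le> (1 / q - 1) / real B"
    using ln_le_minus_one[of "1 / q"] q B by (intro divide_right_mono) (auto simp: ln_div)
  finally have \<gamma>_le: "1 - \<gamma> \<le> (1 - q) / (q * real B)" using q B by (simp add: field_simps)
  have "2 * mixing_time = ?N * (real B / (1 - q))"
    using \<theta> N by (simp add: mixing_time_def q_def field_simps power2_eq_square power3_eq_cube)
  also have "real B / (1 - q) \<le> real B / (1 - q) * (1 / q)"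
    using q B mult_left_mono[of 1 "1 / q" "real B / (1 - q)"] by simp
  also have "\<dots> = (1 / q\<^sup>2) / ((1 - q) / (q * real B))"
    using q B by (simp add: field_simps power2_eq_square)
  also have "\<dots> \<le> (1 / q\<^sup>2) / (1 - \<gamma>)"
    using \<gamma>_le * q B by (intro divide_left_mono) (auto simp: \<gamma>_def)
  finally show "2 * mixing_time \<le> ?N * (q powi (-2) / (1 - q powr (1 / real B)))"
    using N by (simp add: \<gamma>_def power_int_minus divide_inverse)
qed

section \<open>The high-probability bound\<close>

text \<open>After \<open>sqrt N\<close> is rounded up to \<open>N\<close>, the mixing term fits
  under the summand \<open>2 * N\<^sup>2 * w / (1 - g)\<close> in \<open>K\<close>; the summand
  \<open>4 * N\<close> has room for one of the two terms \<open>N * b\<close>.\<close>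

lemma (in network) mixing_constant_le:
  assumes "0 \<le> a" "0 \<le> b"
    and N: "N = real CARD('v)" and w: "w = (1 - \<theta> / (4 * N\<^sup>2)) powi (-2)"
    and g: "g = (1 - \<theta> / (4 * N\<^sup>2)) powr (1 / real B)"
  defines "K \<equiv> (4 * N + 2 * N\<^sup>2 * w / (1 - g)) * ((N + 1) * a + N * b)"
  shows "4 * mixing_time * N * sqrt N * (a + b) + 2 * N * b \<le> K + N * b"
    and "4 * N * a \<le> K" and "0 \<le> w / (1 - g)"
proof -
  have N1: "1 \<le> N" using zero_less_card_finite[where 'a='v] unfolding N by linarith
  define W where "W = w / (1 - g)"
  have W: "2 * mixing_time \<le> N * W" using mixing_time_le by (simp add: W_def w g N)
  have W0: "0 \<le> W"
  proof -
    have "0 < N * W" using W mixing_time_pos by linarith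
    then show ?thesis using N1 by (simp add: zero_less_mult_iff)
  qed
  then show "0 \<le> w / (1 - g)" by (simp add: W_def)
  have "N * (a + b) \<le> (N + 1) * a + N * b" using assms(1) by (simp add: algebra_simps)
  moreover have K: "K = (4 * N + 2 * N\<^sup>2 * W) * ((N + 1) * a + N * b)" by (simp add: K_def W_def)
  ultimately have K_ge: "(4 * N + 2 * N\<^sup>2 * W) * (N * (a + b)) \<le> K"
    unfolding K using N1 W0 by (intro mult_left_mono) auto
  have "sqrt N \<le> N" using N1 by (intro real_le_lsqrt) (auto simp: power2_eq_square)
  then have "4 * mixing_time * N * sqrt N * (a + b) \<le> 4 * mixing_time * N * N * (a + b)"
    using N1 mixing_time_pos assms(1,2) by (intro mult_right_mono mult_left_mono) auto
  also have "\<dots> = (2 * mixing_time) * (2 * N\<^sup>2 * (a + b))" by (simp add: power2_eq_square algebra_simps)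
  also have "\<dots> \<le> (N * W) * (2 * N\<^sup>2 * (a + b))" using W assms(1,2) by (intro mult_right_mono) auto
  also have "\<dots> = 2 * N\<^sup>2 * W * (N * (a + b))" by (simp add: algebra_simps)
  finally have 1: "4 * mixing_time * N * sqrt N * (a + b) \<le> 2 * N\<^sup>2 * W * (N * (a + b))" .
  have "1 * (N * b) \<le> 4 * N * (N * (a + b))"
    using N1 assms(1,2) by (intro mult_mono) (auto simp: distrib_left)
  with 1 K_ge show "4 * mixing_time * N * sqrt N * (a + b) + 2 * N * b \<le> K + N * b"
    unfolding distrib_right[of "4 * N"] by linarith
  have "1 * a \<le> N * (a + b)" using N1 assms(1,2) by (intro mult_mono) auto
  then have "4 * N * a \<le> 4 * N * (N * (a + b))" using N1 by (intro mult_left_mono) auto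
  moreover have "0 \<le> 2 * N\<^sup>2 * W * (N * (a + b))" using N1 W0 assms(1,2) by simp
  ultimately show "4 * N * a \<le> K" using K_ge unfolding distrib_right[of "4 * N"] by linarith
qed

text \<open>Strong convexity is applied to a pair of points attaining the diameter.\<close>

lemma (in mirror_map) diameter_le_bregman_radius:
  assumes "compact X" "X \<noteq> {}" and R: "0 \<le> R" "\<And>a b. a \<in> X \<Longrightarrow> b \<in> X \<Longrightarrow> D a b \<le> R\<^sup>2"
  shows "diameter X \<le> sqrt (2 / \<sigma>) * R"
proof -
  obtain a b where ab: "a \<in> X" "b \<in> X" "dist a b = diameter X"
    using diameter_compact_attained[OF assms(1,2)] by blast
  have "\<sigma> / 2 * (dist a b)\<^sup>2 \<le> R\<^sup>2"
    using bregman_ge[of a b] R(2)[OF ab(1,2)] by (simp add: dist_norm)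
  then have "(dist a b)\<^sup>2 \<le> 2 / \<sigma> * R\<^sup>2" using \<sigma>_pos by (simp add: field_simps)
  then have "dist a b \<le> sqrt (2 / \<sigma> * R\<^sup>2)" by (rule real_le_rsqrt)
  moreover have "sqrt (2 / \<sigma> * R\<^sup>2) = sqrt (2 / \<sigma>) * R"
    using real_sqrt_mult[of "2 / \<sigma>" "R\<^sup>2"] real_sqrt_abs[of R] abs_of_nonneg[OF R(1)] by presburger
  ultimately show ?thesis using ab(3) by linarith
qed

lemma bdd_above_bregman:
  assumes "compact X" "continuous_on UNIV \<Phi>" "continuous_on UNIV d\<Phi>"
  shows "bdd_above {bregman \<Phi> d\<Phi> a b | a b. a \<in> X \<and> b \<in> X}"
proof -
  have *: "continuous_on (X \<times> X) (\<lambda>p. \<Phi> (fst p))" "continuous_on (X \<times> X) (\<lambda>p. \<Phi> (snd p))"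
    "continuous_on (X \<times> X) (\<lambda>p. d\<Phi> (snd p))"
    by (rule continuous_on_compose2[OF assms(2) continuous_on_fst[OF continuous_on_id]] continuous_on_compose2[OF assms(2) continuous_on_snd[OF continuous_on_id]]
      continuous_on_compose2[OF assms(3) continuous_on_snd[OF continuous_on_id]], simp)+
  have "continuous_on (X \<times> X) (\<lambda>p. bregman \<Phi> d\<Phi> (fst p) (snd p))"
    unfolding bregman_def by (intro continuous_intros *)
  then have "compact ((\<lambda>p. bregman \<Phi> d\<Phi> (fst p) (snd p)) ` (X \<times> X))"
    by (intro compact_continuous_image compact_Times assms)
  moreover have "(\<lambda>p. bregman \<Phi> d\<Phi> (fst p) (snd p)) ` (X \<times> X) = {bregman \<Phi> d\<Phi> a b | a b. a \<in> X \<and> b \<in> X}"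
    by force
  ultimately show ?thesis using compact_imp_bounded bounded_imp_bdd_above by metis
qed

theorem theorem2:
  fixes X :: "(real^'n) set"
    and f chi :: "'v::finite \<Rightarrow> real^'n \<Rightarrow> real"
    and F :: "real^'n \<Rightarrow> real"
    and xstar :: "real^'n"
    and \<Phi> :: "real^'n \<Rightarrow> real" and d\<Phi> :: "real^'n \<Rightarrow> real^'n"
    and M :: "'w measure" and Hist :: "nat \<Rightarrow> 'w measure"
    and P :: "nat \<Rightarrow> real^'v^'v"
    and \<xi> :: "nat \<Rightarrow> 'v \<Rightarrow> 'v \<Rightarrow> 'w \<Rightarrow> real^'n"
    and gtilde :: "nat \<Rightarrow> 'v \<Rightarrow> real^'n \<Rightarrow> 'w \<Rightarrow> real^'n"
    and g :: "'v \<Rightarrow> real^'n \<Rightarrow> real^'n"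
    and x0 :: "'v \<Rightarrow> real^'n"
    and x y :: "nat \<Rightarrow> 'v \<Rightarrow> 'w \<Rightarrow> real^'n"
    and \<alpha> r :: "nat \<Rightarrow> real"
    and B T :: nat
    and N \<sigma> L \<theta> \<nu> Gf Gchi DX DPhi \<omega>c \<gamma>c C1 C2 C3 C4 C5 C6 \<delta> :: real
    and l :: 'v
  \<comment> \<open>problem\<close>
  assumes "X \<noteq> {}" and "convex X" and "compact X"
    and "\<And>i. convex_on UNIV (f i)" and "\<And>i. convex_on UNIV (chi i)"
    and "\<And>z. F z = (\<Sum>i\<in>UNIV. f i z + chi i z)"
    and "is_arg_min F (\<lambda>z. z \<in> X) xstar"
  \<comment> \<open>mirror map\<close>
    and "\<And>z. GDERIV \<Phi> z :> d\<Phi> z" and "continuous_on UNIV d\<Phi>"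
    and "\<sigma> > 0"
    and "\<And>a b. \<Phi> a \<ge> \<Phi> b + d\<Phi> b \<bullet> (a - b) + \<sigma> / 2 * (norm (a - b))\<^sup>2"
    and "\<And>a b. norm (d\<Phi> a - d\<Phi> b) \<le> L * norm (a - b)"
    and "\<And>a (b :: 'v \<Rightarrow> real^'n) w. (\<forall>i. w i \<in> {0..1}) \<Longrightarrow> (\<Sum>i\<in>UNIV. w i) = 1 \<Longrightarrow>
           bregman \<Phi> d\<Phi> a (\<Sum>i\<in>UNIV. w i *\<^sub>R b i) \<le> (\<Sum>i\<in>UNIV. w i * bregman \<Phi> d\<Phi> a (b i))"
  \<comment> \<open>network\<close>
    and "\<And>t. doubly_stochastic (P t)"
    and "B \<ge> 1"
    and "\<And>s. strongly_connected
           (with_proj \<lparr>pverts = UNIV, parcs = (\<Union>t\<in>{s * B + 1..(s + 1) * B}. edges (P t))\<rparr>)"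
    and "0 < \<theta>" and "\<theta> < 1"
    and "\<And>t i. P t $ i $ i \<ge> \<theta>"
    and "\<And>t i j. (j, i) \<in> edges (P t) \<Longrightarrow> P t $ i $ j \<ge> \<theta>"
  \<comment> \<open>probability space, history, adaptedness\<close>
    and "prob_space M"
    and "filtration (space M) Hist" and "\<And>t. subalgebra M (Hist t)"
    and "\<And>t i j. \<xi> t i j \<in> borel_measurable (Hist t)"
    and "\<And>t i. (\<lambda>\<omega>. gtilde t i (y t i \<omega>) \<omega>) \<in> borel_measurable (Hist t)"
    and "\<And>t i z. z \<in> X \<Longrightarrow> gtilde t i z \<in> borel_measurable M"
  \<comment> \<open>algorithm\<close>
    and "\<And>t. \<alpha> t > 0" and "decseq \<alpha>" and "\<And>t. r t > 0" and "decseq r"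
    and "\<And>i. x0 i \<in> X" and "\<And>i \<omega>. \<omega> \<in> space M \<Longrightarrow> x 0 i \<omega> = x0 i"
    and "\<And>t i \<omega>. \<omega> \<in> space M \<Longrightarrow>
           y t i \<omega> = (\<Sum>j\<in>UNIV. P t $ i $ j *\<^sub>R (x t j \<omega> + r t *\<^sub>R \<xi> t i j \<omega>))"
    and "\<And>t i \<omega>. \<omega> \<in> space M \<Longrightarrow>
           is_arg_min
             (\<lambda>z. gtilde t i (y t i \<omega>) \<omega> \<bullet> z + 1 / \<alpha> t * bregman \<Phi> d\<Phi> z (y t i \<omega>) + chi i z)
             (\<lambda>z. z \<in> X) (x (Suc t) i \<omega>)"
  \<comment> \<open>stochastic subgradients\<close>
    and "Gf \<ge> 0"
    and "\<And>i z. z \<in> X \<Longrightarrow> g i z \<in> subdifferential (f i) z"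
    and "\<And>t i z. z \<in> X \<Longrightarrow> AE \<omega> in M. vec_cond_exp M (past M Hist t) (gtilde t i z) \<omega> = g i z"
    and "\<And>t i z. z \<in> X \<Longrightarrow>
           AE \<omega> in M. nn_cond_exp M (past M Hist t) (\<lambda>\<omega>. ennreal ((norm (gtilde t i z \<omega>))\<^sup>2)) \<omega>
             \<le> ennreal (Gf\<^sup>2)"
    and "\<And>t i. AE \<omega> in M. g i (y t i \<omega>) \<in> subdifferential (f i) (y t i \<omega>)"
    and "\<And>t i. AE \<omega> in M.
           vec_cond_exp M (past_and_noise M Hist \<xi> t) (\<lambda>\<omega>. gtilde t i (y t i \<omega>) \<omega>) \<omega>
             = g i (y t i \<omega>)"
    and "\<And>t i. AE \<omega> in M.
           nn_cond_exp M (past_and_noise M Hist \<xi> t)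
             (\<lambda>\<omega>. ennreal ((norm (gtilde t i (y t i \<omega>) \<omega>))\<^sup>2)) \<omega> \<le> ennreal (Gf\<^sup>2)"
  \<comment> \<open>noise\<close>
    and "\<And>t i j i' j'. i \<noteq> i' \<Longrightarrow> j \<noteq> j' \<Longrightarrow>
           prob_space.indep_var M borel (\<xi> t i j) borel (\<xi> t i' j')"
    and "\<And>t i j. AE \<omega> in M.
           nn_cond_exp M (past M Hist t) (\<lambda>\<omega>. ennreal ((norm (\<xi> t i j \<omega>))\<^sup>2)) \<omega> \<le> ennreal \<nu>"
  \<comment> \<open>additional almost sure bounds\<close>
    and "\<And>t i. AE \<omega> in M. norm (gtilde t i (y t i \<omega>) \<omega>) \<le> Gf"
    and "\<And>t i j. AE \<omega> in M. (norm (\<xi> t i j \<omega>))\<^sup>2 \<le> \<nu>"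
  \<comment> \<open>constants\<close>
    and "N = real CARD('v)"
    and "Gchi = (MAX i\<in>UNIV. Sup {norm s | s z. z \<in> X \<and> s \<in> subdifferential (chi i) z})"
    and "DX = diameter X"
    and "DPhi \<ge> 0" and "DPhi\<^sup>2 = Sup {bregman \<Phi> d\<Phi> a b | a b. a \<in> X \<and> b \<in> X}"
    and "\<omega>c = (1 - \<theta> / (4 * N\<^sup>2)) powi (-2)"
    and "\<gamma>c = (1 - \<theta> / (4 * N\<^sup>2)) powr (1 / real B)"
    and "C1 = 2 * N * \<omega>c / (1 - \<gamma>c) * ((N + 1) * Gf + N * Gchi) * (\<Sum>j\<in>UNIV. norm (x0 j))"
    and "C2 = N * DPhi\<^sup>2"
    and "C3 = ((4 * N + 2 * N\<^sup>2 * \<omega>c / (1 - \<gamma>c)) * ((N + 1) * Gf + N * Gchi) + N * Gchi)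
                * ((Gf + Gchi) / \<sigma>) + N * Gf\<^sup>2 / (2 * \<sigma>)"
    and "C4 = (4 * N + 2 * N\<^sup>2 * \<omega>c / (1 - \<gamma>c)) * ((N + 1) * Gf + N * Gchi) * N * sqrt \<nu>
                + (Gf + Gchi) * N\<^sup>2 * sqrt \<nu>"
    and "C5 = sqrt (2 / \<sigma>) * DPhi * L * N * sqrt \<nu>"
    and "C6 = N * L * \<nu>"
  \<comment> \<open>horizon and confidence level\<close>
    and "T \<ge> 1" and "0 < \<delta>" and "\<delta> < 1"
  shows "measure M {\<omega> \<in> space M.
           F ((1 / real T) *\<^sub>R (\<Sum>t = 1..T. x t l \<omega>)) - F xstar
             \<le> C1 / T + C2 / (T * \<alpha> T)
                + C3 / T * (\<Sum>t = 0..T. \<alpha> t)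
                + C4 / T * (\<Sum>t = 0..T. r t)
                + C5 / T * (\<Sum>t = 0..T. r t / \<alpha> t)
                + C6 / T * (\<Sum>t = 0..T. (r t)\<^sup>2 / \<alpha> t)
                + 2 * sqrt 2 * Gf * DX * N * (sqrt (ln (1 / \<delta>)) / sqrt T)} \<ge> 1 - \<delta>"
proof -
  interpret prob_space M by (rule assms(21))
  interpret mirror_map \<Phi> d\<Phi> \<sigma> L
    by unfold_locales (fact assms)+
  interpret network P B \<theta>
    by unfold_locales (fact assms)+
  have "isCont \<Phi> z" for z
    using assms(8)[of z] unfolding gderiv_def by (rule has_derivative_continuous)
  then have cont_\<Phi>: "continuous_on UNIV \<Phi>" by (simp add: continuous_at_imp_continuous_on)
  have xstar: "xstar \<in> X" using assms(7) by (simp add: is_arg_min_def)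
  \<comment> \<open>Taken at time 1, where \<open>past\<close> is \<open>Hist 0\<close> and hence a
    subalgebra by assumption; \<open>g i z\<close> does not depend on the time.\<close>
  have g_le: "norm (g i z) \<le> Gf" if "z \<in> X" for i z
    using norm_cond_mean_le_of_second_moment[OF assms(23)[of 0] assms(26)[OF that, of 1 i], of "g i z" Gf]
      assms(37)[OF that, of 1 i] assms(38)[OF that, of 1 i] assms(35) by (simp add: past_def)
  have f_diff: "f i a - f i b \<le> Gf * norm (a - b)" if "a \<in> X" for i a b
    by (rule subgradient_norm_le_imp_diff_le[OF assms(36)[OF that] g_le[OF that]])
  let ?S = "\<lambda>i. Sup {norm s | s z. z \<in> X \<and> s \<in> subdifferential (chi i) z}"
  have S_le: "?S i \<le> Gchi" for i unfolding assms(47) by (rule Max_ge) auto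
  have Gchi: "0 \<le> Gchi"
    using S_le[of undefined] Sup_subgradient_norms_nonneg[OF assms(5,3,1), of undefined] by linarith
  have chi_diff: "chi i a - chi i b \<le> Gchi * norm (a - b)" if "a \<in> X" for i a b
    using convex_diff_le_Sup_subgradient_norms[OF assms(5,3) that, of i b] mult_right_mono[OF S_le[of i] norm_ge_zero[of "a - b"]]
    by linarith
  \<comment> \<open>A constant inequality that holds almost surely on a probability space holds
    outright.\<close>
  have \<nu>: "0 \<le> \<nu>"
  proof -
    have "AE \<omega> in M. 0 \<le> \<nu>"
      using assms(45)[of 0 undefined undefined] by (rule eventually_mono) (rule order_trans[OF zero_le_power2])
    then show ?thesis by simp
  qed
  have DX_ge: "norm (a - b) \<le> DX" if "a \<in> X" "b \<in> X" for a b
    using diameter_bounded_bound[OF compact_imp_bounded[OF assms(3)] that] by (simp add: assms(48) dist_norm)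
  have DPhi_ge: "bregman \<Phi> d\<Phi> a b \<le> DPhi\<^sup>2" if "a \<in> X" "b \<in> X" for a b
    unfolding assms(50) using that by (intro cSup_upper bdd_above_bregman assms(3,9) cont_\<Phi>) auto
  have DX_le: "DX \<le> sqrt (2 / \<sigma>) * DPhi"
    unfolding assms(48) by (rule diameter_le_bregman_radius[OF assms(3,1,49) DPhi_ge])
  interpret dscmd P B \<theta> \<Phi> d\<Phi> \<sigma> L X f chi xstar \<alpha> r Gf Gchi \<nu> DX DPhi N
    by (rule dscmd.intro[OF network_axioms mirror_map_axioms dscmd_axioms.intro], rule assms(46), rule assms(2), rule xstar, (rule assms(13); assumption), rule assms(5),
      rule assms(27), rule assms(28), rule assms(29), (rule f_diff; assumption), (rule chi_diff; assumption),
      rule assms(35), rule Gchi, rule \<nu>, (rule DX_ge; assumption), rule assms(49), (rule DPhi_ge; assumption), rule DX_le)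
  interpret dscmd_process P B \<theta> \<Phi> d\<Phi> \<sigma> L X f chi xstar \<alpha> r Gf Gchi \<nu> DX DPhi N M Hist \<xi>
    "\<lambda>t i \<omega>. gtilde t i (y t i \<omega>) \<omega>" "\<lambda>t i \<omega>. g i (y t i \<omega>)" x y x0
    by (rule dscmd_process.intro[OF dscmd_axioms prob_space_axioms dscmd_process_axioms.intro], rule assms(3), rule cont_\<Phi>, rule assms(22), rule assms(23), rule assms(24), rule assms(25),
      rule assms(31), (rule assms(32); assumption), (rule assms(33); assumption), (rule assms(34); assumption),
      rule assms(39), rule assms(40), rule assms(44), rule assms(45))
  have F_eq: "dscmd.objective f chi = F"
    by (simp add: fun_eq_iff assms(6) objective_def)
  have N: "1 \<le> N" using zero_less_card_finite[where 'a='v] unfolding assms(46) by linarith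
  have T: "0 < real T" using assms(59) by simp
  define E where "E = 2 * N * Gf * DX * sqrt (2 * real T * ln (1 / \<delta>))"
  define c3 where "c3 = 4 * mixing_time * N * sqrt N * (Gf + Gchi)\<^sup>2 / \<sigma> + 2 * N * Gchi * (Gf + Gchi) / \<sigma> + N * Gf\<^sup>2 / (2 * \<sigma>)"
  define b where "b = C2 / \<alpha> T + c3 * (\<Sum>t = 1..T. \<alpha> t) + 3 * N * Gf * sqrt \<nu> * (\<Sum>t = 1..T. r t)
     + C5 * (\<Sum>t = 1..T. r t / \<alpha> t) + C6 * (\<Sum>t = 1..T. (r t)\<^sup>2 / \<alpha> t) + E"
  define K where "K = (4 * N + 2 * N\<^sup>2 * \<omega>c / (1 - \<gamma>c)) * ((N + 1) * Gf + N * Gchi)"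
  note K = mixing_constant_le[OF assms(35) Gchi assms(46,51,52), folded K_def]
  let ?avg = "\<lambda>\<omega>. F ((1 / real T) *\<^sub>R (\<Sum>t = 1..T. x t l \<omega>)) - F xstar"
  let ?R = "C1 / T + C2 / (T * \<alpha> T) + C3 / T * (\<Sum>t = 0..T. \<alpha> t) + C4 / T * (\<Sum>t = 0..T. r t)
    + C5 / T * (\<Sum>t = 0..T. r t / \<alpha> t) + C6 / T * (\<Sum>t = 0..T. (r t)\<^sup>2 / \<alpha> t)
    + 2 * sqrt 2 * Gf * DX * N * (sqrt (ln (1 / \<delta>)) / sqrt T)"
  have hp: "1 - \<delta> \<le> prob {\<omega> \<in> space M. real T * ?avg \<omega> \<le> b}"
    using high_probability_bound[OF assms(4,59-61), of l]
    unfolding F_eq b_def c3_def E_def assms(54,57,58) .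
  \<comment> \<open>The losses are summed from time 1; adding the nonnegative term at time 0 only
    enlarges the bound.\<close>
  have sum_le: "(\<Sum>t = 1..T. h t) \<le> (\<Sum>t = 0..T. h t)" if "\<And>t. 0 \<le> h t" for h :: "nat \<Rightarrow> real"
    by (rule sum_mono2) (use that in auto)
  have pos: "0 \<le> \<alpha> t" "0 \<le> r t" for t using assms(27,29) by (auto intro: less_imp_le)
  have c3: "c3 \<le> C3" "0 \<le> C3"
  proof -
    have "c3 = (4 * mixing_time * N * sqrt N * (Gf + Gchi) + 2 * N * Gchi) * ((Gf + Gchi) / \<sigma>) + N * Gf\<^sup>2 / (2 * \<sigma>)"
    proof -
      have "(a + b) * (h / \<sigma>) = a * h / \<sigma> + b * h / \<sigma>" for a b h :: real
        by (simp add: add_divide_distrib distrib_right)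
      then show ?thesis unfolding c3_def power2_eq_square by (simp only: mult.assoc)
    qed
    also have "\<dots> \<le> (K + N * Gchi) * ((Gf + Gchi) / \<sigma>) + N * Gf\<^sup>2 / (2 * \<sigma>)"
      using assms(10,35) Gchi by (intro add_right_mono mult_right_mono K(1)) auto
    also have "\<dots> = C3" unfolding assms(55) K_def ..
    finally show "c3 \<le> C3" .
    moreover have "0 \<le> c3"
      unfolding c3_def using assms(10,35) Gchi N mixing_time_pos by simp
    ultimately show "0 \<le> C3" by linarith
  qed
  \<comment> \<open>The coefficient 3 is covered by the 4 in \<open>4 * N * Gf \<le> K\<close>, with
    a further factor \<open>N \<ge> 1\<close>.\<close>
  have c4: "3 * N * Gf * sqrt \<nu> \<le> C4" "0 \<le> C4"
  proof -
    have "3 * N * Gf * sqrt \<nu> \<le> (4 * N * Gf) * N * sqrt \<nu>"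
      using N assms(35) \<nu> mult_right_mono[of 3 "4 * N" "N * Gf"] by (intro mult_right_mono) (auto simp: algebra_simps)
    also have "\<dots> \<le> K * N * sqrt \<nu>" using N \<nu> by (intro mult_right_mono K(2)) auto
    also have "\<dots> \<le> C4" unfolding assms(56) K_def using assms(35) Gchi N \<nu> by simp
    finally show "3 * N * Gf * sqrt \<nu> \<le> C4" .
    moreover have "0 \<le> 3 * N * Gf * sqrt \<nu>" using assms(35) N \<nu> by simp
    ultimately show "0 \<le> C4" by linarith
  qed
  have c: "0 \<le> C5" "0 \<le> C6" using N \<nu> L_nonneg assms(10,49) by (simp_all add: assms(57,58))
  have "0 \<le> C1"
  proof -
    have "0 \<le> 2 * N * (\<omega>c / (1 - \<gamma>c)) * ((N + 1) * Gf + N * Gchi) * (\<Sum>j\<in>UNIV. norm (x0 j))"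
      using N assms(35) Gchi K(3) by (intro mult_nonneg_nonneg add_nonneg_nonneg sum_nonneg) auto
    then show ?thesis by (simp add: assms(53))
  qed
  moreover have "c3 * (\<Sum>t = 1..T. \<alpha> t) \<le> C3 * (\<Sum>t = 0..T. \<alpha> t)"
    using pos c3 by (intro mult_mono sum_le sum_nonneg) auto
  moreover have "3 * N * Gf * sqrt \<nu> * (\<Sum>t = 1..T. r t) \<le> C4 * (\<Sum>t = 0..T. r t)"
    using pos c4 by (intro mult_mono sum_le sum_nonneg) auto
  moreover have "C5 * (\<Sum>t = 1..T. r t / \<alpha> t) \<le> C5 * (\<Sum>t = 0..T. r t / \<alpha> t)"
    using pos c by (intro mult_left_mono sum_le) auto
  moreover have "C6 * (\<Sum>t = 1..T. (r t)\<^sup>2 / \<alpha> t) \<le> C6 * (\<Sum>t = 0..T. (r t)\<^sup>2 / \<alpha> t)"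
    using pos c by (intro mult_left_mono sum_le) auto
  ultimately have "b \<le> C1 + C2 / \<alpha> T + C3 * (\<Sum>t = 0..T. \<alpha> t) + C4 * (\<Sum>t = 0..T. r t)
      + C5 * (\<Sum>t = 0..T. r t / \<alpha> t) + C6 * (\<Sum>t = 0..T. (r t)\<^sup>2 / \<alpha> t) + E"
    unfolding b_def by linarith
  then have "b / T \<le> (C1 + C2 / \<alpha> T + C3 * (\<Sum>t = 0..T. \<alpha> t) + C4 * (\<Sum>t = 0..T. r t)
      + C5 * (\<Sum>t = 0..T. r t / \<alpha> t) + C6 * (\<Sum>t = 0..T. (r t)\<^sup>2 / \<alpha> t) + E) / T"
    using T by (intro divide_right_mono) auto
  also have "\<dots> = ?R"
  proof -
    have "sqrt (real T) * sqrt (real T) = real T" using T by simp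
    then have "E / T = 2 * sqrt 2 * Gf * DX * N * (sqrt (ln (1 / \<delta>)) / sqrt T)"
      unfolding E_def real_sqrt_mult using T by (simp add: field_simps)
    then show ?thesis by (simp only: add_divide_distrib times_divide_eq_left divide_divide_eq_left mult.commute[of "\<alpha> T"])
  qed
  finally have b_le: "b / T \<le> ?R" .
  have [measurable]: "x t l \<in> borel_measurable M" for t
    by (rule measurable_from_subalg[OF sub_Hist measurable_from_subalg[OF sub_past x_measurable]])
  have "F \<in> borel_measurable borel"
    using convex_objective[OF assms(4)] unfolding F_eq
    by (intro borel_measurable_continuous_onI convex_on_continuous) auto
  note [measurable] = this
  have "prob {\<omega> \<in> space M. real T * ?avg \<omega> \<le> b} \<le> prob {\<omega> \<in> space M. ?avg \<omega> \<le> ?R}"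
  proof (rule finite_measure_mono)
    show "{\<omega> \<in> space M. ?avg \<omega> \<le> ?R} \<in> events" by measurable
    show "{\<omega> \<in> space M. real T * ?avg \<omega> \<le> b} \<subseteq> {\<omega> \<in> space M. ?avg \<omega> \<le> ?R}"
    proof clarify
      fix \<omega> assume "real T * ?avg \<omega> \<le> b"
      then have "?avg \<omega> \<le> b / T" using T by (simp add: pos_le_divide_eq mult.commute)
      then show "?avg \<omega> \<le> ?R" using b_le by linarith
    qed
  qed
  with hp show ?thesis by linarith
qed

end
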